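(* Suppose that for some constants $\varepsilon>0$ and $\delta>0$ there is an $O(m^{2-\varepsilon})$ time algorithm that computes a $(2-\delta)$-approximation of the girth in an $m$-edge directed graph. Then for every constant $k$, one can detect whether an $m$-edge directed graph contains a $k$-cycle in $O(m^{2-\varepsilon})$ time, and hence the $k$-Cycle Hypothesis is false.
   Context: The girth of a directed graph is the length of its shortest directed cycle (cycles contain at least two distinct vertices; graphs have no self-loops; the girth is $\infty$ if there is no cycle). For $c\ge 1$, a $c$-approximation of the girth $g$ is a value $\hat g$ with $g\le \hat g\le c\cdot g$. A $k$-cycle is a directed simple cycle on $k$ vertices. $k$-Cycle Hypothesis: in the word-RAM model with $O(\log m)$-bit words, for any constant $\varepsilon>0$ there exists a constant integer $k$ such that there is no $O(m^{2-\varepsilon})$ time algorithm that detects whether an $m$-edge directed unweighted graph contains a $k$-cycle. *)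

theory Defs
  imports
    Complex_Main
    "HOL-Library.Extended_Real"
    "HOL-Library.Landau_Symbols"
    "HOL-Probability.Probability_Mass_Function"
    "Graph_Theory.Graph_Theory"
begin

section \<open>Directed cycles and girth\<close>

text \<open>
  A \<open>pair_digraph\<close> is a finite directed graph without self-loops whose arcs are ordered pairs,
  so antiparallel arcs are allowed and parallel ones are not.  The library's \<open>cycle\<close> is a simple
  directed cycle given by its list of arcs; its length is the number of its vertices, and since
  there are no self-loops this is at least 2.
\<close>

definition has_k_cycle :: "nat \<Rightarrow> 'a pair_pre_digraph \<Rightarrow> bool" where
  "has_k_cycle k G \<longleftrightarrow> (\<exists>p. pre_digraph.cycle (with_proj G) p \<and> length p = k)"

text \<open>The infimum of the empty set is \<open>\<infinity>\<close>, the girth of an acyclic graph.\<close>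

definition girth :: "'a pair_pre_digraph \<Rightarrow> enat" where
  "girth G = Inf {enat (length p) | p. pre_digraph.cycle (with_proj G) p}"

definition girth_approximation :: "real \<Rightarrow> 'a pair_pre_digraph \<Rightarrow> enat \<Rightarrow> bool" where
  "girth_approximation c G g' \<longleftrightarrow>
     girth G \<le> g' \<and> ereal_of_enat g' \<le> ereal c * ereal_of_enat (girth G)"


section \<open>The word RAM\<close>

text \<open>
  A program uses finitely many registers and a random access memory.  Programs are written with
  structured control flow; each instruction and each test of a branch or a loop costs one step.
\<close>

datatype binop =
  Add | Sub | Mul | Div | Mod | BitAnd | BitOr | BitXor | ShiftL | ShiftR | Less | Equal

fun binop_sem :: "binop \<Rightarrow> nat \<Rightarrow> nat \<Rightarrow> nat" where
  "binop_sem Add x y = x + y"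
| "binop_sem Sub x y = x - y"
| "binop_sem Mul x y = x * y"
| "binop_sem Div x y = x div y"
| "binop_sem Mod x y = x mod y"
| "binop_sem BitAnd x y = Bit_Operations.and x y"
| "binop_sem BitOr x y = Bit_Operations.or x y"
| "binop_sem BitXor x y = Bit_Operations.xor x y"
| "binop_sem ShiftL x y = push_bit y x"
| "binop_sem ShiftR x y = drop_bit y x"
| "binop_sem Less x y = (if x < y then 1 else 0)"
| "binop_sem Equal x y = (if x = y then 1 else 0)"

type_synonym reg = nat

datatype prog =
    Skip
  | SetConst reg nat
  | BinOp reg binop reg reg   \<comment> \<open>the first register is the destination\<close>
  | Load reg reg              \<comment> \<open>\<open>Load r a\<close>: register \<open>r\<close> gets the memory cell addressed by \<open>a\<close>\<close>
  | Store reg reg             \<comment> \<open>\<open>Store a r\<close>: the memory cell addressed by \<open>a\<close> gets register \<open>r\<close>\<close>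
  | Rand reg reg              \<comment> \<open>\<open>Rand r b\<close>: register \<open>r\<close> gets a uniform number below register \<open>b\<close>\<close>
  | Seq prog prog
  | IfNonzero reg prog prog
  | WhileNonzero reg prog

record state =
  regs :: "reg \<Rightarrow> nat"
  mem :: "nat \<Rightarrow> nat"

definition set_reg :: "reg \<Rightarrow> nat \<Rightarrow> state \<Rightarrow> state" where
  "set_reg r x s = s\<lparr>regs := (regs s)(r := x)\<rparr>"

definition set_mem :: "nat \<Rightarrow> nat \<Rightarrow> state \<Rightarrow> state" where
  "set_mem a x s = s\<lparr>mem := (mem s)(a := x)\<rparr>"

text \<open>A configuration whose program is \<open>Skip\<close> has halted; it steps to itself.\<close>

fun step :: "prog \<Rightarrow> state \<Rightarrow> (prog \<times> state) pmf" where
  "step Skip s = return_pmf (Skip, s)"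
| "step (SetConst r x) s = return_pmf (Skip, set_reg r x s)"
| "step (BinOp r f a b) s =
     return_pmf (Skip, set_reg r (binop_sem f (regs s a) (regs s b)) s)"
| "step (Load r a) s = return_pmf (Skip, set_reg r (mem s (regs s a)) s)"
| "step (Store a r) s = return_pmf (Skip, set_mem (regs s a) (regs s r) s)"
| "step (Rand r b) s =
     (if regs s b = 0 then return_pmf (Skip, set_reg r 0 s)
      else map_pmf (\<lambda>x. (Skip, set_reg r x s)) (pmf_of_set {..<regs s b}))"
| "step (Seq P Q) s =
     (if P = Skip then return_pmf (Q, s)
      else map_pmf (\<lambda>(P', s'). (Seq P' Q, s')) (step P s))"
| "step (IfNonzero r P Q) s = return_pmf (if regs s r \<noteq> 0 then P else Q, s)"
| "step (WhileNonzero r P) s =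
     return_pmf (if regs s r \<noteq> 0 then Seq P (WhileNonzero r P) else Skip, s)"

primrec run :: "nat \<Rightarrow> prog \<Rightarrow> state \<Rightarrow> (prog \<times> state) pmf" where
  "run 0 P s = return_pmf (P, s)"
| "run (Suc t) P s = bind_pmf (run t P s) (\<lambda>(P', s'). step P' s')"

text \<open>
  With \<open>w\<close>-bit words, every register, memory cell and hence every address in use is below \<open>2 ^ w\<close>.
  Arithmetic does not wrap around: a program must keep its values in this range.  As the constant
  factor in the word size belongs to the algorithm, and reduction modulo \<open>2 ^ w\<close> is available as
  an operation, this only affects constants.
\<close>

definition fits :: "nat \<Rightarrow> state \<Rightarrow> bool" where
  "fits w s \<longleftrightarrow> (\<forall>r. regs s r < 2 ^ w) \<and> (\<forall>a. mem s a < 2 ^ w)"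

definition word_size :: "nat \<Rightarrow> nat \<Rightarrow> nat" where
  "word_size c m = c * nat \<lceil>log 2 (real m + 2)\<rceil>"


section \<open>Algorithms on directed graphs\<close>

text \<open>
  The input is an arbitrarily ordered list of the arcs of a graph with vertices \<open>0, \<dots>, n - 1\<close>.
  There are no isolated vertices, as otherwise neither the number of vertices nor the size of a
  vertex name would be bounded in terms of the number \<open>m\<close> of arcs; here \<open>n \<le> 2 m\<close>.
\<close>

definition graph_input :: "nat pair_pre_digraph \<Rightarrow> (nat \<times> nat) list \<Rightarrow> bool" where
  "graph_input G es \<longleftrightarrow>
     pair_digraph G \<and> pverts G = {..<card (pverts G)} \<and>
     (\<forall>v \<in> pverts G. \<exists>e \<in> parcs G. v = fst e \<or> v = snd e) \<and>
     distinct es \<and> set es = parcs G"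

text \<open>Memory initially holds \<open>n, m, u\<^sub>0, v\<^sub>0, u\<^sub>1, v\<^sub>1, \<dots>\<close> for the arcs \<open>(u\<^sub>i, v\<^sub>i)\<close>, then zeros.\<close>

definition init_state :: "nat pair_pre_digraph \<Rightarrow> (nat \<times> nat) list \<Rightarrow> state" where
  "init_state G es =
     (let input = card (pverts G) # length es # concat (map (\<lambda>(u, v). [u, v]) es)
      in \<lparr>regs = (\<lambda>_. 0), mem = (\<lambda>a. if a < length input then input ! a else 0)\<rparr>)"

text \<open>
  \<open>solves P c T R\<close>: on every input graph with \<open>m\<close> arcs, with words of \<open>word_size c m\<close> bits, \<open>P\<close>
  always halts within \<open>T m\<close> steps, and with probability at least \<open>2/3\<close> register 0 then holds an
  answer \<open>x\<close> with \<open>R G x\<close>.  For a program without \<open>Rand\<close> the outcome is a single state, so that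
  the answer is always correct.
\<close>

definition solves ::
    "prog \<Rightarrow> nat \<Rightarrow> (nat \<Rightarrow> nat) \<Rightarrow> (nat pair_pre_digraph \<Rightarrow> nat \<Rightarrow> bool) \<Rightarrow> bool" where
  "solves P c T R \<longleftrightarrow>
     (\<forall>G es. graph_input G es \<longrightarrow>
        (let m = card (parcs G); s = init_state G es in
           (\<forall>t \<le> T m. \<forall>(P', s') \<in> set_pmf (run t P s). fits (word_size c m) s') \<and>
           (\<forall>(P', s') \<in> set_pmf (run (T m) P s). P' = Skip) \<and>
           measure_pmf.prob (run (T m) P s) {(P', s'). R G (regs s' 0)} \<ge> 2 / 3))"

datatype model = Deterministic | Randomized

fun rand_free :: "prog \<Rightarrow> bool" where
  "rand_free (Rand r b) \<longleftrightarrow> False"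
| "rand_free (Seq P Q) \<longleftrightarrow> rand_free P \<and> rand_free Q"
| "rand_free (IfNonzero r P Q) \<longleftrightarrow> rand_free P \<and> rand_free Q"
| "rand_free (WhileNonzero r P) \<longleftrightarrow> rand_free P"
| "rand_free _ \<longleftrightarrow> True"

definition solvable_in_time ::
    "model \<Rightarrow> (nat pair_pre_digraph \<Rightarrow> nat \<Rightarrow> bool) \<Rightarrow> (nat \<Rightarrow> real) \<Rightarrow> bool" where
  "solvable_in_time M R f \<longleftrightarrow>
     (\<exists>P c T. (M = Deterministic \<longrightarrow> rand_free P) \<and>
              (\<lambda>m. real (T m)) \<in> O(f) \<and> solves P c T R)"

text \<open>The answer 0 encodes the value \<open>\<infinity>\<close>.\<close>

definition girth_approximable_in_time :: "model \<Rightarrow> real \<Rightarrow> (nat \<Rightarrow> real) \<Rightarrow> bool" where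
  "girth_approximable_in_time M c =
     solvable_in_time M (\<lambda>G x. girth_approximation c G (if x = 0 then \<infinity> else enat x))"

definition k_cycle_detectable_in_time :: "model \<Rightarrow> nat \<Rightarrow> (nat \<Rightarrow> real) \<Rightarrow> bool" where
  "k_cycle_detectable_in_time M k =
     solvable_in_time M (\<lambda>G x. x \<noteq> 0 \<longleftrightarrow> has_k_cycle k G)"

definition k_Cycle_Hypothesis :: "model \<Rightarrow> bool" where
  "k_Cycle_Hypothesis M \<longleftrightarrow>
     (\<forall>\<epsilon>>0. \<exists>k. \<not> k_cycle_detectable_in_time M k (\<lambda>m. real m powr (2 - \<epsilon>)))"

end

(*
Colour coding.  Colour the vertices with k colours and keep only the arcs that lead from a colour to
the cyclically next one.  Every cycle of the remaining graph has a length divisible by k, so that its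
girth is k if some k-cycle survives and at least 2k otherwise, and a (2 - delta)-approximation of the
girth tells the two cases apart.  It is called once on the disjoint union H of several coloured
copies of the graph, in which each vertex gets a private out-neighbour so that none is isolated.

The colourings come from the multiplicative hash function d -> (a d mod Q B) div B, applied to the E
digits of a vertex in base B > n^(1/E).  As Q is of the order k^2, it is injective on a given k-cycle
for 19 of 20 multipliers a < Q B, and one copy is made for each colouring of the constantly many
hash values.  The randomized algorithm draws a and takes E = 1, hence H has O(m) arcs.  The
deterministic one has copies for all multipliers, hence H has O(m^(1 + 1/E)) arcs, which is absorbed
by passing from epsilon to epsilon'.

A coloured call succeeds with probability 19/20 * 2/3 = 19/30 only, but the majority of three is
right with probability more than 2/3.  The three calls need memories that are initially zero at
addresses not known in advance; they are simulated in interleaved memory windows.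

The reduction itself takes at least linear time, which is no loss if epsilon <= 1.  For epsilon > 1
there is no approximation algorithm at all, since it would have to read the input: every one of
linearly many arcs could be the one that closes a cycle.
*)

theory Submission
  imports Defs "HOL-Real_Asymp.Real_Asymp"
begin

section \<open>Execution of programs\<close>

text \<open>This is why each of the three calls owns a residue class of addresses modulo 3, infinite
  and still zero. The vote is taken on the answers to the detection problem, since valid
  approximations of the same girth may differ from each other. Hashing adds errors on one side only:
  without a \<open>k\<close>-cycle every colouring leaves girth at least 2k, so a bad multiplier can
  hide a cycle but never create one. The colourings of the hash values are enumerated rather than
  drawn, because a random one succeeds only with a small probability depending on \<open>k\<close>,
  while enumerating constantly many costs a constant factor. Hashing whole vertex names would need
  about \<open>n\<close> multipliers, hence as many copies in the deterministic case. Hashing all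
  \<open>E\<close> digits with one common multiplier needs only about n^(1/E) of them, since
  distinct names differ in some digit, and the collisions of two different digits are rare.\<close>

definition good :: "nat \<Rightarrow> nat \<Rightarrow> prog \<Rightarrow> state \<Rightarrow> bool" where
  "good w t P s \<longleftrightarrow>
     (\<forall>t'\<le>t. \<forall>(P', s')\<in>set_pmf (run t' P s). fits w s') \<and> (\<forall>(P', s')\<in>set_pmf (run t P s). P' = Skip)"

definition result :: "nat \<Rightarrow> prog \<Rightarrow> state \<Rightarrow> state pmf" where
  "result t P s = map_pmf snd (run t P s)"

text \<open>\<open>run\<close> recurses on the last step, whereas the arguments about programs split
  off the first one.\<close>

lemma run_Suc_left: "run (Suc t) P s = bind_pmf (step P s) (\<lambda>(P', s'). run t P' s')"
proof (induction t)
  case 0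
  then show ?case by (simp add: bind_return_pmf split_def bind_return_pmf')
next
  case (Suc t)
  have "run (Suc (Suc t)) P s = bind_pmf (run (Suc t) P s) (\<lambda>(P', s'). step P' s')" by simp
  also have "\<dots> = bind_pmf (step P s) (\<lambda>(P', s'). run (Suc t) P' s')"
    unfolding Suc by (simp add: bind_assoc_pmf split_def)
  finally show ?case .
qed

lemma run_add: "run (a + b) P s = bind_pmf (run a P s) (\<lambda>(P', s'). run b P' s')"
proof (induction b)
  case 0
  then show ?case by (simp add: split_def bind_return_pmf')
next
  case (Suc b)
  then show ?case by (simp add: bind_assoc_pmf split_def)
qed

lemma run_Skip [simp]: "run t Skip s = return_pmf (Skip, s)"
  by (induction t) (auto simp: bind_return_pmf)

lemma good_0 [simp]: "good w 0 P s \<longleftrightarrow> P = Skip \<and> fits w s"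
  by (auto simp: good_def)

lemma good_Skip [simp]: "good w t Skip s \<longleftrightarrow> fits w s"
  by (auto simp: good_def)

lemma good_Suc: "good w (Suc t) P s \<longleftrightarrow> fits w s \<and> (\<forall>(P', s')\<in>set_pmf (step P s). good w t P' s')"
proof
  assume g: "good w (Suc t) P s"
  have "good w t P' s'" if "(P', s') \<in> set_pmf (step P s)" for P' s'
    unfolding good_def
  proof (intro conjI allI impI ballI, clarify)
    fix t' Q r assume "t' \<le> t" "(Q, r) \<in> set_pmf (run t' P' s')"
    then have "(Q, r) \<in> set_pmf (run (Suc t') P s)" "Suc t' \<le> Suc t"
      using that by (force simp: run_Suc_left simp del: run.simps(2))+
    then show "fits w r" using g unfolding good_def by blast
  next
    show "case x of (Q, r) \<Rightarrow> Q = Skip" if "x \<in> set_pmf (run t P' s')" for x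
    proof -
      have "x \<in> set_pmf (run (Suc t) P s)"
        using that \<open>(P', s') \<in> set_pmf (step P s)\<close>
        by (force simp: run_Suc_left simp del: run.simps(2))
      then show ?thesis using g unfolding good_def by blast
    qed
  qed
  moreover have "fits w s" using g unfolding good_def by (auto dest: spec[of _ 0])
  ultimately show "fits w s \<and> (\<forall>(P', s')\<in>set_pmf (step P s). good w t P' s')" by auto
next
  assume r: "fits w s \<and> (\<forall>(P', s')\<in>set_pmf (step P s). good w t P' s')"
  show "good w (Suc t) P s"
    unfolding good_def
  proof (intro conjI allI impI ballI, clarify)
    fix t' Q r' assume t: "t' \<le> Suc t" "(Q, r') \<in> set_pmf (run t' P s)"
    show "fits w r'"
    proof (cases t')
      case 0
      then show ?thesis using t r by auto
    next
      case (Suc u)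
      then obtain P' s' where "(P', s') \<in> set_pmf (step P s)" "(Q, r') \<in> set_pmf (run u P' s')"
        using t by (auto simp: run_Suc_left simp del: run.simps(2))
      then show ?thesis using r t Suc unfolding good_def by fastforce
    qed
  next
    fix x assume "x \<in> set_pmf (run (Suc t) P s)"
    then obtain P' s' where "(P', s') \<in> set_pmf (step P s)" "x \<in> set_pmf (run t P' s')"
      by (auto simp: run_Suc_left simp del: run.simps(2))
    then show "case x of (Q, r) \<Rightarrow> Q = Skip" using r unfolding good_def by fastforce
  qed
qed

lemma good_fits: "good w t P s \<Longrightarrow> fits w s"
  unfolding good_def by (auto dest: spec[of _ 0])

lemma good_result_fits: "good w t P s \<Longrightarrow> s' \<in> set_pmf (result t P s) \<Longrightarrow> fits w s'"
  unfolding good_def result_def by fastforce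

lemma result_Skip [simp]: "result t Skip s = return_pmf s"
  by (simp add: result_def)

lemma result_0 [simp]: "result 0 P s = return_pmf s"
  by (simp add: result_def)

lemma result_Suc: "result (Suc t) P s = bind_pmf (step P s) (\<lambda>(P', s'). result t P' s')"
  by (simp add: result_def run_Suc_left map_bind_pmf split_def del: run.simps(2))

text \<open>A halted configuration steps to itself, so a time bound can be padded without changing
  the outcome.\<close>

lemma good_mono:
  assumes "good w t P s" "t \<le> t'"
  shows "good w t' P s" "result t' P s = result t P s"
proof -
  have A: "good w (t + d) P s \<and> result (t + d) P s = result t P s" for d
    using assms(1)
  proof (induction t arbitrary: P s)
    case 0
    then show ?case by simp
  next
    case (Suc t)
    have f: "fits w s" and g: "\<And>P' s'. (P', s') \<in> set_pmf (step P s) \<Longrightarrow> good w t P' s'"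
      using Suc.prems by (auto simp: good_Suc)
    have "result (Suc t + d) P s = bind_pmf (step P s) (\<lambda>(P', s'). result (t + d) P' s')"
      by (simp add: result_Suc)
    also have "\<dots> = result (Suc t) P s"
      unfolding result_Suc using Suc.IH[OF g] by (intro bind_pmf_cong) auto
    finally show ?case using f Suc.IH[OF g] by (auto simp: good_Suc)
  qed
  show "good w t' P s" "result t' P s = result t P s"
    using A[of "t' - t"] assms(2) by auto
qed

text \<open>The additional step is the one that turns \<open>Seq Skip Q\<close> into
  \<open>Q\<close>. Where \<open>P\<close> halts before time \<open>t\<close>, as it may on some
  random branches only, the remaining time is padded.\<close>

lemma good_Seq:
  assumes "good w t P s" and "\<And>s'. s' \<in> set_pmf (result t P s) \<Longrightarrow> good w u Q s'"
  shows "good w (t + u + 1) (Seq P Q) s"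
    and "result (t + u + 1) (Seq P Q) s = bind_pmf (result t P s) (result u Q)"
proof -
  have "good w (t + u + 1) (Seq P Q) s \<and>
        result (t + u + 1) (Seq P Q) s = bind_pmf (result t P s) (result u Q)"
    using assms
  proof (induction t arbitrary: P s)
    case 0
    then show ?case by (simp add: good_Suc result_Suc bind_return_pmf)
  next
    case (Suc t)
    show ?case
    proof (cases "P = Skip")
      case True
      then have g: "good w u Q s" "fits w s" using Suc.prems by (auto simp: good_fits)
      then show ?thesis
        using True good_mono[OF g(1), of "Suc (t + u)"] by (simp add: good_Suc result_Suc bind_return_pmf)
    next
      case False
      have IH: "good w (t + u + 1) (Seq P' Q) s' \<and>
         result (t + u + 1) (Seq P' Q) s' = bind_pmf (result t P' s') (result u Q)"
        if "(P', s') \<in> set_pmf (step P s)" for P' s'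
      proof (rule Suc.IH)
        show "good w t P' s'" using Suc.prems that by (auto simp: good_Suc)
        show "good w u Q s''" if "s'' \<in> set_pmf (result t P' s')" for s''
          using that \<open>(P', s') \<in> _\<close> by (intro Suc.prems(2)) (force simp: result_Suc)
      qed
      have "result (Suc t + u + 1) (Seq P Q) s
          = bind_pmf (step P s) (\<lambda>(P', s'). result (t + u + 1) (Seq P' Q) s')"
        using False by (simp add: result_Suc bind_map_pmf split_def)
      also have "\<dots> = bind_pmf (step P s) (\<lambda>(P', s'). bind_pmf (result t P' s') (result u Q))"
        using IH by (intro bind_pmf_cong) auto
      also have "\<dots> = bind_pmf (result (Suc t) P s) (result u Q)"
        by (simp add: result_Suc bind_assoc_pmf split_def)
      finally have "result (Suc t + u + 1) (Seq P Q) s = bind_pmf (result (Suc t) P s) (result u Q)" .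
      moreover have "good w (Suc (t + u + 1)) (Seq P Q) s"
        unfolding good_Suc[of w "t + u + 1"] using IH Suc.prems(1) False by (auto simp: good_fits)
      ultimately show ?thesis by simp
    qed
  qed
  then show "good w (t + u + 1) (Seq P Q) s"
    and "result (t + u + 1) (Seq P Q) s = bind_pmf (result t P s) (result u Q)" by auto
qed

text \<open>Total correctness with a step bound, for all random outcomes at once; fitting into
  \<open>w\<close>-bit words throughout is part of the claim. Probabilities are left to
  \<open>likely\<close>.\<close>

definition hoare :: "nat \<Rightarrow> nat \<Rightarrow> (state \<Rightarrow> bool) \<Rightarrow> prog \<Rightarrow> (state \<Rightarrow> bool) \<Rightarrow> bool" where
  "hoare w t A P B \<longleftrightarrow>
     (\<forall>s. fits w s \<longrightarrow> A s \<longrightarrow> good w t P s \<and> (\<forall>s'\<in>set_pmf (result t P s). B s'))"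

lemma hoareI:
  "(\<And>s. fits w s \<Longrightarrow> A s \<Longrightarrow> good w t P s \<and> (\<forall>s'\<in>set_pmf (result t P s). B s')) \<Longrightarrow> hoare w t A P B"
  by (auto simp: hoare_def)

lemma hoare_mono:
  assumes "hoare w t A P B" "\<And>s. A' s \<Longrightarrow> A s" "\<And>s. B s \<Longrightarrow> B' s" "t \<le> t'"
  shows "hoare w t' A' P B'"
  using assms good_mono[OF _ assms(4)] unfolding hoare_def by metis

lemma hoare_Seq:
  assumes "hoare w t A P B" "hoare w u B Q C" "t + u + 1 \<le> v"
  shows "hoare w v A (Seq P Q) C"
proof -
  have "hoare w (t + u + 1) A (Seq P Q) C"
  proof (rule hoareI)
    fix s assume s: "fits w s" "A s"
    have g: "good w t P s" and B: "\<And>s'. s' \<in> set_pmf (result t P s) \<Longrightarrow> B s'"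
      using assms(1) s by (auto simp: hoare_def)
    have "good w u Q s' \<and> (\<forall>s''\<in>set_pmf (result u Q s'). C s'')"
      if "s' \<in> set_pmf (result t P s)" for s'
      using assms(2) B[OF that] good_result_fits[OF g that] by (auto simp: hoare_def)
    then show "good w (t + u + 1) (Seq P Q) s \<and> (\<forall>s'\<in>set_pmf (result (t + u + 1) (Seq P Q) s). C s')"
      using good_Seq[OF g, of u Q] by auto
  qed
  then show ?thesis by (rule hoare_mono) (use assms in auto)
qed

text \<open>The index of the invariant is the number of iterations still to come. An iteration costs
  \<open>t\<close> steps for the body, one for the test and one for dropping the finished body; the
  final 1 is the failing test.\<close>

lemma hoare_While:
  assumes body: "\<And>n. hoare w t (Inv (Suc n)) P (Inv n)"
    and test: "\<And>n s. Inv n s \<Longrightarrow> regs s r \<noteq> 0 \<longleftrightarrow> n > 0"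
    and v: "n * (t + 2) + 1 \<le> v"
  shows "hoare w v (Inv n) (WhileNonzero r P) (Inv 0)"
proof -
  have "hoare w (n * (t + 2) + 1) (Inv n) (WhileNonzero r P) (Inv 0)"
  proof (induction n)
    case 0
    show ?case using test[of 0] by (intro hoareI) (auto simp: good_Suc result_Suc bind_return_pmf)
  next
    case (Suc n)
    have *: "hoare w (t + (n * (t + 2) + 1) + 1) (Inv (Suc n)) (Seq P (WhileNonzero r P)) (Inv 0)"
      by (rule hoare_Seq[OF body Suc]) auto
    have e: "Suc n * (t + 2) + 1 = Suc (t + (n * (t + 2) + 1) + 1)" by simp
    show ?case
      unfolding e
    proof (intro hoareI)
      fix s assume "fits w s" "Inv (Suc n) s"
      then show "good w (Suc (t + (n * (t + 2) + 1) + 1)) (WhileNonzero r P) s \<and>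
         (\<forall>s'\<in>set_pmf (result (Suc (t + (n * (t + 2) + 1) + 1)) (WhileNonzero r P) s). Inv 0 s')"
        using * test[of "Suc n" s]
        by (auto simp: good_Suc[of _ _ "WhileNonzero _ _"] result_Suc[of _ "WhileNonzero _ _"] hoare_def bind_return_pmf)
    qed
  qed
  then show ?thesis by (rule hoare_mono) (use v in auto)
qed

section \<open>Verification conditions for code without loops\<close>

definition non_expanding :: "binop \<Rightarrow> bool" where
  "non_expanding f \<longleftrightarrow> f \<in> {Sub, Div, Mod, ShiftR, Less, Equal}"

lemma binop_sem_less:
  assumes "non_expanding f" "x < 2 ^ w" "0 < w"
  shows "binop_sem f x y < 2 ^ w"
proof -
  have "1 < (2::nat) ^ w" using assms(3) by (rule one_less_power[rotated]) simp
  moreover have "x mod y < 2 ^ w" "x div y < 2 ^ w" "drop_bit y x < 2 ^ w" "x - y < 2 ^ w"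
    using assms(2) le_less_trans[OF mod_less_eq_dividend] le_less_trans[OF div_le_dividend]
    by (auto simp: drop_bit_eq_div)
  ultimately show ?thesis
    using assms(1) unfolding non_expanding_def by auto
qed

text \<open>Overflow is checked only where a result can exceed the first operand. The disjunct
  \<open>x = 0\<close> covers a zero bound of \<open>Rand\<close>, for which the result is 0. The
  value \<open>False\<close> on loops confines the calculus to straight-line code and makes the
  entry for loops in \<open>cost\<close> harmless; loops go through
  \<open>hoare_While\<close>.\<close>

fun wp :: "nat \<Rightarrow> prog \<Rightarrow> (state \<Rightarrow> bool) \<Rightarrow> state \<Rightarrow> bool" where
  "wp w Skip Q s \<longleftrightarrow> Q s"
| "wp w (SetConst r x) Q s \<longleftrightarrow> x < 2 ^ w \<and> Q (set_reg r x s)"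
| "wp w (BinOp r f a b) Q s \<longleftrightarrow>
     (\<not> non_expanding f \<longrightarrow> binop_sem f (regs s a) (regs s b) < 2 ^ w) \<and>
     Q (set_reg r (binop_sem f (regs s a) (regs s b)) s)"
| "wp w (Load r a) Q s \<longleftrightarrow> Q (set_reg r (mem s (regs s a)) s)"
| "wp w (Store a r) Q s \<longleftrightarrow> Q (set_mem (regs s a) (regs s r) s)"
| "wp w (Rand r b) Q s \<longleftrightarrow> (\<forall>x. x < regs s b \<or> x = 0 \<longrightarrow> Q (set_reg r x s))"
| "wp w (Seq A B) Q s \<longleftrightarrow> wp w A (wp w B Q) s"
| "wp w (IfNonzero r A B) Q s \<longleftrightarrow> (regs s r \<noteq> 0 \<longrightarrow> wp w A Q s) \<and> (regs s r = 0 \<longrightarrow> wp w B Q s)"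
| "wp w (WhileNonzero r P) Q s \<longleftrightarrow> False"

fun cost :: "prog \<Rightarrow> nat" where
  "cost Skip = 0"
| "cost (Seq A B) = cost A + cost B + 1"
| "cost (IfNonzero r A B) = max (cost A) (cost B) + 1"
| "cost _ = 1"

lemma fits_set_reg: "fits w s \<Longrightarrow> x < 2 ^ w \<Longrightarrow> fits w (set_reg r x s)"
  by (auto simp: fits_def set_reg_def)

lemma fits_set_mem: "fits w s \<Longrightarrow> x < 2 ^ w \<Longrightarrow> fits w (set_mem r x s)"
  by (auto simp: fits_def set_mem_def)

lemma fitsD: "fits w s \<Longrightarrow> regs s r < 2 ^ w" "fits w s \<Longrightarrow> mem s a < 2 ^ w"
  by (auto simp: fits_def)

lemma hoare_wp:
  assumes "0 < w"
  shows "hoare w (cost P) (wp w P B) P B"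
proof (induction P arbitrary: B)
  case (BinOp r f a b)
  have "binop_sem f (regs s a) (regs s b) < 2 ^ w" if "fits w s" "wp w (BinOp r f a b) B s" for s
    using that binop_sem_less[of f "regs s a" w] assms fitsD by auto
  then show ?case
    by (auto simp: hoare_def good_Suc result_Suc bind_return_pmf intro!: fits_set_reg)
next
  case (Seq P1 P2)
  show ?case
    using hoare_Seq[OF Seq.IH(1)[of "wp w P2 B"] Seq.IH(2)[of B], of "cost (Seq P1 P2)"] by simp
next
  case (IfNonzero r P1 P2)
  have "good w (Suc (max (cost P1) (cost P2))) (IfNonzero r P1 P2) s \<and>
        (\<forall>s'\<in>set_pmf (result (Suc (max (cost P1) (cost P2))) (IfNonzero r P1 P2) s). B s')"
    if s: "fits w s" "wp w (IfNonzero r P1 P2) B s" for s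
  proof (cases "regs s r = 0")
    case True
    then have "good w (cost P2) P2 s \<and> (\<forall>s'\<in>set_pmf (result (cost P2) P2 s). B s')"
      using IfNonzero(2)[of B] s by (auto simp: hoare_def)
    then show ?thesis
      using True s good_mono[of w "cost P2" P2 s "max (cost P1) (cost P2)"]
      by (simp add: good_Suc result_Suc bind_return_pmf)
  next
    case False
    then have "good w (cost P1) P1 s \<and> (\<forall>s'\<in>set_pmf (result (cost P1) P1 s). B s')"
      using IfNonzero(1)[of B] s by (auto simp: hoare_def)
    then show ?thesis
      using False s good_mono[of w "cost P1" P1 s "max (cost P1) (cost P2)"]
      by (simp add: good_Suc result_Suc bind_return_pmf)
  qed
  then show ?case by (auto simp: hoare_def)
next
  case (Rand r b)
  have "0 < (2::nat) ^ w" by simp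
  then show ?case
    by (auto simp: hoare_def good_Suc result_Suc bind_return_pmf bind_map_pmf lessThan_empty_iff
        intro!: fits_set_reg dest: fitsD(1)[of w _ b] less_trans)
qed (auto simp: hoare_def good_Suc result_Suc bind_return_pmf
        intro!: fits_set_reg fits_set_mem fitsD)

lemma hoare_wpI:
  assumes "0 < w" "\<And>s. fits w s \<Longrightarrow> A s \<Longrightarrow> wp w P B s" "cost P \<le> t"
  shows "hoare w t A P B"
proof -
  have "hoare w t (wp w P B) P B" by (rule hoare_mono[OF hoare_wp]) (use assms in auto)
  then show ?thesis using assms(2) by (auto simp: hoare_def)
qed

section \<open>Simulation in a memory window\<close>

lemma regs_set_reg [simp]: "regs (set_reg r x s) = (regs s)(r := x)"
  and mem_set_reg [simp]: "mem (set_reg r x s) = mem s"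
  and regs_set_mem [simp]: "regs (set_mem a x s) = regs s"
  and mem_set_mem [simp]: "mem (set_mem a x s) = (mem s)(a := x)"
  by (simp_all add: set_reg_def set_mem_def)

text \<open>Registers below 40 belong to the reduction; above them the three simulated register
  files are interleaved like the memory windows.\<close>

definition sim_reg :: "nat \<Rightarrow> reg \<Rightarrow> reg" where
  "sim_reg j r = 40 + 3 * r + j"

definition emb :: "nat \<Rightarrow> nat \<Rightarrow> state \<Rightarrow> state \<Rightarrow> state" where
  "emb j off s0 s =
     \<lparr>regs = (\<lambda>r. if \<exists>q. r = sim_reg j q then regs s ((r - 40) div 3) else regs s0 r),
      mem = (\<lambda>a. if \<exists>q. a = off + 3 * q then mem s ((a - off) div 3) else mem s0 a)\<rparr>"

text \<open>
  The simulated cell \<open>a\<close> is the cell \<open>off + 3 * a\<close>.  Register 2 is reset to 0 after each access, so that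
  the state of the simulation is a function \<open>emb j off s0\<close> of the simulated state.
\<close>

fun sim :: "nat \<Rightarrow> prog \<Rightarrow> prog" where
  "sim j Skip = Skip"
| "sim j (SetConst r x) = SetConst (sim_reg j r) x"
| "sim j (BinOp r f a b) = BinOp (sim_reg j r) f (sim_reg j a) (sim_reg j b)"
| "sim j (Load r a) =
     Seq (BinOp 2 Mul (sim_reg j a) 4) (Seq (BinOp 2 Add 2 3) (Seq (Load (sim_reg j r) 2) (SetConst 2 0)))"
| "sim j (Store a r) =
     Seq (BinOp 2 Mul (sim_reg j a) 4) (Seq (BinOp 2 Add 2 3) (Seq (Store 2 (sim_reg j r)) (SetConst 2 0)))"
| "sim j (Rand r b) = Rand (sim_reg j r) (sim_reg j b)"
| "sim j (Seq P Q) = Seq (sim j P) (sim j Q)"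
| "sim j (IfNonzero r P Q) = IfNonzero (sim_reg j r) (sim j P) (sim j Q)"
| "sim j (WhileNonzero r P) = WhileNonzero (sim_reg j r) (sim j P)"

lemma sim_eq_Skip [simp]: "sim j P = Skip \<longleftrightarrow> P = Skip"
  by (cases P) auto

lemma rand_free_sim: "rand_free P \<Longrightarrow> rand_free (sim j P)"
  by (induction P) auto

lemma run_numeral: "run (numeral n) P s = bind_pmf (run (pred_numeral n) P s) (\<lambda>(P', s'). step P' s')"
  by (simp add: numeral_eq_Suc)

text \<open>The assumption excludes the step in which a finished first component is dropped; before
  it, \<open>B\<close> is merely carried along.\<close>

lemma run_Seq_prefix:
  assumes "\<And>i X s'. i < n \<Longrightarrow> (X, s') \<in> set_pmf (run i A s) \<Longrightarrow> X \<noteq> Skip"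
  shows "run n (Seq A B) s = map_pmf (\<lambda>(X, s'). (Seq X B, s')) (run n A s)"
  using assms
proof (induction n)
  case (Suc n)
  have IH: "run n (Seq A B) s = map_pmf (\<lambda>(X, s'). (Seq X B, s')) (run n A s)"
    by (intro Suc.IH) (rule Suc.prems, auto)
  have "run (Suc n) (Seq A B) s
      = bind_pmf (run n A s) (\<lambda>(X, s'). step (Seq X B) s')"
    by (simp add: IH bind_map_pmf split_def del: step.simps)
  also have "\<dots> = bind_pmf (run n A s) (\<lambda>(X, s'). map_pmf (\<lambda>(X, s'). (Seq X B, s')) (step X s'))"
    using Suc.prems[of n] by (intro bind_pmf_cong) auto
  also have "\<dots> = map_pmf (\<lambda>(X, s'). (Seq X B, s')) (run (Suc n) A s)"
    by (simp add: map_bind_pmf split_def)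
  finally show ?case .
qed simp

lemma good_run:
  assumes "\<And>i X s'. i < n \<Longrightarrow> (X, s') \<in> set_pmf (run i P s) \<Longrightarrow> fits w s'"
    and "\<And>X s'. (X, s') \<in> set_pmf (run n P s) \<Longrightarrow> good w t X s'"
  shows "good w (n + t) P s"
    and "result (n + t) P s = bind_pmf (run n P s) (\<lambda>(X, s'). result t X s')"
proof -
  show "result (n + t) P s = bind_pmf (run n P s) (\<lambda>(X, s'). result t X s')"
    by (simp add: result_def run_add map_bind_pmf split_def)
  show "good w (n + t) P s"
    unfolding good_def
  proof (intro conjI allI impI ballI, clarify)
    fix t' Q r assume *: "t' \<le> n + t" "(Q, r) \<in> set_pmf (run t' P s)"
    show "fits w r"
    proof (cases "t' < n")
      case True
      then show ?thesis using assms(1) * by blast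
    next
      case False
      then have t': "t' = n + (t' - n)" by simp
      have "(Q, r) \<in> set_pmf (run (n + (t' - n)) P s)" using *(2) t' by metis
      then obtain X s' where "(X, s') \<in> set_pmf (run n P s)" "(Q, r) \<in> set_pmf (run (t' - n) X s')"
        by (auto simp: run_add)
      then show ?thesis
        using assms(2)[of X s'] *(1) unfolding good_def by (auto dest!: spec[of _ "t' - n"])
    qed
  next
    fix x assume "x \<in> set_pmf (run (n + t) P s)"
    then obtain X s' where "(X, s') \<in> set_pmf (run n P s)" "x \<in> set_pmf (run t X s')"
      by (auto simp: run_add)
    then show "case x of (Q, r) \<Rightarrow> Q = Skip" using assms(2)[of X s'] by (auto simp: good_def)
  qed
qed

text \<open>The last assumption ensures that the cell \<open>off + 3 * a\<close> of a
  \<open>v\<close>-bit address \<open>a\<close> has a \<open>w\<close>-bit address.\<close>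

locale simulation =
  fixes j off :: nat and s0 :: state and v w :: nat
  assumes j: "j < 3" and s0: "regs s0 2 = 0" "regs s0 3 = off" "regs s0 4 = 3"
    and fits_s0: "fits w s0" and vw: "3 * 2 ^ v + off \<le> 2 ^ w"
begin

abbreviation "E \<equiv> emb j off s0"
abbreviation "\<rho> \<equiv> sim_reg j"

lemma sim_reg_eq_iff [simp]: "\<rho> r = \<rho> r' \<longleftrightarrow> r = r'"
  by (auto simp: sim_reg_def)

lemma sim_reg_div: "(\<rho> r - 40) div 3 = r"
  using j by (simp add: sim_reg_def)

lemma regs_E [simp]: "regs (E s) (\<rho> r) = regs s r"
  by (auto simp: emb_def sim_reg_div)

lemma regs_E_low [simp]: "r < 40 \<Longrightarrow> regs (E s) r = regs s0 r"
  by (auto simp: emb_def sim_reg_def)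

lemma mem_E [simp]: "mem (E s) (off + 3 * a) = mem s a" "mem (E s) (3 * a + off) = mem s a"
    "mem (E s) (a * 3 + off) = mem s a"
  by (auto simp: emb_def mult.commute)

lemma set_reg_E [simp]: "set_reg (\<rho> r) x (E s) = E (set_reg r x s)"
  by (auto simp: emb_def set_reg_def fun_eq_iff sim_reg_div)

lemma set_mem_E [simp]: "set_mem (off + 3 * a) x (E s) = E (set_mem a x s)"
    "set_mem (a * 3 + off) x (E s) = E (set_mem a x s)"
  by (auto simp: emb_def set_mem_def fun_eq_iff)

lemma low_neq [simp]: "r < 40 \<Longrightarrow> \<rho> q \<noteq> r" "r < 40 \<Longrightarrow> r \<noteq> \<rho> q"
  by (auto simp: sim_reg_def)

lemma set_reg_swap: "r \<noteq> r' \<Longrightarrow> set_reg r x (set_reg r' y s) = set_reg r' y (set_reg r x s)"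
  by (auto simp: set_reg_def fun_upd_twist)

lemma set_reg_twice: "set_reg r x (set_reg r y s) = set_reg r x s"
  by (auto simp: set_reg_def)

lemma set_reg_mem_swap: "set_reg r x (set_mem a y s) = set_mem a y (set_reg r x s)"
  by (auto simp: set_reg_def set_mem_def)

lemma set_reg_2_0: "set_reg 2 0 (E s) = E s"
  using s0(1) by (auto simp: emb_def set_reg_def fun_eq_iff)

lemma fits_E:
  assumes "fits v s"
  shows "fits w (E s)"
proof -
  have "(2::nat) ^ v \<le> 2 ^ w" using vw by linarith
  then have "regs s a < 2 ^ w" "mem s a < 2 ^ w" for a using fitsD[OF assms] less_le_trans by blast+
  then show ?thesis using fits_s0 by (auto simp: fits_def emb_def)
qed

lemma less_7: "i < (7::nat) \<Longrightarrow> i = 0 \<or> i = 1 \<or> i = 2 \<or> i = 3 \<or> i = 4 \<or> i = 5 \<or> i = 6"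
  by presburger

text \<open>Seven is the length of a simulated memory access: four instructions and three removals
  of \<open>Skip\<close> between them; everything else takes one step. The states in between are not
  of the form \<open>E s\<close>, so their fitting and their not having halted are recorded
  separately.\<close>

lemma sim_step:
  assumes "P \<noteq> Skip" "fits v s" "\<And>X s'. (X, s') \<in> set_pmf (step P s) \<Longrightarrow> fits v s'"
  shows "\<exists>n\<in>{1..7}. run n (sim j P) (E s) = map_pmf (\<lambda>(Q, r). (sim j Q, E r)) (step P s) \<and>
           (\<forall>i<n. \<forall>(X, s')\<in>set_pmf (run i (sim j P) (E s)). X \<noteq> Skip \<and> fits w s')"
  using assms
proof (induction P)
  case Skip
  then show ?case by simp
next
  case (SetConst r x)
  then show ?case by (intro bexI[of _ 1]) (auto simp: bind_return_pmf fits_E)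
next
  case (BinOp r f a b)
  then show ?case by (intro bexI[of _ 1]) (auto simp: bind_return_pmf fits_E)
next
  case (Rand r b)
  then show ?case by (intro bexI[of _ 1])
     (auto simp: bind_return_pmf fits_E pmf.map_comp comp_def)
next
  case (IfNonzero r P Q)
  then show ?case by (intro bexI[of _ 1]) (auto simp: bind_return_pmf fits_E)
next
  case (WhileNonzero r P)
  then show ?case by (intro bexI[of _ 1]) (auto simp: bind_return_pmf fits_E)
next
  case (Load r a)
  have a: "regs s a < 2 ^ v" using Load fitsD by blast
  then have "regs s a * 3 + off < 2 ^ w"
    using vw by linarith
  then show ?case using Load(2,3) fits_E[of s] fits_E[of "set_reg r (mem s (regs s a)) s"]
    by (intro bexI[of _ 7])
      (auto simp: s0 run_numeral bind_return_pmf set_reg_twice set_reg_swap[of _ 2] set_reg_2_0 dest!: less_7 intro!: fits_set_reg fitsD)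
next
  case (Store a r)
  have a: "regs s a < 2 ^ v" using Store fitsD by blast
  then have "regs s a * 3 + off < 2 ^ w"
    using vw by linarith
  then show ?case using Store(2,3) fitsD(1)[OF fits_E[OF Store(2)], of "\<rho> r"] fits_E[of s] fits_E[of "set_mem (regs s a) (regs s r) s"]
    by (intro bexI[of _ 7])
      (auto simp: s0 run_numeral bind_return_pmf set_reg_twice set_reg_mem_swap set_reg_swap[of _ 2] set_reg_2_0 dest!: less_7 intro!: fits_set_reg fits_set_mem)
next
  case (Seq P Q)
  show ?case
  proof (cases "P = Skip")
    case True
    then show ?thesis using Seq
      by (intro bexI[of _ 1]) (auto simp: bind_return_pmf fits_E)
  next
    case False
    have "fits v s'" if "(X, s') \<in> set_pmf (step P s)" for X s'
    proof -
      have "(Seq X Q, s') \<in> set_pmf (step (Seq P Q) s)" using that False by force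
      then show ?thesis using Seq.prems by blast
    qed
    then obtain n where n: "n \<in> {1..7}"
        "run n (sim j P) (E s) = map_pmf (\<lambda>(Q, r). (sim j Q, E r)) (step P s)"
        "\<And>i X s'. i < n \<Longrightarrow> (X, s') \<in> set_pmf (run i (sim j P) (E s)) \<Longrightarrow> X \<noteq> Skip \<and> fits w s'"
      using Seq.IH(1)[OF False Seq.prems(2)] by blast
    have r: "run i (sim j (Seq P Q)) (E s)
        = map_pmf (\<lambda>(X, s'). (Seq X (sim j Q), s')) (run i (sim j P) (E s))" if "i \<le> n" for i
      unfolding sim.simps
    proof (rule run_Seq_prefix)
      fix l X s' assume "l < i" "(X, s') \<in> set_pmf (run l (sim j P) (E s))"
      then show "X \<noteq> Skip" using n(3)[of l X s'] that by simp
    qed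
    show ?thesis
    proof (intro bexI[of _ n] conjI)
      show "run n (sim j (Seq P Q)) (E s)
          = map_pmf (\<lambda>(Q, r). (sim j Q, E r)) (step (Seq P Q) s)"
        unfolding r[OF order_refl] n(2) using False by (simp add: pmf.map_comp comp_def split_def)
      show "\<forall>i<n. \<forall>(X, s')\<in>set_pmf (run i (sim j (Seq P Q)) (E s)). X \<noteq> Skip \<and> fits w s'"
        using r n(3) by fastforce
    qed (use n in auto)
  qed
qed

text \<open>Simulated steps take different numbers of real steps, possibly depending on random
  choices; all are padded to seven.\<close>

theorem sim_good:
  assumes "good v t P s"
  shows "good w (7 * t) (sim j P) (E s) \<and> result (7 * t) (sim j P) (E s) = map_pmf E (result t P s)"
  using assms
proof (induction t arbitrary: P s)
  case 0
  then show ?case by (auto simp: fits_E)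
next
  case (Suc t)
  show ?case
  proof (cases "P = Skip")
    case True
    then show ?thesis using Suc.prems by (simp add: fits_E)
  next
    case False
    have f: "fits v s" and g: "\<And>P' s'. (P', s') \<in> set_pmf (step P s) \<Longrightarrow> good v t P' s'"
      using Suc.prems by (auto simp: good_Suc)
    obtain n where n: "n \<in> {1..7}"
        "run n (sim j P) (E s) = map_pmf (\<lambda>(Q, r). (sim j Q, E r)) (step P s)"
        "\<And>i X s'. i < n \<Longrightarrow> (X, s') \<in> set_pmf (run i (sim j P) (E s)) \<Longrightarrow> fits w s'"
      using sim_step[OF False f] good_fits[OF g] by blast
    have g': "good w (7 * t) X s'" if "(X, s') \<in> set_pmf (run n (sim j P) (E s))" for X s'
      using that Suc.IH[OF g] unfolding n(2) by auto
    have "result (n + 7 * t) (sim j P) (E s)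
        = bind_pmf (step P s) (\<lambda>(Q, r). result (7 * t) (sim j Q) (E r))"
      by (subst good_run(2)[OF n(3) g']) (auto simp: n(2) bind_map_pmf split_def)
    also have "\<dots> = bind_pmf (step P s) (\<lambda>(Q, r). map_pmf E (result t Q r))"
      using Suc.IH[OF g] by (intro bind_pmf_cong) auto
    also have "\<dots> = map_pmf E (result (Suc t) P s)"
      by (simp add: result_Suc map_bind_pmf split_def)
    finally have r: "result (n + 7 * t) (sim j P) (E s) = map_pmf E (result (Suc t) P s)" .
    have "n + 7 * t \<le> 7 * Suc t" using n(1) by auto
    from good_mono[OF good_run(1)[OF n(3) g'] this] r show ?thesis by simp
  qed
qed

end

section \<open>Cycles and the layered graph\<close>

text \<open>A cycle as an injective map from the integers modulo \<open>k\<close> to vertices, which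
  suits colours counted modulo \<open>k\<close> better than a list of arcs does.\<close>

definition cyclic_seq :: "('a \<times> 'a) set \<Rightarrow> nat \<Rightarrow> (nat \<Rightarrow> 'a) \<Rightarrow> bool" where
  "cyclic_seq A k f \<longleftrightarrow> 0 < k \<and> inj_on f {..<k} \<and> (\<forall>i<k. (f i, f (Suc i mod k)) \<in> A)"

lemma pcas_nth:
  "pcas u p v \<longleftrightarrow> (if p = [] then u = v else
     fst (p ! 0) = u \<and> snd (last p) = v \<and> (\<forall>i. Suc i < length p \<longrightarrow> fst (p ! Suc i) = snd (p ! i)))"
proof (induction p arbitrary: u)
  case (Cons e p)
  show ?case
  proof (cases p)
    case (Cons e' p')
    have "(\<forall>i. Suc i < length (e # p) \<longrightarrow> fst ((e # p) ! Suc i) = snd ((e # p) ! i)) \<longleftrightarrow>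
        fst (p ! 0) = snd e \<and> (\<forall>i. Suc i < length p \<longrightarrow> fst (p ! Suc i) = snd (p ! i))"
    proof -
      have "(\<forall>i. Q i) \<longleftrightarrow> Q 0 \<and> (\<forall>i. Q (Suc i))" for Q :: "nat \<Rightarrow> bool" by (metis not0_implies_Suc)
      from this[of "\<lambda>i. Suc i < length (e # p) \<longrightarrow> fst ((e # p) ! Suc i) = snd ((e # p) ! i)"]
      show ?thesis using Cons by auto
    qed
    then show ?thesis using Cons.IH[of "snd e"] Cons by auto
  qed auto
qed auto

lemma pawalk_verts_eq: "pcas u p v \<Longrightarrow> pawalk_verts u p = u # map snd p"
  by (induction p arbitrary: u) auto

text \<open>A closed walk lists its base point twice, so the library asks for distinctness of the
  tail of its vertex list, that is, of the heads of the arcs. The heads therefore serve as the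
  vertices \<open>f i\<close>.\<close>

lemma has_k_cycle_iff:
  fixes G :: "'a pair_pre_digraph"
  assumes "pair_wf_digraph G"
  shows "has_k_cycle k G \<longleftrightarrow> (\<exists>f. cyclic_seq (parcs G) k f)"
proof
  interpret pair_wf_digraph G by fact
  assume "has_k_cycle k G"
  then obtain p u where p: "awalk u p u" "distinct (tl (pawalk_verts u p))" "p \<noteq> []" "length p = k"
    by (auto simp: has_k_cycle_def cycle_def)
  then have c: "pcas u p u" "set p \<subseteq> parcs G" by (auto simp: awalk_def)
  have "distinct (map snd p)" using p(2) pawalk_verts_eq[OF c(1)] by simp
  then have "inj_on (\<lambda>i. snd (p ! i)) {..<k}"
    using p(4) by (auto simp: inj_on_def distinct_conv_nth)
  moreover have "(snd (p ! i), snd (p ! (Suc i mod k))) \<in> parcs G" if "i < k" for i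
  proof -
    have "snd (p ! i) = fst (p ! (Suc i mod k))"
    proof (cases "Suc i = k")
      case True
      then have "last p = p ! i" using p(3,4) by (auto simp: last_conv_nth)
      then show ?thesis using True c(1) p(3) by (simp add: pcas_nth)
    next
      case False
      then show ?thesis using that c(1) p(3,4) by (simp add: pcas_nth)
    qed
    moreover have "p ! (Suc i mod k) \<in> parcs G" using c(2) p(4) that by (metis in_mono mod_less_divisor nth_mem gr_zeroI not_less0)
    ultimately show ?thesis by simp
  qed
  ultimately have "cyclic_seq (parcs G) k (\<lambda>i. snd (p ! i))"
    using p(3,4) by (auto simp: cyclic_seq_def)
  then show "\<exists>f. cyclic_seq (parcs G) k f" by blast
next
  interpret pair_wf_digraph G by fact
  assume "\<exists>f. cyclic_seq (parcs G) k f"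
  then obtain f where f: "0 < k" "inj_on f {..<k}" "\<And>i. i < k \<Longrightarrow> (f i, f (Suc i mod k)) \<in> parcs G"
    by (auto simp: cyclic_seq_def)
  define p where "p = map (\<lambda>i. (f i, f (Suc i mod k))) [0..<k]"
  have c: "pcas (f 0) p (f 0)"
    using f(1) by (auto simp: pcas_nth p_def last_map)
  \<comment> \<open>The list \<open>p\<close> is built from tails; its heads are the same vertices
    shifted by one position.\<close>
  have "inj_on (\<lambda>i. f (Suc i mod k)) {..<k}"
  proof (rule inj_onI)
    fix i j assume ij: "i \<in> {..<k}" "j \<in> {..<k}" "f (Suc i mod k) = f (Suc j mod k)"
    then have "Suc i mod k = Suc j mod k" using f(1,2) by (auto simp: inj_on_def)
    then show "i = j" using ij by (auto simp: mod_Suc split: if_splits)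
  qed
  then have "distinct (tl (pawalk_verts (f 0) p))"
    unfolding pawalk_verts_eq[OF c] by (simp add: p_def distinct_map comp_def atLeast0LessThan)
  moreover have "awalk (f 0) p (f 0)"
    using c f(1,3) in_arcsD1[OF f(3)[OF f(1)]] by (auto simp: awalk_def p_def)
  ultimately have "cycle p" using f(1) by (auto simp: cycle_def p_def)
  then show "has_k_cycle k G" by (auto simp: has_k_cycle_def p_def)
qed

lemma girth_le: "has_k_cycle k G \<Longrightarrow> girth G \<le> enat k"
  by (auto simp: girth_def has_k_cycle_def intro!: Inf_lower)

lemma girth_ge:
  assumes "\<And>k. has_k_cycle k G \<Longrightarrow> l \<le> enat k"
  shows "l \<le> girth G"
  unfolding girth_def using assms by (intro Inf_greatest) (auto simp: has_k_cycle_def)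

lemma has_k_cycle_ge_2:
  assumes "pair_digraph G" "has_k_cycle k G"
  shows "2 \<le> k"
proof -
  interpret pair_digraph G by fact
  obtain f where f: "cyclic_seq (parcs G) k f"
    using has_k_cycle_iff[of G k] assms(2) pair_wf_digraph_axioms by blast
  have "k \<noteq> 1"
  proof
    assume "k = 1"
    then have "(f 0, f 0) \<in> parcs G" using f by (auto simp: cyclic_seq_def)
    then show False using pair_no_loops by force
  qed
  then show ?thesis using f by (auto simp: cyclic_seq_def)
qed

lemma card_pverts_le:
  assumes "graph_input G es"
  shows "card (pverts G) \<le> 2 * length es"
proof -
  have "pverts G \<subseteq> fst ` set es \<union> snd ` set es"
    using assms by (auto simp: graph_input_def)
  then have "card (pverts G) \<le> card (fst ` set es \<union> snd ` set es)" by (intro card_mono) auto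
  also have "\<dots> \<le> card (fst ` set es) + card (snd ` set es)" by (rule card_Un_le)
  also have "\<dots> \<le> length es + length es"
    by (intro add_mono order_trans[OF card_image_le card_length]) auto
  finally show ?thesis by simp
qed

text \<open>\<open>col I v\<close> is the colour of \<open>v\<close> in copy \<open>I\<close>. It is
  left arbitrary: that the lengths of cycles are multiples of \<open>k\<close> holds for every
  colouring, and only the survival of a given \<open>k\<close>-cycle depends on a lucky one.\<close>

locale layered =
  fixes G :: "nat pair_pre_digraph" and es :: "(nat \<times> nat) list"
    and n k N :: nat and col :: "nat \<Rightarrow> nat \<Rightarrow> nat"
  assumes input: "graph_input G es" and n: "n = card (pverts G)" and k: "2 \<le> k"
begin

text \<open>Colours are \<open>b\<close>-bit numbers and may be \<open>k\<close> or more. The test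
  on the tail discards those; the colour of the head is then a remainder modulo
  \<open>k\<close>.\<close>

definition kept :: "nat \<Rightarrow> nat \<times> nat \<Rightarrow> bool" where
  "kept I e \<longleftrightarrow> col I (fst e) < k \<and> col I (snd e) = Suc (col I (fst e)) mod k"

text \<open>Dropping arcs may isolate vertices, which an input must not have; pendant arcs prevent this.\<close>

definition pendant_arcs :: "(nat \<times> nat) set" where
  "pendant_arcs = (\<lambda>x. (x, N * n + x)) ` {..<N * n}"

definition copy_arcs :: "(nat \<times> nat) set" where
  "copy_arcs = {(I * n + u, I * n + v) | I u v. I < N \<and> (u, v) \<in> parcs G \<and> kept I (u, v)}"

definition H :: "nat pair_pre_digraph" where
  "H = \<lparr>pverts = {..<2 * (N * n)}, parcs = pendant_arcs \<union> copy_arcs\<rparr>"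

lemma wf: "pair_digraph G" and verts: "pverts G = {..<n}"
  using input n by (auto simp: graph_input_def)

lemma arc_less: "(u, v) \<in> parcs G \<Longrightarrow> u < n \<and> v < n \<and> u \<noteq> v"
proof -
  interpret pair_digraph G by (rule wf)
  show "(u, v) \<in> parcs G \<Longrightarrow> u < n \<and> v < n \<and> u \<noteq> v"
    using in_arcsD1 in_arcsD2 pair_no_loops verts by fastforce
qed

lemma copy_less: "I < N \<Longrightarrow> u < n \<Longrightarrow> I * n + u < N * n"
proof -
  assume "I < N" "u < n"
  then have "I * n + u < Suc I * n" by simp
  also have "\<dots> \<le> N * n" using \<open>I < N\<close> by (intro mult_right_mono) auto
  finally show ?thesis .
qed

lemma copy_arcsE:
  assumes "(x, y) \<in> copy_arcs"
  obtains "x div n < N" "y div n = x div n" "(x mod n, y mod n) \<in> parcs G"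
    "kept (x div n) (x mod n, y mod n)" "x < N * n" "y < N * n"
proof -
  from assms obtain I u v where "x = I * n + u" "y = I * n + v" "I < N" "(u, v) \<in> parcs G" "kept I (u, v)"
    by (auto simp: copy_arcs_def)
  with arc_less[of u v] copy_less[of I] show ?thesis by (intro that) auto
qed

lemma finite_arcs: "finite (parcs H)" and H_arcs_less: "(x, y) \<in> parcs H \<Longrightarrow> x < N * n \<and> y < 2 * (N * n) \<and> x \<noteq> y"
proof -
  show *: "x < N * n \<and> y < 2 * (N * n) \<and> x \<noteq> y" if "(x, y) \<in> parcs H" for x y
  proof (cases "(x, y) \<in> copy_arcs")
    case True
    then show ?thesis using arc_less by (elim copy_arcsE) auto
  next
    case False
    then show ?thesis using that by (auto simp: H_def pendant_arcs_def)
  qed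
  have "parcs H \<subseteq> {..<N * n} \<times> {..<2 * (N * n)}" using * by auto
  then show "finite (parcs H)" by (rule finite_subset) auto
qed

lemma pair_digraph_H: "pair_digraph H"
  using finite_arcs H_arcs_less
  by unfold_locales (auto simp: H_def, (fastforce)+)

lemma H_input:
  assumes "distinct fs" "set fs = parcs H"
  shows "graph_input H fs"
  unfolding graph_input_def
proof (intro conjI ballI)
  show "pverts H = {..<card (pverts H)}" by (simp add: H_def)
  fix v assume "v \<in> pverts H"
  then have "v < 2 * (N * n)" by (simp add: H_def)
  show "\<exists>e\<in>parcs H. v = fst e \<or> v = snd e"
  proof (cases "v < N * n")
    case True
    then show ?thesis by (intro bexI[of _ "(v, N * n + v)"]) (auto simp: H_def pendant_arcs_def)
  next
    case False
    then show ?thesis using \<open>v < 2 * (N * n)\<close>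
      by (intro bexI[of _ "(v - N * n, v)"])
        (auto simp: H_def pendant_arcs_def image_iff intro!: bexI[of _ "v - N * n"])
  qed
qed (use assms pair_digraph_H in auto)

text \<open>The head of an arc on a cycle has an outgoing arc itself, but the private
  out-neighbours, numbered from \<open>N * n\<close> on, have none. So pendant arcs lie on no
  cycle.\<close>

lemma H_cycle_arc:
  assumes "cyclic_seq (parcs H) l f" "i < l"
  shows "(f i, f (Suc i mod l)) \<in> copy_arcs"
proof -
  have "(f i, f (Suc i mod l)) \<in> parcs H" using assms by (auto simp: cyclic_seq_def)
  moreover have "f (Suc i mod l) < N * n"
  proof -
    have "Suc i mod l < l" using assms(2) by simp
    then have "(f (Suc i mod l), f (Suc (Suc i mod l) mod l)) \<in> parcs H"
      using assms(1) unfolding cyclic_seq_def by blast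
    then show ?thesis using H_arcs_less by blast
  qed
  ultimately show ?thesis by (auto simp: H_def pendant_arcs_def)
qed

text \<open>Arcs stay within one copy, and the colour advances by one modulo \<open>k\<close> along
  each, so returning to the start forces \<open>l\<close> to be 0 modulo \<open>k\<close>. As the
  copy is constant, forgetting it keeps the vertices distinct.\<close>

lemma H_cycle:
  assumes "cyclic_seq (parcs H) l f"
  shows "k dvd l" and "cyclic_seq (parcs G) l (\<lambda>i. f i mod n)"
proof -
  have l: "0 < l" and inj: "inj_on f {..<l}" using assms by (auto simp: cyclic_seq_def)
  note arc = H_cycle_arc[OF assms]
  define I where "I = f 0 div n"
  have I: "f i div n = I" if "i < l" for i
    using that
  proof (induction i)
    case (Suc i)
    then show ?case using arc[of i] by (auto elim!: copy_arcsE)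
  qed (simp add: I_def)
  have A: "(f i mod n, f (Suc i mod l) mod n) \<in> parcs G" if "i < l" for i
    using arc[OF that] by (auto elim!: copy_arcsE)
  have C: "col I (f i mod n) < k" "col I (f (Suc i mod l) mod n) = Suc (col I (f i mod n)) mod k"
    if "i < l" for i
    using arc[OF that] I[OF that] by (auto elim!: copy_arcsE simp: kept_def)
  \<comment> \<open>Reducing the index modulo \<open>l\<close> admits \<open>i = l\<close>, where
    the cycle is back at its start.\<close>
  have "col I (f (i mod l) mod n) = (col I (f 0 mod n) + i) mod k" if "i \<le> l" for i
    using that
  proof (induction i)
    case 0
    then show ?case using C(1)[of 0] l by simp
  next
    case (Suc i)
    then show ?case using C(2)[of i] by (simp add: mod_Suc_eq)
  qed
  from this[of l] have "(col I (f 0 mod n) + l) mod k = (col I (f 0 mod n) + 0) mod k"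
    using C(1)[of 0] l by simp
  then show "k dvd l" by (metis add_diff_cancel_left' dvd_minus_mod mod_eq_dvd_iff_nat add.right_neutral le_add1)
  have "inj_on (\<lambda>i. f i mod n) {..<l}"
  proof (rule inj_onI)
    fix i j assume "i \<in> {..<l}" "j \<in> {..<l}" "f i mod n = f j mod n"
    moreover from this have "f i = f j" using I by (metis div_mult_mod_eq lessThan_iff)
    ultimately show "i = j" using inj by (auto simp: inj_on_def)
  qed
  then show "cyclic_seq (parcs G) l (\<lambda>i. f i mod n)"
    using l A by (auto simp: cyclic_seq_def)
qed

lemma G_cycle:
  assumes "cyclic_seq (parcs G) k f" "I < N" "\<And>i. i < k \<Longrightarrow> col I (f i) = i"
  shows "cyclic_seq (parcs H) k (\<lambda>i. I * n + f i)"
proof -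
  have "(I * n + f i, I * n + f (Suc i mod k)) \<in> copy_arcs" if "i < k" for i
  proof -
    have "(f i, f (Suc i mod k)) \<in> parcs G" "kept I (f i, f (Suc i mod k))"
      using assms that k by (auto simp: cyclic_seq_def kept_def)
    then show ?thesis using assms(2) unfolding copy_arcs_def by blast
  qed
  moreover have "inj_on (\<lambda>i. I * n + f i) {..<k}" using assms by (auto simp: cyclic_seq_def inj_on_def)
  ultimately show ?thesis using k by (auto simp: cyclic_seq_def H_def)
qed

lemma wf_G: "pair_wf_digraph G" and wf_H: "pair_wf_digraph H"
  using wf pair_digraph_H by (simp_all add: pair_digraph_def pair_fin_digraph_def)

text \<open>A cycle of \<open>H\<close> has length \<open>k * q\<close>, and \<open>q = 1\<close>
  would project to a \<open>k\<close>-cycle of \<open>G\<close>. The answer 0 encodes infinity and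
  must count as negative.\<close>

lemma answer_no:
  assumes "\<not> has_k_cycle k G" "girth_approximation c H (if x = 0 then \<infinity> else enat x)"
  shows "\<not> (0 < x \<and> x < 2 * k)"
proof -
  have "enat (2 * k) \<le> girth H"
  proof (rule girth_ge)
    fix l assume "has_k_cycle l H"
    then obtain f where f: "cyclic_seq (parcs H) l f" using has_k_cycle_iff[OF wf_H] by blast
    have "l \<noteq> k" using H_cycle(2)[OF f] assms(1) has_k_cycle_iff[OF wf_G] by blast
    moreover have "0 < l" using f by (simp add: cyclic_seq_def)
    moreover obtain q where q: "l = k * q" using H_cycle(1)[OF f] by (auto simp: dvd_def)
    ultimately have "q \<noteq> 0" "q \<noteq> 1" by auto
    then have "2 \<le> q" by simp
    then have "k * 2 \<le> k * q" by (rule mult_le_mono2)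
    then show "enat (2 * k) \<le> enat l" using q by simp
  qed
  also have "\<dots> \<le> (if x = 0 then \<infinity> else enat x)" using assms(2) by (simp add: girth_approximation_def)
  finally show ?thesis by (auto split: if_splits)
qed

lemma answer_yes:
  assumes "has_k_cycle k H" "girth_approximation c H (if x = 0 then \<infinity> else enat x)" "c < 2"
  shows "0 < x \<and> x < 2 * k"
proof -
  obtain g where g: "girth H = enat g" "g \<le> k"
    using girth_le[OF assms(1)] by (cases "girth H") auto
  have le: "ereal_of_enat (if x = 0 then \<infinity> else enat x) \<le> ereal (c * real g)"
    using assms(2) g by (simp add: girth_approximation_def)
  then have x: "x \<noteq> 0" by (auto split: if_splits)
  then have "real x \<le> c * real g" using le by simp
  \<comment> \<open>The factor \<open>c\<close> may be negative, hence the detour through its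
    positive part.\<close>
  also have "\<dots> \<le> max c 0 * real k" using g by (intro mult_mono) auto
  also have "\<dots> < 2 * real k" using assms(3) k by (intro mult_strict_right_mono) auto
  finally show ?thesis using x by (simp flip: of_nat_less_iff)
qed

end

section \<open>Hash functions and colours\<close>

definition bucket :: "nat \<Rightarrow> nat \<Rightarrow> nat \<Rightarrow> nat \<Rightarrow> nat" where
  "bucket Q B a d = (d * a) mod (Q * B) div B"

text \<open>A Horner scheme: the buckets of the base-\<open>B\<close> digits of \<open>y\<close>,
  lowest digit first, become the base-\<open>Q\<close> digits of the result. The accumulator form
  mirrors the registers of \<open>colour_step\<close>.\<close>

primrec hash :: "nat \<Rightarrow> nat \<Rightarrow> nat \<Rightarrow> nat \<Rightarrow> nat \<Rightarrow> nat \<Rightarrow> nat" where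
  "hash Q B a 0 h y = h"
| "hash Q B a (Suc e) h y = hash Q B a e (h * Q + bucket Q B a (y mod B)) (y div B)"

lemma bucket_less: "0 < Q \<Longrightarrow> 0 < B \<Longrightarrow> bucket Q B a d < Q"
  by (simp add: bucket_def less_mult_imp_div_less)

lemma hash_less:
  assumes "0 < Q" "0 < B"
  shows "hash Q B a e h y < Suc h * Q ^ e"
proof (induction e arbitrary: h y)
  case (Suc e)
  have "hash Q B a (Suc e) h y < Suc (h * Q + bucket Q B a (y mod B)) * Q ^ e"
    using Suc by simp
  also have "\<dots> \<le> (Suc h * Q) * Q ^ e"
    using bucket_less[OF assms, of a "y mod B"] by (intro mult_right_mono) auto
  finally show ?case by (simp add: algebra_simps)
qed simp

text \<open>Buckets are below \<open>Q\<close>, so a hash value is a faithful base-\<open>Q\<close>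
  expansion and can be taken apart digit by digit.\<close>

lemma hash_eqD:
  assumes "0 < Q" "0 < B" "hash Q B a e h x = hash Q B a e h' y"
  shows "h = h' \<and> (\<forall>i<e. bucket Q B a (x div B ^ i mod B) = bucket Q B a (y div B ^ i mod B))"
  using assms(3)
proof (induction e arbitrary: h h' x y)
  case (Suc e)
  let ?b = "\<lambda>x. bucket Q B a (x mod B)"
  have *: "h * Q + ?b x = h' * Q + ?b y"
    "\<And>i. i < e \<Longrightarrow> ?b (x div B div B ^ i) = ?b (y div B div B ^ i)"
    using Suc.IH[of "h * Q + ?b x" "x div B" "h' * Q + ?b y" "y div B"] Suc.prems by auto
  have "(h * Q + ?b x) div Q = h" "(h' * Q + ?b y) div Q = h'"
    using bucket_less[OF assms(1,2)] assms(1) by auto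
  then have h: "h = h'" using *(1) by metis
  have "?b (x div B ^ i) = ?b (y div B ^ i)" if "i < Suc e" for i
  proof (cases i)
    case 0
    then show ?thesis using * h by simp
  next
    case (Suc i')
    then show ?thesis using *(2)[of i'] that by (simp add: div_mult2_eq)
  qed
  then show ?case using h by blast
qed simp

lemma digits_differ:
  fixes x y B :: nat
  assumes "x \<noteq> y" "x < B ^ e" "y < B ^ e"
  shows "\<exists>i<e. x div B ^ i mod B \<noteq> y div B ^ i mod B"
  using assms
proof (induction e arbitrary: x y)
  case (Suc e)
  show ?case
  proof (cases "x mod B = y mod B")
    case True
    then have "x div B \<noteq> y div B" using Suc.prems(1) by (metis div_mult_mod_eq)
    moreover have "x div B < B ^ e" "y div B < B ^ e"
      using Suc.prems by (auto simp: less_mult_imp_div_less mult.commute)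
    ultimately obtain i where "i < e" "x div B div B ^ i mod B \<noteq> y div B div B ^ i mod B"
      using Suc.IH by blast
    then show ?thesis by (intro exI[of _ "Suc i"]) (auto simp: div_mult2_eq)
  next
    case False
    then show ?thesis by (intro exI[of _ 0]) auto
  qed
qed simp

text \<open>As \<open>a\<close> grows the multiples \<open>a * d\<close> run through \<open>d\<close> periods of length \<open>M\<close>, meeting the window
  at most \<open>B div d + 1\<close> times in each.\<close>

lemma card_mult_mod_window:
  fixes d B L M :: nat
  assumes "0 < d" "L + B \<le> M" "0 < M"
  shows "card {a. a < M \<and> L \<le> a * d mod M \<and> a * d mod M < L + B} \<le> B + d"
proof -
  define W where "W = (\<lambda>j. {a. j * M + L \<le> a * d \<and> a * d < j * M + L + B})"
  have fin: "finite (W j) \<and> card (W j) \<le> B div d + 1" for j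
  proof (cases "W j = {}")
    case False
    define a0 where "a0 = (LEAST a. a \<in> W j)"
    have a0: "a0 \<in> W j" "\<And>a. a \<in> W j \<Longrightarrow> a0 \<le> a"
      using False by (auto simp: a0_def intro: LeastI Least_le)
    \<comment> \<open>Within one window the multiples advance by \<open>d\<close> from the least
      one, which leaves room for at most \<open>B div d\<close> more.\<close>
    have "W j \<subseteq> {a0..a0 + B div d}"
    proof
      fix a assume a: "a \<in> W j"
      then have "a0 \<le> a" using a0 by auto
      moreover have "(a - a0) * d \<le> B" using a a0(1) by (auto simp: W_def diff_mult_distrib)
      then have "a - a0 \<le> B div d" using assms(1) by (simp add: less_eq_div_iff_mult_less_eq)
      ultimately show "a \<in> {a0..a0 + B div d}" by auto
    qed
    then show ?thesis using card_mono[of "{a0..a0 + B div d}"] finite_subset by fastforce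
  qed auto
  have "{a. a < M \<and> L \<le> a * d mod M \<and> a * d mod M < L + B} \<subseteq> (\<Union>j<d. W j)"
  proof
    fix a assume a: "a \<in> {a. a < M \<and> L \<le> a * d mod M \<and> a * d mod M < L + B}"
    then have "a * d < d * M" using assms(1) by simp
    then have "a * d div M < d" by (rule less_mult_imp_div_less)
    moreover have "a \<in> W (a * d div M)"
    proof -
      have "L \<le> a * d mod M" "a * d mod M < L + B" using a by auto
      then show ?thesis using div_mult_mod_eq[of "a * d" M] unfolding W_def mem_Collect_eq by linarith
    qed
    ultimately show "a \<in> (\<Union>j<d. W j)" by blast
  qed
  then have "card {a. a < M \<and> L \<le> a * d mod M \<and> a * d mod M < L + B} \<le> card (\<Union>j<d. W j)"
    using fin by (intro card_mono) auto
  also have "\<dots> \<le> (\<Sum>j<d. card (W j))" by (rule card_UN_le) simp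
  also have "\<dots> \<le> d * (B div d + 1)" using sum_bounded_above[of "{..<d}" "\<lambda>j. card (W j)" "B div d + 1"] fin by simp
  also have "\<dots> \<le> B + d" by (simp add: algebra_simps)
  finally show ?thesis .
qed

text \<open>Equal buckets put the residues \<open>p\<close> and \<open>q\<close> into the same block
  of length \<open>B\<close>. Their difference modulo \<open>Q * B\<close> is that of
  \<open>a * (y - x)\<close>, which is thus within \<open>B\<close> of a multiple of
  \<open>Q * B\<close>, from above or from below.\<close>

lemma bucket_collision:
  assumes "x < y" "0 < B" "0 < Q" "bucket Q B a x = bucket Q B a y"
  shows "a * (y - x) mod (Q * B) < B \<or> Q * B - B \<le> a * (y - x) mod (Q * B)"
proof -
  let ?M = "Q * B"
  define p q where "p = x * a mod ?M" and "q = y * a mod ?M"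
  have M: "0 < ?M" using assms by simp
  have lt: "p < ?M" "q < ?M" using M by (auto simp: p_def q_def)
  have "p div B = q div B" using assms(4) by (simp add: bucket_def p_def q_def)
  then have "p div B * B = q div B * B" by simp
  moreover note div_mult_mod_eq[of p B] div_mult_mod_eq[of q B] mod_less_divisor[OF assms(2), of p]
      mod_less_divisor[OF assms(2), of q]
  ultimately have near: "p < q + B \<and> q < p + B" by linarith
  have "x * a + a * (y - x) = y * a" using assms(1) by (simp add: algebra_simps diff_mult_distrib2)
  then have "(p + a * (y - x) mod ?M) mod ?M = q" by (simp add: p_def q_def mod_simps)
  then have "p + a * (y - x) mod ?M = q \<or> p + a * (y - x) mod ?M = q + ?M"
    using lt mod_less_divisor[OF M, of "a * (y - x)"]
    by (cases "p + a * (y - x) mod ?M < ?M") (auto simp: le_mod_geq not_less)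
  then show ?thesis using near by linarith
qed

text \<open>A collision places \<open>a * (y - x)\<close> in one of two windows of length
  \<open>B\<close>, at either end of the period. Each is hit by at most \<open>B + (y - x)\<close>,
  hence at most \<open>2 * B\<close>, multipliers.\<close>

lemma card_bucket_collision:
  assumes "x \<noteq> y" "x < B" "y < B" "0 < Q"
  shows "card {a. a < Q * B \<and> bucket Q B a x = bucket Q B a y} \<le> 4 * B"
  using assms
proof (induction x y rule: linorder_wlog)
  case (le x y)
  let ?M = "Q * B" and ?d = "y - x"
  have d: "0 < ?d" "?d \<le> B" and B: "0 < B" "B \<le> ?M" "0 < ?M" using le by auto
  have "{a. a < ?M \<and> bucket Q B a x = bucket Q B a y} \<subseteq>
      {a. a < ?M \<and> 0 \<le> a * ?d mod ?M \<and> a * ?d mod ?M < 0 + B} \<union>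
      {a. a < ?M \<and> ?M - B \<le> a * ?d mod ?M \<and> a * ?d mod ?M < ?M - B + B}"
    using bucket_collision[of x y B Q] le B by auto
  from card_mono[OF _ this]
  have "card {a. a < ?M \<and> bucket Q B a x = bucket Q B a y} \<le>
      card ({a. a < ?M \<and> 0 \<le> a * ?d mod ?M \<and> a * ?d mod ?M < 0 + B} \<union>
      {a. a < ?M \<and> ?M - B \<le> a * ?d mod ?M \<and> a * ?d mod ?M < ?M - B + B})" by simp
  also have "\<dots> \<le> (B + ?d) + (B + ?d)"
    by (rule order_trans[OF card_Un_le add_mono]; rule card_mult_mod_window) (use d B in auto)
  finally show ?case using d by simp
next
  case (sym x y)
  then show ?case by (simp add: eq_commute)
qed

text \<open>A union bound over pairs: two elements differ in some digit, and a common hash value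
  forces a bucket collision in that digit.\<close>

lemma card_hash_not_inj:
  assumes "finite S" "\<And>x. x \<in> S \<Longrightarrow> x < B ^ e" "0 < Q" "0 < B"
  shows "card {a. a < Q * B \<and> \<not> inj_on (hash Q B a e 0) S} \<le> (card S)\<^sup>2 * (4 * B)"
proof -
  define D where "D = (\<lambda>(x, y). if x = y then {} else {a. a < Q * B \<and> hash Q B a e 0 x = hash Q B a e 0 y})"
  have D: "card (D p) \<le> 4 * B" if p: "p \<in> S \<times> S" for p
  proof (cases p)
    case (Pair x y)
    show ?thesis
    proof (cases "x = y")
      case False
      then obtain i where i: "i < e" "x div B ^ i mod B \<noteq> y div B ^ i mod B"
        using digits_differ assms(2) p Pair by blast
      have "D p \<subseteq> {a. a < Q * B \<and> bucket Q B a (x div B ^ i mod B) = bucket Q B a (y div B ^ i mod B)}"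
      proof
        fix a assume "a \<in> D p"
        then have a: "a < Q * B" "hash Q B a e 0 x = hash Q B a e 0 y" using False by (auto simp: D_def Pair)
        from hash_eqD[OF assms(3,4) a(2)] i(1) a(1)
        show "a \<in> {a. a < Q * B \<and> bucket Q B a (x div B ^ i mod B) = bucket Q B a (y div B ^ i mod B)}"
          by blast
      qed
      then have "card (D p) \<le> card {a. a < Q * B \<and> bucket Q B a (x div B ^ i mod B) = bucket Q B a (y div B ^ i mod B)}"
        by (intro card_mono) auto
      also have "\<dots> \<le> 4 * B" using i(2) assms by (intro card_bucket_collision) auto
      finally show ?thesis .
    qed (simp add: D_def Pair)
  qed
  have "{a. a < Q * B \<and> \<not> inj_on (hash Q B a e 0) S} \<subseteq> (\<Union>p\<in>S \<times> S. D p)"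
  proof
    fix a assume a: "a \<in> {a. a < Q * B \<and> \<not> inj_on (hash Q B a e 0) S}"
    then obtain x y where "x \<in> S" "y \<in> S" "x \<noteq> y" "hash Q B a e 0 x = hash Q B a e 0 y"
      by (auto simp: inj_on_def)
    with a show "a \<in> (\<Union>p\<in>S \<times> S. D p)" by (intro UN_I[of "(x, y)"]) (auto simp: D_def)
  qed
  then have "card {a. a < Q * B \<and> \<not> inj_on (hash Q B a e 0) S} \<le> card (\<Union>p\<in>S \<times> S. D p)"
    using assms(1) by (intro card_mono) (auto simp: D_def)
  also have "\<dots> \<le> (\<Sum>p\<in>S \<times> S. card (D p))" using assms(1) by (intro card_UN_le) auto
  also have "\<dots> \<le> card (S \<times> S) * (4 * B)" using sum_bounded_above[of "S \<times> S" "\<lambda>p. card (D p)" "4 * B"] D by simp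
  finally show ?thesis by (simp add: card_cartesian_product power2_eq_square)
qed

text \<open>A table of \<open>b\<close>-bit values is a single number read in base 2^b; this lets a
  number below 2^(b*U) stand for a colouring of all \<open>U\<close> hash values.\<close>

lemma ex_digit_sequence:
  fixes b :: nat and g :: "nat \<Rightarrow> nat"
  assumes "\<And>h. g h < 2 ^ b"
  shows "\<exists>c<2 ^ (b * U). \<forall>h<U. c div 2 ^ (b * h) mod 2 ^ b = g h"
proof (induction U)
  case (Suc U)
  then obtain c where c: "c < 2 ^ (b * U)" "\<And>h. h < U \<Longrightarrow> c div 2 ^ (b * h) mod 2 ^ b = g h" by blast
  let ?c = "c + g U * 2 ^ (b * U)"
  have "?c < (g U + 1) * 2 ^ (b * U)" using c(1) by simp
  also have "\<dots> \<le> 2 ^ b * 2 ^ (b * U)" using assms[of U] by (intro mult_right_mono) auto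
  finally have "?c < 2 ^ (b * Suc U)" by (simp add: power_add)
  moreover have "?c div 2 ^ (b * h) mod 2 ^ b = g h" if "h < Suc U" for h
  proof (cases "h = U")
    case True
    then show ?thesis using c(1) assms[of U] by simp
  next
    case False
    then have h: "h < U" using that by simp
    then obtain d where d: "U = Suc (h + d)" using less_imp_Suc_add by blast
    have e: "b * U = b * h + (b + b * d)" unfolding d by (simp add: algebra_simps)
    \<comment> \<open>Below the top digit the new summand, once divided by 2^(b*h), is a multiple of
      2^b and disappears in the remainder.\<close>
    have "?c = c + (g U * 2 ^ (b * d) * 2 ^ b) * 2 ^ (b * h)"
      unfolding e power_add by (simp only: mult_ac)
    then have "?c div 2 ^ (b * h) = g U * 2 ^ (b * d) * 2 ^ b + c div 2 ^ (b * h)"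
      by (simp only: div_mult_self1[of "2 ^ (b * h)"] power_not_zero) simp
    then show ?thesis using c(2)[OF h] by simp
  qed
  ultimately show ?case by blast
qed simp

definition colour :: "nat \<Rightarrow> nat \<Rightarrow> nat \<Rightarrow> nat" where
  "colour b c h = c div 2 ^ (b * h) mod 2 ^ b"

lemma ex_colour:
  assumes "k \<le> 2 ^ b" "inj_on (\<lambda>i. h (f i)) {..<k}" "\<And>i. i < k \<Longrightarrow> h (f i) < U"
  shows "\<exists>c<2 ^ (b * U). \<forall>i<k. colour b c (h (f i)) = i"
proof -
  \<comment> \<open>A hash value met on the cycle gets its position there as colour; the others get
    0, which is arbitrary.\<close>
  define g where "g = (\<lambda>x. if \<exists>i<k. h (f i) = x then (THE i. i < k \<and> h (f i) = x) else 0)"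
  have g: "g (h (f i)) = i" if "i < k" for i
  proof -
    have "(THE j. j < k \<and> h (f j) = h (f i)) = i"
      using that assms(2) by (intro the_equality) (auto simp: inj_on_def)
    then show ?thesis using that by (auto simp: g_def)
  qed
  have "g x < 2 ^ b" for x
  proof (cases "\<exists>i<k. h (f i) = x")
    case True
    then obtain i where "i < k" "h (f i) = x" by blast
    then show ?thesis using g[of i] assms(1) by auto
  qed (auto simp: g_def)
  then obtain c where c: "c < 2 ^ (b * U)" "\<And>h. h < U \<Longrightarrow> c div 2 ^ (b * h) mod 2 ^ b = g h"
    using ex_digit_sequence[of g b U] by blast
  then have "\<forall>i<k. colour b c (h (f i)) = i" using g assms(3) unfolding colour_def by simp
  then show ?thesis using c(1) by blast
qed

section \<open>The program that constructs the layered graph\<close>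

fun seqs :: "prog list \<Rightarrow> prog" where
  "seqs [] = Skip"
| "seqs (P # Ps) = Seq P (seqs Ps)"

fun rep :: "nat \<Rightarrow> prog \<Rightarrow> prog" where
  "rep 0 P = Skip"
| "rep (Suc e) P = Seq P (rep e P)"

lemma rand_free_seqs [simp]: "rand_free (seqs Ps) \<longleftrightarrow> (\<forall>P\<in>set Ps. rand_free P)"
  by (induction Ps) auto

lemma rand_free_rep: "rand_free P \<Longrightarrow> rand_free (rep e P)"
  by (induction e) auto

declare non_expanding_def [simp]

text \<open>The old memory with a list laid over it, from \<open>off\<close> on with stride 3.
  Storing at the write position then amounts to appending to the list.\<close>

definition put :: "(nat \<Rightarrow> nat) \<Rightarrow> nat \<Rightarrow> nat list \<Rightarrow> nat \<Rightarrow> nat" where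
  "put \<mu> off xs a = (if \<exists>q<length xs. a = off + 3 * q then xs ! ((a - off) div 3) else \<mu> a)"

lemma put_Nil [simp]: "put \<mu> off [] = \<mu>"
  by (auto simp: put_def fun_eq_iff)

lemma put_snoc:
  assumes "a = off + 3 * length xs"
  shows "(put \<mu> off xs)(a := x) = put \<mu> off (xs @ [x])"
  using assms by (auto simp: put_def fun_eq_iff nth_append less_Suc_eq)

lemma put_update:
  assumes "q < length xs" "a = off + 3 * q"
  shows "(put \<mu> off xs)(a := x) = put \<mu> off (xs[q := x])"
  using assms by (auto simp: put_def fun_eq_iff nth_list_update)

lemma put_below: "a < off \<Longrightarrow> put \<mu> off xs a = \<mu> a"
  by (auto simp: put_def)

definition flat :: "(nat \<times> nat) list \<Rightarrow> nat list" where
  "flat xs = concat (map (\<lambda>(u, v). [u, v]) xs)"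

lemma flat_simps [simp]: "flat [] = []" "flat (e # xs) = fst e # snd e # flat xs"
    "flat (xs @ ys) = flat xs @ flat ys"
  by (auto simp: flat_def split_def)

lemma length_flat [simp]: "length (flat xs) = 2 * length xs"
  by (induction xs) auto

lemma nth_flat: "e < length xs \<Longrightarrow> flat xs ! (2 * e) = fst (xs ! e) \<and> flat xs ! (2 * e + 1) = snd (xs ! e)"
proof (induction xs arbitrary: e)
  case (Cons x xs)
  then show ?case by (cases e) auto
qed simp

text \<open>
  Registers: 1 counts the affirmative answers, 2 holds 0 between the steps of a simulation, 3 and 4
  the position and the stride of the memory window, 5 and 6 the size of the graph, 7 the base
  \<open>B\<close>, 8 the modulus \<open>Q * B\<close>, 9 the multiplier, 10 the number of copies, 11 the constant 1,
  12 the write position, 13 the number of vertices in all copies, 14 a loop counter, 15 the number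
  of the current copy; 16 to 26 are temporary.
\<close>

definition colour_step :: prog where
  "colour_step = seqs [BinOp 23 Mod 21 7, BinOp 23 Mul 23 26, BinOp 23 Mod 23 8, BinOp 23 Div 23 7,
     BinOp 22 Mul 22 24, BinOp 22 Add 22 23, BinOp 21 Div 21 7]"

text \<open>The copy number in register 15 encodes a pair: its remainder modulo \<open>C\<close> is
  the colouring, and its quotient is added to the multiplier in register 9. Subtracting register 2,
  which is 0, copies a register.\<close>

definition colour_prog :: "nat \<Rightarrow> nat \<Rightarrow> nat \<Rightarrow> nat \<Rightarrow> reg \<Rightarrow> reg \<Rightarrow> prog" where
  "colour_prog b Q E C src dst = seqs [SetConst 24 C, BinOp 25 Mod 15 24, BinOp 26 Div 15 24,
     BinOp 26 Add 26 9, SetConst 22 0, BinOp 21 Sub src 2, SetConst 24 Q, rep E colour_step,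
     SetConst 24 b, BinOp 22 Mul 22 24, BinOp 25 ShiftR 25 22, SetConst 24 (2 ^ b), BinOp dst Mod 25 24]"

text \<open>The input fills the cells 0 to 2m+1, so the window starts at 2m+2+j, where
  \<open>j\<close> selects its residue class.\<close>

definition setup_prog :: "nat \<Rightarrow> nat \<Rightarrow> prog" where
  "setup_prog E j = seqs [SetConst 11 1, SetConst 4 3, SetConst 2 0, Load 5 2, Load 6 11,
     SetConst 24 (2 + j), BinOp 3 Add 6 6, BinOp 3 Add 3 24, SetConst 7 1, BinOp 16 Add 6 6, SetConst 24 E]"

definition base_prog :: prog where
  "base_prog = WhileNonzero 16 (Seq (BinOp 16 ShiftR 16 24) (BinOp 7 Add 7 7))"

definition modulus_prog :: "nat \<Rightarrow> prog" where
  "modulus_prog Q = Seq (SetConst 24 Q) (BinOp 8 Mul 24 7)"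

definition copies_prog :: "model \<Rightarrow> nat \<Rightarrow> prog" where
  "copies_prog R C = seqs [SetConst 10 C,
     if R = Randomized then Skip else BinOp 10 Mul 10 8,
     BinOp 13 Mul 10 5, SetConst 24 6, BinOp 12 Add 3 24, BinOp 14 Sub 13 2]"

definition pendant_prog :: prog where
  "pendant_prog = seqs [BinOp 14 Sub 14 11, Store 12 14, BinOp 12 Add 12 4,
     BinOp 16 Add 13 14, Store 12 16, BinOp 12 Add 12 4]"

definition read_prog :: prog where
  "read_prog = seqs [BinOp 14 Sub 14 11, BinOp 15 Div 14 6, BinOp 16 Mod 14 6, BinOp 16 Add 16 16,
     SetConst 24 2, BinOp 16 Add 16 24, Load 17 16, BinOp 16 Add 16 11, Load 18 16]"

definition emit_prog :: "nat \<Rightarrow> prog" where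
  "emit_prog k = seqs [SetConst 24 k, BinOp 25 Less 19 24, BinOp 19 Add 19 11, BinOp 19 Mod 19 24,
     BinOp 26 Equal 19 20, BinOp 25 Mul 25 26,
     IfNonzero 25 (seqs [BinOp 16 Mul 15 5, BinOp 17 Add 16 17, Store 12 17, BinOp 12 Add 12 4,
       BinOp 18 Add 16 18, Store 12 18, BinOp 12 Add 12 4]) Skip]"

definition main_prog :: "nat \<Rightarrow> nat \<Rightarrow> nat \<Rightarrow> nat \<Rightarrow> nat \<Rightarrow> prog" where
  "main_prog k b Q E C =
     seqs [read_prog, colour_prog b Q E C 17 19, colour_prog b Q E C 18 20, emit_prog k]"

text \<open>The number of arcs is known only after the colour tests, so the first two cells of the
  window are filled last. An arc takes two cells of stride 3; the distance of the write position
  from \<open>off + 6\<close>, divided by 6, is the count.\<close>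

definition header_prog :: prog where
  "header_prog = seqs [BinOp 16 Add 13 13, Store 3 16, BinOp 12 Sub 12 3, SetConst 24 6,
     BinOp 12 Sub 12 24, BinOp 12 Div 12 24, BinOp 16 Add 3 4, Store 16 12]"

definition build_prog :: "model \<Rightarrow> nat \<Rightarrow> nat \<Rightarrow> nat \<Rightarrow> nat \<Rightarrow> nat \<Rightarrow> prog" where
  "build_prog R k b Q E C = Seq (copies_prog R C) (Seq (WhileNonzero 14 pendant_prog)
     (Seq (BinOp 14 Mul 10 6) (Seq (WhileNonzero 14 (main_prog k b Q E C)) header_prog)))"

definition build_const :: "model \<Rightarrow> nat \<Rightarrow> nat \<Rightarrow> nat \<Rightarrow> nat \<Rightarrow> nat \<Rightarrow> nat" where
  "build_const R k b Q E C = cost (copies_prog R C) + cost pendant_prog + cost (main_prog k b Q E C)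
     + cost header_prog + 10"

text \<open>\<open>\<mu>\<close> and \<open>R0\<close> are the memory and the high registers at the
  beginning of a round. The bounds keep within a word, in this order: the write position, the number
  of copies, the products of a digit and a multiplier, the hash values and the shift
  amounts.\<close>

locale construction = layered G es n k N col
  for G es n k N col +
  fixes b Q E j B A C w m off cnt :: nat and R0 \<mu> :: "nat \<Rightarrow> nat" and R :: model
  assumes m: "m = length es" and off: "off = 2 * m + 2 + j" and QB: "0 < Q" "0 < B"
    and input_mem: "\<And>e. e < m \<Longrightarrow> \<mu> (2 + 2 * e) = fst (es ! e) \<and> \<mu> (3 + 2 * e) = snd (es ! e)"
    and window: "\<And>q. \<mu> (off + 3 * q) = 0"
    and col_eq: "col = (\<lambda>I v. colour b (I mod C) (hash Q B (A + I div C) E 0 v))"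
    and A_less: "\<And>I. I < N \<Longrightarrow> A + I div C < Q * B"
    and N_eq: "N = (if R = Randomized then C else C * (Q * B))"
    and const_less: "k < 2 ^ w" "C < 2 ^ w" "Q < 2 ^ w" "b < 2 ^ w" "2 ^ b < (2::nat) ^ w" "6 < (2::nat) ^ w"
    and bounds: "off + 6 + 6 * (N * n + N * m) < 2 ^ w" "N < 2 ^ w" "Q * B * B \<le> 2 ^ w"
      "Q ^ E \<le> 2 ^ w" "b * Q ^ E < 2 ^ w"
begin

definition core :: "nat list \<Rightarrow> state \<Rightarrow> bool" where
  "core xs s \<longleftrightarrow> mem s = put \<mu> off xs \<and> (\<forall>r\<ge>40. regs s r = R0 r) \<and>
     regs s 1 = cnt \<and> regs s 2 = 0 \<and> regs s 3 = off \<and> regs s 4 = 3 \<and> regs s 5 = n \<and> regs s 6 = m \<and>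
     regs s 7 = B \<and> regs s 8 = Q * B \<and> regs s 9 = A \<and> regs s 10 = N \<and> regs s 11 = 1 \<and> regs s 13 = N * n"

lemma w_pos: "0 < w"
  using const_less(6) by (intro gr0I) auto

text \<open>The bound on \<open>Suc (regs s 22) * Q ^ e\<close> is the invariant of the Horner
  scheme: the remaining \<open>e\<close> digits still cannot push the hash value beyond
  \<open>Q ^ E\<close>.\<close>

lemma wp_colour_step:
  assumes "regs s 7 = B" "regs s 8 = Q * B" "regs s 24 = Q" "regs s 26 = a" "a < Q * B"
    "Suc (regs s 22) * Q ^ e \<le> Q ^ E" "e \<le> E"
    and "\<And>s'. mem s' = mem s \<Longrightarrow> (\<And>r. r \<notin> {21, 22, 23} \<Longrightarrow> regs s' r = regs s r) \<Longrightarrow>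
      regs s' 22 = hash Q B a e (regs s 22) (regs s 21) \<Longrightarrow> P s'"
  shows "wp w (rep e colour_step) P s"
  using assms
proof (induction e arbitrary: s)
  case 0
  then show ?case by auto
next
  case (Suc e)
  let ?d = "regs s 21 mod B"
  let ?h = "regs s 22 * Q + bucket Q B a ?d"
  have "?d * a < B * (Q * B)" using Suc.prems(5) QB by (intro mult_strict_mono) auto
  then have 1: "?d * a < 2 ^ w" using bounds(3) by (simp add: mult_ac)
  have "?h < Suc (regs s 22) * Q" using bucket_less[OF QB, of a ?d] by simp
  then have s: "Suc ?h \<le> Suc (regs s 22) * Q" by simp
  have "1 \<le> Q ^ e" using QB by simp
  then have "Suc (regs s 22) * Q * 1 \<le> Suc (regs s 22) * Q * Q ^ e" by (rule mult_le_mono2)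
  also have "\<dots> \<le> Q ^ E" using Suc.prems(6) by (simp add: algebra_simps)
  finally have "Suc ?h \<le> Q ^ E" using s by simp
  then have 2: "?h < 2 ^ w" using bounds(4) by linarith
  have "Suc ?h * Q ^ e \<le> Suc (regs s 22) * Q * Q ^ e" using s by (rule mult_le_mono1)
  also have "\<dots> \<le> Q ^ E" using Suc.prems(6) by (simp add: algebra_simps)
  finally have 3: "Suc ?h * Q ^ e \<le> Q ^ E" .
  show ?case
    unfolding rep.simps wp.simps
    apply (subst colour_step_def)
    apply (simp add: Suc.prems)
    apply (intro conjI)
    subgoal using 1 by simp
    subgoal using 2 by simp
    subgoal using 2 by (simp add: bucket_def)
    subgoal
      apply (rule Suc.IH)
      using 3 Suc.prems apply (simp_all add: bucket_def)
      done
    done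
qed

lemma wp_colour_prog:
  assumes "regs s 2 = 0" "regs s 7 = B" "regs s 8 = Q * B" "regs s 9 = A" "regs s 15 < N"
    and "src \<notin> {21, 22, 23, 24, 25, 26}" "dst \<notin> {21, 22, 23, 24, 25, 26}"
    and P: "\<And>s'. mem s' = mem s \<Longrightarrow> (\<And>r. r \<notin> insert dst {21, 22, 23, 24, 25, 26} \<Longrightarrow> regs s' r = regs s r) \<Longrightarrow>
      regs s' dst = col (regs s 15) (regs s src) \<Longrightarrow> P s'"
  shows "wp w (colour_prog b Q E C src dst) P s"
proof -
  have a: "A + regs s 15 div C < Q * B" using A_less assms(5) by blast
  have "Q * B * 1 \<le> Q * B * B" using QB by (intro mult_le_mono2) auto
  then have a': "A + regs s 15 div C < 2 ^ w" using a bounds(3) by linarith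
  have QE: "1 \<le> Q ^ E" using QB by simp
  have h: "b * hash Q B a E 0 v < 2 ^ w" for a v
    using hash_less[OF QB, of a E 0 v] bounds(5) le_less_trans[OF mult_le_mono2] by (metis less_or_eq_imp_le mult_1 One_nat_def)
  show ?thesis
    using assms(6,7) const_less a' QE
    apply (simp add: colour_prog_def assms(1-5) add.commute)
    apply (rule wp_colour_step[where a = "A + regs s 15 div C"])
    using a assms(1-7) apply (simp_all add: add.commute)
    subgoal for s'
      using h[of "A + regs s 15 div C" "regs s src"]
      apply (auto simp: mult.commute)
      apply (rule P)
      apply (auto simp: col_eq colour_def drop_bit_eq_div mult.commute add.commute)
      done
    done
qed

text \<open>Loop counters run downwards, so the arcs appear in reverse order; \<open>pend r\<close>
  is what has been written when the counter stands at \<open>r\<close>, and likewise for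
  \<open>copies r\<close>.\<close>

definition pend :: "nat \<Rightarrow> (nat \<times> nat) list" where
  "pend r = map (\<lambda>x. (x, N * n + x)) (rev [r..<N * n])"

definition copy_arc :: "nat \<Rightarrow> nat \<times> nat" where
  "copy_arc i = (i div m * n + fst (es ! (i mod m)), i div m * n + snd (es ! (i mod m)))"

definition copies :: "nat \<Rightarrow> (nat \<times> nat) list" where
  "copies r = map copy_arc (filter (\<lambda>i. kept (i div m) (es ! (i mod m))) (rev [r..<N * m]))"

lemma pend_Suc: "r < N * n \<Longrightarrow> pend r = pend (Suc r) @ [(r, N * n + r)]"
  by (simp add: pend_def upt_conv_Cons)

lemma pend_top [simp]: "pend (N * n) = []"
  by (simp add: pend_def)

lemma length_pend: "r \<le> N * n \<Longrightarrow> length (pend r) = N * n - r"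
  by (simp add: pend_def)

lemma copies_Suc: "r < N * m \<Longrightarrow>
    copies r = copies (Suc r) @ (if kept (r div m) (es ! (r mod m)) then [copy_arc r] else [])"
  by (simp add: copies_def upt_conv_Cons)

lemma copies_top [simp]: "copies (N * m) = []"
  by (simp add: copies_def)

lemma length_copies: "length (copies r) \<le> N * m - r"
  unfolding copies_def by (rule order_trans[OF eq_refl[OF length_map]], rule order_trans[OF length_filter_le]) simp

lemma es: "distinct es" "set es = parcs G"
  using input by (auto simp: graph_input_def)

lemma es_less: "e < m \<Longrightarrow> fst (es ! e) < n \<and> snd (es ! e) < n"
  using arc_less[of "fst (es ! e)" "snd (es ! e)"] es(2) nth_mem[of e es] m by auto

lemma index_less:
  assumes "i < N * m"
  shows "i mod m < m" "i div m < N"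
proof -
  have "0 < m" using assms by (intro gr0I) auto
  then show "i mod m < m" "i div m < N" using assms by (auto simp: less_mult_imp_div_less)
qed

lemma copy_arc_less:
  assumes "i < N * m"
  shows "fst (copy_arc i) < N * n" "snd (copy_arc i) < N * n"
  using copy_less[OF index_less(2)[OF assms]] es_less[OF index_less(1)[OF assms]]
  by (auto simp: copy_arc_def)

text \<open>The index of a copied arc can be recovered: the tail divided by \<open>n\<close> gives
  the copy, the remainders give the arc in the duplicate-free list \<open>es\<close>. Pendant arcs
  are told apart by their heads, which are at least \<open>N * n\<close>.\<close>

lemma distinct_arcs: "distinct (pend 0 @ copies 0)"
proof -
  have "inj_on copy_arc {..<N * m}"
  proof (rule inj_onI)
    fix i i' assume i: "i \<in> {..<N * m}" "i' \<in> {..<N * m}" and eq: "copy_arc i = copy_arc i'"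
    note less = es_less[OF index_less(1)]
    have "fst (copy_arc i) div n = i div m" if "i < N * m" for i
      using less[OF that] by (simp add: copy_arc_def)
    then have I: "i div m = i' div m" using i eq by (metis lessThan_iff)
    then have "es ! (i mod m) = es ! (i' mod m)" using eq by (simp add: copy_arc_def prod_eq_iff)
    then have "i mod m = i' mod m"
      using es(1) index_less(1) i m by (simp add: nth_eq_iff_index_eq)
    then show "i = i'" using I by (metis div_mult_mod_eq)
  qed
  then have "distinct (copies 0)"
    unfolding copies_def by (auto simp: distinct_map intro: inj_on_subset)
  moreover have "distinct (pend 0)" by (auto simp: pend_def distinct_map inj_on_def)
  moreover have "set (pend 0) \<inter> set (copies 0) = {}"
  proof -
    have "N * n \<le> snd a" if "a \<in> set (pend 0)" for a using that by (auto simp: pend_def)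
    moreover have "snd a < N * n" if "a \<in> set (copies 0)" for a
      using that copy_arc_less(2) by (auto simp: copies_def)
    ultimately show ?thesis by (meson disjoint_iff not_less)
  qed
  ultimately show ?thesis by simp
qed

lemma copy_arc_in:
  assumes "i < N * m" "kept (i div m) (es ! (i mod m))"
  shows "copy_arc i \<in> copy_arcs"
proof -
  have "es ! (i mod m) \<in> set es" using index_less(1)[OF assms(1)] m by (intro nth_mem) simp
  then have "(fst (es ! (i mod m)), snd (es ! (i mod m))) \<in> parcs G" using es(2) by simp
  moreover have "kept (i div m) (fst (es ! (i mod m)), snd (es ! (i mod m)))" using assms(2) by simp
  ultimately show ?thesis
    using index_less(2)[OF assms(1)] unfolding copy_arc_def copy_arcs_def by blast
qed

lemma copy_arc_surj:
  assumes "a \<in> copy_arcs"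
  obtains i where "i < N * m" "kept (i div m) (es ! (i mod m))" "a = copy_arc i"
proof -
  obtain I u v where a: "a = (I * n + u, I * n + v)" "I < N" "(u, v) \<in> set es" "kept I (u, v)"
    using assms es(2) by (auto simp: copy_arcs_def)
  from a(3) obtain e where e: "e < m" "es ! e = (u, v)" unfolding in_set_conv_nth m by blast
  have "I * m + e < Suc I * m" using e by simp
  also have "\<dots> \<le> N * m" using a(2) by (intro mult_right_mono) auto
  finally have "I * m + e < N * m" .
  moreover have d: "(I * m + e) div m = I" "(I * m + e) mod m = e" using e(1) by simp_all
  moreover have "a = copy_arc (I * m + e)" unfolding copy_arc_def d e(2) a(1) by simp
  ultimately show ?thesis using that a(4) e(2) by simp
qed

lemma set_arcs: "set (pend 0 @ copies 0) = parcs H"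
proof -
  have "set (pend 0) = pendant_arcs" by (auto simp: pend_def pendant_arcs_def)
  moreover have "set (copies 0) = copy_arcs"
    using copy_arc_in by (auto simp: copies_def elim!: copy_arc_surj)
  ultimately show ?thesis by (auto simp: H_def)
qed

lemma graph_input_arcs: "graph_input H (pend 0 @ copies 0)"
  using H_input distinct_arcs set_arcs by blast

definition ready :: "state \<Rightarrow> bool" where
  "ready s \<longleftrightarrow> mem s = \<mu> \<and> (\<forall>r\<ge>40. regs s r = R0 r) \<and>
     regs s 1 = cnt \<and> regs s 2 = 0 \<and> regs s 3 = off \<and> regs s 4 = 3 \<and> regs s 5 = n \<and> regs s 6 = m \<and>
     regs s 7 = B \<and> regs s 8 = Q * B \<and> regs s 9 = A \<and> regs s 11 = 1"

definition writing :: "(nat \<times> nat) list \<Rightarrow> state \<Rightarrow> bool" where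
  "writing fs s \<longleftrightarrow> core ([0, 0] @ flat fs) s \<and> regs s 12 = off + 6 + 6 * length fs"

definition inv_pend :: "nat \<Rightarrow> state \<Rightarrow> bool" where
  "inv_pend r s \<longleftrightarrow> r \<le> N * n \<and> writing (pend r) s \<and> regs s 14 = r"

definition inv_main :: "nat \<Rightarrow> state \<Rightarrow> bool" where
  "inv_main r s \<longleftrightarrow> r \<le> N * m \<and> writing (pend 0 @ copies r) s \<and> regs s 14 = r"

definition at_arc :: "nat \<Rightarrow> state \<Rightarrow> bool" where
  "at_arc r s \<longleftrightarrow> r < N * m \<and> writing (pend 0 @ copies (Suc r)) s \<and> regs s 14 = r \<and>
     regs s 15 = r div m \<and> regs s 17 = fst (es ! (r mod m)) \<and> regs s 18 = snd (es ! (r mod m))"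

lemma room: "x \<le> N * n \<Longrightarrow> y \<le> N * m \<Longrightarrow> off + 6 + 6 * (x + y) < 2 ^ w"
  by (rule le_less_trans[OF _ bounds(1)]) (simp add: add_mono)

lemma small: "off + 6 < 2 ^ w" "N * n < 2 ^ w" "N * m < 2 ^ w" "r \<le> N * n \<Longrightarrow> N * n + r < 2 ^ w"
proof -
  have *: "off + 6 < W \<and> x < W \<and> y < W \<and> (r \<le> x \<longrightarrow> x + r < W)"
    if "off + 6 + 6 * (x + y) < W" for x y W :: nat
    using that by auto
  show "off + 6 < 2 ^ w" "N * n < 2 ^ w" "N * m < 2 ^ w" "r \<le> N * n \<Longrightarrow> N * n + r < 2 ^ w"
    using *[OF bounds(1)] by auto
qed

lemma coreD:
  assumes "core xs s"
  shows "mem s = put \<mu> off xs" "\<And>r. 40 \<le> r \<Longrightarrow> regs s r = R0 r"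
    "regs s 1 = cnt" "regs s (Suc 0) = cnt" "regs s 2 = 0" "regs s 3 = off" "regs s 4 = 3" "regs s 5 = n"
    "regs s 6 = m" "regs s 7 = B" "regs s 8 = Q * B" "regs s 9 = A" "regs s 10 = N" "regs s 11 = 1"
    "regs s 13 = N * n"
  using assms by (auto simp: core_def)

lemma hoare_copies: "hoare w (cost (copies_prog R C)) ready (copies_prog R C) (inv_pend (N * n))"
proof (rule hoare_wpI[OF w_pos _ order_refl])
  fix s assume "ready s"
  then have s: "mem s = \<mu>" "\<And>r. 40 \<le> r \<Longrightarrow> regs s r = R0 r" "regs s 1 = cnt" "regs s (Suc 0) = cnt"
    "regs s 2 = 0" "regs s 3 = off" "regs s 4 = 3" "regs s 5 = n" "regs s 6 = m"
    "regs s 7 = B" "regs s 8 = Q * B" "regs s 9 = A" "regs s 11 = 1"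
    by (auto simp: ready_def)
  \<comment> \<open>The fresh window is zero, so the two placeholders of the header are already
    there.\<close>
  have p: "put \<mu> off [0, 0] = \<mu>"
    using window[of 0] window[of 1] by (auto simp: put_def fun_eq_iff less_Suc_eq)
  have *: "(if R = Randomized then C else C * (Q * B)) = N" using N_eq by simp
  show "wp w (copies_prog R C) (inv_pend (N * n)) s"
    using small bounds(2) const_less *
    by (cases R) (simp_all add: copies_prog_def s p inv_pend_def writing_def core_def)
qed

lemma hoare_pendant: "hoare w (cost pendant_prog) (inv_pend (Suc r)) pendant_prog (inv_pend r)"
proof (rule hoare_wpI[OF w_pos _ order_refl])
  fix s assume "inv_pend (Suc r) s"
  then have r: "r < N * n" and c: "core ([0, 0] @ flat (pend (Suc r))) s"
    and s: "regs s 12 = off + 6 + 6 * length (pend (Suc r))" "regs s 14 = Suc r"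
    by (auto simp: inv_pend_def writing_def)
  let ?p = "off + 6 + 6 * length (pend (Suc r))"
  have b: "?p + 6 < 2 ^ w" "N * n + r < 2 ^ w"
    using room[of "Suc (length (pend (Suc r)))" 0] small(4)[of r] r by (auto simp: length_pend)
  have "((put \<mu> off ([0, 0] @ flat (pend (Suc r))))(?p := r))(?p + 3 := N * n + r) =
      put \<mu> off ([0, 0] @ flat (pend r))"
    using r by (simp add: put_snoc pend_Suc)
  then show "wp w pendant_prog (inv_pend r) s"
    using b r by (simp add: pendant_prog_def inv_pend_def writing_def core_def pend_Suc s coreD[OF c] add.assoc)
qed

lemma writing_cong:
  assumes "writing fs s" "mem s' = mem s"
    "\<And>r. r \<in> {1, 2, 3, 4, 5, 6, 7, 8, 9, 10, 11, 12, 13} \<union> {40..} \<Longrightarrow> regs s' r = regs s r"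
  shows "writing fs s'"
  using assms by (simp add: writing_def core_def)

lemma hoare_read: "hoare w (cost read_prog) (inv_main (Suc r)) read_prog (at_arc r)"
proof (rule hoare_wpI[OF w_pos _ order_refl])
  fix s assume "inv_main (Suc r) s"
  then have r: "r < N * m" and c: "core ([0, 0] @ flat (pend 0 @ copies (Suc r))) s"
    and s: "regs s 12 = off + 6 + 6 * length (pend 0 @ copies (Suc r))" "regs s 14 = Suc r"
    by (auto simp: inv_main_def writing_def)
  let ?e = "r mod m"
  have e: "?e < m" by (rule index_less(1)[OF r])
  have b: "3 + 2 * ?e < 2 ^ w" "2 + 2 * ?e < off" "3 + 2 * ?e < off"
    using small(1) off e by linarith+
  have eq: "Suc (Suc (?e + ?e)) = 2 + 2 * ?e" "Suc (Suc (Suc (?e + ?e))) = 3 + 2 * ?e" by simp_all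
  have "put \<mu> off ([0, 0] @ flat (pend 0 @ copies (Suc r))) (Suc (Suc (?e + ?e))) = fst (es ! ?e)"
    unfolding eq(1) using b input_mem[OF e] by (simp only: put_below)
  moreover have "put \<mu> off ([0, 0] @ flat (pend 0 @ copies (Suc r))) (Suc (Suc (Suc (?e + ?e)))) = snd (es ! ?e)"
    unfolding eq(2) using b input_mem[OF e] by (simp only: put_below)
  ultimately show "wp w read_prog (at_arc r) s"
    using b r const_less
    by (simp add: read_prog_def at_arc_def writing_def core_def s coreD[OF c])
qed

text \<open>\<open>X\<close> is a frame condition: it carries the colour of the tail, held in
  register 19, across the computation for the head.\<close>

lemma hoare_colour:
  assumes "src \<in> {17, 18}" "dst \<in> {19, 20}"
    "\<And>s s' :: state. X s \<Longrightarrow> regs s' 19 = regs s 19 \<or> dst = 19 \<Longrightarrow> X s'"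
  shows "hoare w (cost (colour_prog b Q E C src dst)) (\<lambda>s. at_arc r s \<and> X s) (colour_prog b Q E C src dst)
     (\<lambda>s. at_arc r s \<and> X s \<and> regs s dst = col (r div m) (regs s src))"
proof (rule hoare_wpI[OF w_pos _ order_refl])
  fix s assume s: "at_arc r s \<and> X s"
  then have c: "core ([0, 0] @ flat (pend 0 @ copies (Suc r))) s" and r: "r < N * m"
    by (auto simp: at_arc_def writing_def)
  show "wp w (colour_prog b Q E C src dst)
      (\<lambda>s. at_arc r s \<and> X s \<and> regs s dst = col (r div m) (regs s src)) s"
  proof (rule wp_colour_prog)
    fix s' :: state
    assume s': "mem s' = mem s" "\<And>r. r \<notin> insert dst {21, 22, 23, 24, 25, 26} \<Longrightarrow> regs s' r = regs s r"
      "regs s' dst = col (regs s 15) (regs s src)"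
    have "writing (pend 0 @ copies (Suc r)) s'"
      using s s' assms(2) unfolding at_arc_def by (elim conjE, elim writing_cong) auto
    then have "at_arc r s'" using s s' assms(2) unfolding at_arc_def by auto
    moreover have "X s'" using s s'(2)[of 19] assms(2,3) by auto
    moreover have "regs s' src = regs s src" using s'(2)[of src] assms(1,2) by auto
    ultimately show "at_arc r s' \<and> X s' \<and> regs s' dst = col (r div m) (regs s' src)"
      using s s'(3) by (auto simp: at_arc_def)
  qed (use s c index_less[OF r] assms in \<open>auto simp: core_def at_arc_def\<close>)
qed

lemma hoare_emit:
  "hoare w (cost (emit_prog k)) (\<lambda>s. at_arc r s \<and> regs s 19 = col (r div m) (regs s 17) \<and>
      regs s 20 = col (r div m) (regs s 18)) (emit_prog k) (inv_main r)"
proof (rule hoare_wpI[OF w_pos _ order_refl])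
  fix s assume *: "at_arc r s \<and> regs s 19 = col (r div m) (regs s 17) \<and> regs s 20 = col (r div m) (regs s 18)"
  let ?f = "pend 0 @ copies (Suc r)" and ?u = "fst (es ! (r mod m))" and ?v = "snd (es ! (r mod m))"
    and ?I = "r div m"
  let ?p = "off + 6 + 6 * length ?f"
  have r: "r < N * m" and c: "core ([0, 0] @ flat ?f) s"
    and s: "regs s 12 = ?p" "regs s 14 = r" "regs s 15 = ?I" "regs s 17 = ?u" "regs s 18 = ?v"
      "regs s 19 = col ?I ?u" "regs s 20 = col ?I ?v"
    using * by (auto simp: at_arc_def writing_def)
  have p: "?p + 6 < 2 ^ w"
    using room[of "length (pend 0)" "Suc (length (copies (Suc r)))"] r length_copies[of "Suc r"]
    by (simp add: length_pend)
  have uv: "?I * n + ?u < N * n" "?I * n + ?v < N * n" using copy_arc_less[OF r] by (auto simp: copy_arc_def)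
  then have b: "?I * n + ?u < 2 ^ w" "?I * n + ?v < 2 ^ w" "?I * n < 2 ^ w" using small(2) by linarith+
  have "col I x < 2 ^ b" for I x by (simp add: col_eq colour_def)
  then have cl: "Suc (col I x) < 2 ^ w" for I x using const_less(5) by (meson Suc_leI le_less_trans)
  have mem: "((put \<mu> off ([0, 0] @ flat ?f))(?p := ?I * n + ?u))(?p + 3 := ?I * n + ?v) =
      put \<mu> off ([0, 0] @ flat (?f @ [copy_arc r]))"
    by (simp add: put_snoc copy_arc_def)
  have 1: "Suc 0 < (2::nat) ^ w" using const_less(6) by linarith
  show "wp w (emit_prog k) (inv_main r) s"
  proof (cases "kept ?I (es ! (r mod m))")
    case True
    then have k': "col ?I ?u < k" "Suc (col ?I ?u) mod k = col ?I ?v" by (auto simp: kept_def)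
    show ?thesis
      using p b mem const_less 1 True r k' cl[of ?I ?u]
      by (simp add: emit_prog_def inv_main_def writing_def core_def copies_Suc[OF r] s coreD[OF c] add.assoc)
  next
    case False
    then have k': "\<not> (col ?I ?u < k \<and> Suc (col ?I ?u) mod k = col ?I ?v)" by (auto simp: kept_def)
    show ?thesis
      using const_less 1 False r k' cl[of ?I ?u]
      by (simp add: emit_prog_def inv_main_def writing_def core_def copies_Suc[OF r] s coreD[OF c])
  qed
qed

lemma hoare_main: "hoare w (cost (main_prog k b Q E C)) (inv_main (Suc r)) (main_prog k b Q E C) (inv_main r)"
proof -
  let ?X = "\<lambda>s. regs s 19 = col (r div m) (fst (es ! (r mod m)))"
  have S: "hoare w 0 (inv_main r) Skip (inv_main r)" by (auto simp: hoare_def)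
  have 1: "hoare w (cost (colour_prog b Q E C 17 19)) (at_arc r) (colour_prog b Q E C 17 19)
      (\<lambda>s. at_arc r s \<and> ?X s)"
    by (rule hoare_mono[OF hoare_colour[where X = "\<lambda>s. True" and src = 17 and dst = 19 and r = r]])
      (auto simp: at_arc_def)
  have 2: "hoare w (cost (colour_prog b Q E C 18 20)) (\<lambda>s. at_arc r s \<and> ?X s) (colour_prog b Q E C 18 20)
      (\<lambda>s. at_arc r s \<and> regs s 19 = col (r div m) (regs s 17) \<and> regs s 20 = col (r div m) (regs s 18))"
    by (rule hoare_mono[OF hoare_colour[where X = ?X and src = 18 and dst = 20 and r = r]])
      (auto simp: at_arc_def)
  show ?thesis
    unfolding main_prog_def seqs.simps
    by (rule hoare_Seq[OF hoare_read hoare_Seq[OF 1 hoare_Seq[OF 2 hoare_Seq[OF hoare_emit S order_refl] order_refl] order_refl]])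
      simp
qed

lemma hoare_header: "hoare w (cost header_prog) (inv_main 0) header_prog
    (core ([N * n + N * n, length (pend 0 @ copies 0)] @ flat (pend 0 @ copies 0)))"
proof (rule hoare_wpI[OF w_pos _ order_refl])
  fix s assume "inv_main 0 s"
  let ?f = "pend 0 @ copies 0"
  have c: "core ([0, 0] @ flat ?f) s" and s: "regs s 12 = off + 6 + 6 * length ?f"
    using \<open>inv_main 0 s\<close> by (auto simp: inv_main_def writing_def)
  have "((put \<mu> off ([0, 0] @ flat ?f))(off := x))(off + 3 := y) = put \<mu> off ([x, y] @ flat ?f)" for x y
    using put_update[of 0 "[0, 0] @ flat ?f" off off \<mu> x] put_update[of 1 "[x, 0] @ flat ?f" "off + 3" off \<mu> y]
    by simp
  moreover have "(off + 6 + 6 * length ?f - off - 6) div 6 = length ?f" by simp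
  ultimately show "wp w header_prog (core ([N * n + N * n, length ?f] @ flat ?f)) s"
    using small(1) small(4)[of "N * n"] const_less by (simp add: header_prog_def core_def s coreD[OF c])
qed

lemma hoare_build:
  "hoare w (build_const R k b Q E C * (1 + N * n + N * m)) ready (build_prog R k b Q E C)
    (core ([N * n + N * n, length (pend 0 @ copies 0)] @ flat (pend 0 @ copies 0)))"
proof -
  have l: "hoare w 1 (inv_pend 0) (BinOp 14 Mul 10 6) (inv_main (N * m))"
  proof (rule hoare_wpI[OF w_pos])
    fix s assume "inv_pend 0 s"
    then have c: "core ([0, 0] @ flat (pend 0)) s" and s: "regs s 12 = off + 6 + 6 * length (pend 0)"
      by (auto simp: inv_pend_def writing_def)
    show "wp w (BinOp 14 Mul 10 6) (inv_main (N * m)) s"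
      using small by (simp add: inv_main_def writing_def core_def s coreD[OF c])
  qed simp
  have p: "hoare w (N * n * (cost pendant_prog + 2) + 1) (inv_pend (N * n)) (WhileNonzero 14 pendant_prog) (inv_pend 0)"
    by (rule hoare_While[where Inv = inv_pend, OF hoare_pendant]) (auto simp: inv_pend_def)
  have q: "hoare w (N * m * (cost (main_prog k b Q E C) + 2) + 1) (inv_main (N * m))
      (WhileNonzero 14 (main_prog k b Q E C)) (inv_main 0)"
    by (rule hoare_While[where Inv = inv_main, OF hoare_main]) (auto simp: inv_main_def)
  show ?thesis
    unfolding build_prog_def
    by (rule hoare_mono[OF hoare_Seq[OF hoare_copies hoare_Seq[OF p hoare_Seq[OF l hoare_Seq[OF q
        hoare_header order_refl] order_refl] order_refl] order_refl]])
      (auto simp: build_const_def algebra_simps)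
qed

end

section \<open>One round and the majority of three\<close>

lemma prob_bind_pmf:
  "measure_pmf.prob (bind_pmf D F) A = (\<integral>x. measure_pmf.prob (F x) A \<partial>D)"
  using measurable_measure_pmf[of F] unfolding measure_pmf_bind
  by (subst measure_pmf.measure_bind[where N = "count_space UNIV"]) auto

lemma integrable_prob: "integrable (measure_pmf D) (\<lambda>x. measure_pmf.prob (F x) A)"
  by (rule measure_pmf.integrable_const_bound[where B = 1]) auto

text \<open>Total probability when only a lower bound \<open>p\<close> for \<open>X\<close> is
  known: since \<open>q' \<le> q\<close>, a greater probability of \<open>X\<close> can only
  help.\<close>

lemma prob_bind_ge:
  fixes D :: "'a pmf"
  assumes "p \<le> measure_pmf.prob D X" "0 \<le> q'" "q' \<le> q"
    and "\<And>x. x \<in> set_pmf D \<Longrightarrow> x \<in> X \<Longrightarrow> q \<le> measure_pmf.prob (F x) Y"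
    and "\<And>x. x \<in> set_pmf D \<Longrightarrow> q' \<le> measure_pmf.prob (F x) Y"
  shows "p * q + (1 - p) * q' \<le> measure_pmf.prob (bind_pmf D F) Y"
proof -
  have "p * q + (1 - p) * q' = q' + (q - q') * p" by (simp add: algebra_simps)
  also have "\<dots> \<le> q' + (q - q') * measure_pmf.prob D X"
    using assms by (intro add_left_mono mult_left_mono) auto
  also have "\<dots> = (\<integral>x. q' + (q - q') * indicator X x \<partial>D)"
    by (subst Bochner_Integration.integral_add) (auto intro!: measure_pmf.integrable_const_bound[where B = 1])
  also have "\<dots> \<le> (\<integral>x. measure_pmf.prob (F x) Y \<partial>D)"
  proof (intro integral_mono_AE integrable_prob)
    show "AE x in D. q' + (q - q') * indicator X x \<le> measure_pmf.prob (F x) Y"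
      using assms(4,5) by (auto simp: AE_measure_pmf_iff indicator_def)
    show "integrable D (\<lambda>x. q' + (q - q') * indicator X x)"
      using assms(2,3) by (intro measure_pmf.integrable_const_bound[where B = q]) (auto simp: indicator_def)
  qed
  also have "\<dots> = measure_pmf.prob (bind_pmf D F) Y" by (rule prob_bind_pmf[symmetric])
  finally show ?thesis .
qed

text \<open>The probabilistic companion of \<open>hoare\<close>. Termination is left to
  \<open>hoare\<close>, so composition rules need both triples.\<close>

definition likely :: "nat \<Rightarrow> nat \<Rightarrow> real \<Rightarrow> (state \<Rightarrow> bool) \<Rightarrow> prog \<Rightarrow> (state \<Rightarrow> bool) \<Rightarrow> bool" where
  "likely w t p A P B \<longleftrightarrow>
     (\<forall>s. fits w s \<longrightarrow> A s \<longrightarrow> p \<le> measure_pmf.prob (result t P s) {s'. B s'})"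

lemma hoare_likely: "hoare w t A P B \<Longrightarrow> p \<le> 1 \<Longrightarrow> likely w t p A P B"
  unfolding likely_def hoare_def
proof (intro allI impI)
  fix s assume *: "p \<le> 1" "\<forall>s. fits w s \<longrightarrow> A s \<longrightarrow> good w t P s \<and> (\<forall>s'\<in>set_pmf (result t P s). B s')"
    "fits w s" "A s"
  then have "measure_pmf.prob (result t P s) {s'. B s'} = 1"
    by (intro measure_pmf.prob_eq_1[THEN iffD2]) (auto simp: AE_measure_pmf_iff)
  then show "p \<le> measure_pmf.prob (result t P s) {s'. B s'}" using * by simp
qed

lemma likely_mono:
  assumes "likely w t p A P B" "hoare w t A P C" "\<And>s. A' s \<Longrightarrow> A s" "\<And>s. B s \<Longrightarrow> B' s" "t \<le> t'" "p' \<le> p"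
  shows "likely w t' p' A' P B'"
  unfolding likely_def
proof (intro allI impI)
  fix s assume s: "fits w s" "A' s"
  then have "good w t P s" using assms(2,3) by (auto simp: hoare_def)
  then have "result t' P s = result t P s" using assms(5) by (rule good_mono)
  moreover have "measure_pmf.prob (result t P s) {s'. B s'} \<le> measure_pmf.prob (result t P s) {s'. B' s'}"
    using assms(4) by (intro measure_pmf.finite_measure_mono) auto
  ultimately show "p' \<le> measure_pmf.prob (result t' P s) {s'. B' s'}"
    using assms(1,3,6) s unfolding likely_def by fastforce
qed

text \<open>\<open>D\<close> holds surely after \<open>P\<close>, and \<open>B\<close> with
  probability at least \<open>p\<close>. Where \<open>B\<close> fails, \<open>Q\<close> may still
  succeed with probability \<open>q'\<close>, as a vote does after one wrong answer.\<close>

lemma likely_Seq: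
  assumes P: "hoare w t A P D" and B: "likely w t p A P B"
    and Q: "hoare w u D Q D'" and q: "likely w u q (\<lambda>s. D s \<and> B s) Q C" and q': "likely w u q' D Q C"
    and "0 \<le> q'" "q' \<le> q" "t + u + 1 \<le> v"
  shows "likely w v (p * q + (1 - p) * q') A (Seq P Q) C"
proof -
  have "likely w (t + u + 1) (p * q + (1 - p) * q') A (Seq P Q) C"
    unfolding likely_def
  proof (intro allI impI)
    fix s assume s: "fits w s" "A s"
    have g: "good w t P s" and D: "\<And>s'. s' \<in> set_pmf (result t P s) \<Longrightarrow> D s' \<and> fits w s'"
      using P s good_result_fits by (auto simp: hoare_def)
    have r: "result (t + u + 1) (Seq P Q) s = bind_pmf (result t P s) (result u Q)"
      by (rule good_Seq(2)[OF g]) (use Q D in \<open>auto simp: hoare_def\<close>)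
    show "p * q + (1 - p) * q' \<le> measure_pmf.prob (result (t + u + 1) (Seq P Q) s) {s'. C s'}"
      unfolding r
    proof (rule prob_bind_ge)
      show "p \<le> measure_pmf.prob (result t P s) {s'. B s'}" using B s by (auto simp: likely_def)
      show "q \<le> measure_pmf.prob (result u Q x) {s'. C s'}"
        if "x \<in> set_pmf (result t P s)" "x \<in> {s'. B s'}" for x
        using q D[OF that(1)] that(2) by (auto simp: likely_def)
      show "q' \<le> measure_pmf.prob (result u Q x) {s'. C s'}"
        if "x \<in> set_pmf (result t P s)" for x
        using q' D[OF that(1)] by (auto simp: likely_def)
    qed (use assms in auto)
  qed
  from likely_mono[OF this hoare_Seq[OF P Q order_refl]] show ?thesis using assms(8) by simp
qed

lemma likely_zero: "likely w t 0 A P B"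
  by (simp add: likely_def)

section \<open>The base of the digit expansion\<close>

text \<open>The number of iterations of the loop which finds the least base \<open>B = 2 ^ i\<close> with \<open>2 * m < B ^ E\<close>.\<close>

function halvings :: "nat \<Rightarrow> nat \<Rightarrow> nat" where
  "halvings E x = (if x = 0 \<or> E = 0 then 0 else Suc (halvings E (x div 2 ^ E)))"
  by auto
termination
proof (relation "Wellfounded.measure snd")
  fix E x :: nat assume "\<not> (x = 0 \<or> E = 0)"
  moreover from this have "1 < (2::nat) ^ E" by (intro one_less_power) auto
  ultimately show "((E, x div 2 ^ E), (E, x)) \<in> Wellfounded.measure snd" by (simp add: div_less_dividend)
qed auto

declare halvings.simps [simp del]

lemma halvings_upper: "0 < E \<Longrightarrow> x < 2 ^ (E * halvings E x)"
proof (induction E x rule: halvings.induct)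
  case (1 E x)
  show ?case
  proof (cases "x = 0")
    case False
    then have "x div 2 ^ E < 2 ^ (E * halvings E (x div 2 ^ E))" using 1 by simp
    then have "x < 2 ^ (E * halvings E (x div 2 ^ E)) * 2 ^ E" by (simp add: div_less_iff_less_mult)
    then show ?thesis using False 1(2) by (subst halvings.simps) (simp add: power_add mult.commute)
  qed (simp add: halvings.simps)
qed

text \<open>The last iteration starts from a positive number, so the base exceeds the
  \<open>E\<close>-th root of \<open>x\<close> by at most a factor of 2.\<close>

lemma halvings_lower: "0 < E \<Longrightarrow> 0 < x \<Longrightarrow> 2 ^ (E * halvings E x) \<le> x * 2 ^ E"
proof (induction E x rule: halvings.induct)
  case (1 E x)
  have h: "halvings E x = Suc (halvings E (x div 2 ^ E))" using 1(2,3) by (subst halvings.simps) simp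
  show ?case
  proof (cases "x div 2 ^ E = 0")
    case True
    moreover have "halvings E 0 = 0" by (subst halvings.simps) simp
    ultimately have "halvings E x = 1" using h by simp
    then show ?thesis using 1 by simp
  next
    case False
    then have "2 ^ (E * halvings E (x div 2 ^ E)) \<le> x div 2 ^ E * 2 ^ E" using 1 by simp
    also have "\<dots> \<le> x" by simp
    finally show ?thesis unfolding h by (simp add: power_add)
  qed
qed

definition base_of :: "nat \<Rightarrow> nat \<Rightarrow> nat" where
  "base_of E m = 2 ^ halvings E (2 * m)"

lemma base_of_pos [simp]: "0 < base_of E m"
  by (simp add: base_of_def)

lemma less_base_of_power: "0 < E \<Longrightarrow> 2 * m < base_of E m ^ E"
  using halvings_upper[of E "2 * m"] by (simp add: base_of_def mult.commute flip: power_mult)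

lemma base_of_power_le: "0 < E \<Longrightarrow> 0 < m \<Longrightarrow> base_of E m ^ E \<le> 2 * m * 2 ^ E"
  using halvings_lower[of E "2 * m"] by (simp add: base_of_def mult.commute flip: power_mult)

lemma halvings_le_base_of: "halvings E (2 * m) \<le> base_of E m"
  unfolding base_of_def using less_exp less_imp_le by blast

definition choose_prog :: "model \<Rightarrow> prog" where
  "choose_prog R = (if R = Randomized then Rand 9 8 else SetConst 9 0)"

definition finish_prog :: "nat \<Rightarrow> nat \<Rightarrow> prog" where
  "finish_prog k j = seqs [SetConst 24 (2 * k), BinOp 25 Less (sim_reg j 0) 24,
     IfNonzero (sim_reg j 0) (BinOp 1 Add 1 25) Skip]"

definition prep_prog :: "nat \<Rightarrow> nat \<Rightarrow> nat \<Rightarrow> prog" where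
  "prep_prog Q E j = Seq (setup_prog E j) (Seq base_prog (modulus_prog Q))"

definition round_prog :: "model \<Rightarrow> nat \<Rightarrow> nat \<Rightarrow> nat \<Rightarrow> nat \<Rightarrow> nat \<Rightarrow> prog \<Rightarrow> nat \<Rightarrow> prog" where
  "round_prog R k b Q E C P j = Seq (prep_prog Q E j) (Seq (choose_prog R)
     (Seq (build_prog R k b Q E C) (Seq (sim j P) (finish_prog k j))))"

text \<open>
  There is a copy for each of the \<open>C\<close> colourings of the hash values and, unless the multiplier is
  drawn at random, for each multiplier.
\<close>

definition copies_count :: "model \<Rightarrow> nat \<Rightarrow> nat \<Rightarrow> nat \<Rightarrow> nat" where
  "copies_count R Q B C = (if R = Randomized then C else C * (Q * B))"

text \<open>\<open>solver\<close> covers every input of at most the size that \<open>H\<close> can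
  have, with common bounds \<open>t\<close> and \<open>v\<close> on time and word size.
  \<open>C\<close> is the number of tables assigning \<open>b\<close>-bit colours to the
  \<open>Q ^ E\<close> hash values.\<close>

locale rounds =
  fixes G :: "nat pair_pre_digraph" and es :: "(nat \<times> nat) list" and R :: model and P :: prog and c :: real
    and n m k b Q E C B N w v t :: nat
  assumes input: "graph_input G es" and n: "n = card (pverts G)" and m: "m = length es" and k: "2 \<le> k"
    and E: "0 < E" and Q: "Q = 80 * k\<^sup>2" and b: "k \<le> 2 ^ b" and C: "C = 2 ^ (b * Q ^ E)" and c: "c < 2"
    and B: "B = base_of E m" and N: "N = copies_count R Q B C"
    and solver: "\<And>H fs. graph_input H fs \<Longrightarrow> length fs \<le> N * n + N * m \<Longrightarrow>
      good v t P (init_state H fs) \<and>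
      2 / 3 \<le> measure_pmf.prob (result t P (init_state H fs))
        {s. girth_approximation c H (if regs s 0 = 0 then \<infinity> else enat (regs s 0))}"
    and const_less: "2 * k < 2 ^ w" "C < 2 ^ w" "Q < 2 ^ w" "b < 2 ^ w" "2 ^ b < (2::nat) ^ w" "E < 2 ^ w"
      "6 < (2::nat) ^ w"
    and bounds: "2 * m + 10 + 6 * (N * n + N * m) < 2 ^ w" "N < 2 ^ w" "Q * B * B < 2 ^ w"
      "Q ^ E \<le> 2 ^ w" "b * Q ^ E < 2 ^ w" "3 * 2 ^ v + (2 * m + 4) \<le> 2 ^ w"
begin

lemma Qpos: "0 < Q" and Bpos: "0 < B" and w_pos: "0 < w"
  using Q k const_less(7) by (auto simp: B intro!: gr0I)

text \<open>The state before round \<open>j\<close>: the input is intact, the windows and register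
  files of the rounds still to come are zero, and \<open>cnt\<close> answers were affirmative. The
  used windows may contain anything.\<close>

definition avail :: "nat \<Rightarrow> nat \<Rightarrow> state \<Rightarrow> bool" where
  "avail j cnt s \<longleftrightarrow> mem s 0 = n \<and> mem s 1 = m \<and>
     (\<forall>e<m. mem s (2 + 2 * e) = fst (es ! e) \<and> mem s (3 + 2 * e) = snd (es ! e)) \<and>
     (\<forall>j'\<in>{j..<3}. \<forall>q. mem s (2 * m + 2 + j' + 3 * q) = 0 \<and> regs s (40 + 3 * q + j') = 0) \<and>
     regs s 1 = cnt"

definition hash_col :: "nat \<Rightarrow> nat \<Rightarrow> nat \<Rightarrow> nat" where
  "hash_col A I x = colour b (I mod C) (hash Q B (A + I div C) E 0 x)"

definition multiplier :: "nat \<Rightarrow> bool" where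
  "multiplier A \<longleftrightarrow> (if R = Randomized then A < Q * B else A = 0)"

lemma multiplier_less: "multiplier A \<Longrightarrow> I < N \<Longrightarrow> A + I div C < Q * B"
  by (auto simp: multiplier_def N copies_count_def less_mult_imp_div_less mult.commute split: if_splits)

definition prepared :: "nat \<Rightarrow> nat \<Rightarrow> (nat \<Rightarrow> nat) \<Rightarrow> (nat \<Rightarrow> nat) \<Rightarrow> state \<Rightarrow> bool" where
  "prepared j cnt \<mu> R0 s \<longleftrightarrow> mem s = \<mu> \<and> (\<forall>r\<ge>40. regs s r = R0 r) \<and>
     regs s 1 = cnt \<and> regs s 2 = 0 \<and> regs s 3 = 2 * m + 2 + j \<and> regs s 4 = 3 \<and> regs s 5 = n \<and> regs s 6 = m \<and>
     regs s 11 = 1"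

definition base_inv :: "nat \<Rightarrow> nat \<Rightarrow> (nat \<Rightarrow> nat) \<Rightarrow> (nat \<Rightarrow> nat) \<Rightarrow> nat \<Rightarrow> state \<Rightarrow> bool" where
  "base_inv j cnt \<mu> R0 r s \<longleftrightarrow> prepared j cnt \<mu> R0 s \<and> regs s 7 * 2 ^ r = B \<and>
     halvings E (regs s 16) = r \<and> regs s 24 = E"

definition choosable :: "nat \<Rightarrow> nat \<Rightarrow> (nat \<Rightarrow> nat) \<Rightarrow> (nat \<Rightarrow> nat) \<Rightarrow> state \<Rightarrow> bool" where
  "choosable j cnt \<mu> R0 s \<longleftrightarrow> prepared j cnt \<mu> R0 s \<and> regs s 7 = B \<and> regs s 8 = Q * B"

lemma QB_less: "B < 2 ^ w" "Q * B < 2 ^ w"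
proof -
  have "B \<le> Q * B" "Q * B \<le> Q * B * B" using Qpos Bpos by simp_all
  then show "B < 2 ^ w" "Q * B < 2 ^ w" using bounds(3) le_less_trans by blast+
qed

lemma hoare_prep:
  assumes "j < 3"
  shows "hoare w (cost (setup_prog E j) + 5 * B + 10) (\<lambda>s. s = s0 \<and> avail j cnt s0) (prep_prog Q E j)
     (choosable j cnt (mem s0) (regs s0))"
proof -
  let ?r = "halvings E (2 * m)" and ?I = "base_inv j cnt (mem s0) (regs s0)"
  have 1: "hoare w (cost (setup_prog E j)) (\<lambda>s. s = s0 \<and> avail j cnt s0) (setup_prog E j) (?I ?r)"
  proof (rule hoare_wpI[OF w_pos _ order_refl])
    fix s assume "s = s0 \<and> avail j cnt s0"
    then have s: "s = s0" "mem s0 0 = n" "mem s0 1 = m" "mem s0 (Suc 0) = m" "regs s0 1 = cnt" "regs s0 (Suc 0) = cnt"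
      by (auto simp: avail_def)
    have "2 * m + 2 + j < 2 ^ w" using bounds(1) assms by linarith
    then have b': "m + m + 2 + j < 2 ^ w" "m + m < 2 ^ w" "2 + j < 2 ^ w" "m + m + (2 + j) < 2 ^ w" by linarith+
    have c': "3 < (2::nat) ^ w" "1 < (2::nat) ^ w" using const_less(7) by linarith+
    have "2 ^ halvings E (m + m) = B" by (simp add: B base_of_def mult_2)
    then show "wp w (setup_prog E j) (?I ?r) s"
      using b' c' const_less(6)
      by (simp add: setup_prog_def base_inv_def prepared_def s mult_2)
  qed
  have h: "hoare w (?r * (3 + 2) + 1) (?I ?r) base_prog (?I 0)"
    unfolding base_prog_def
  proof (rule hoare_While[where Inv = ?I])
    fix r
    show "hoare w 3 (?I (Suc r)) (Seq (BinOp 16 ShiftR 16 24) (BinOp 7 Add 7 7)) (?I r)"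
    proof (rule hoare_wpI[OF w_pos])
      fix s assume s: "?I (Suc r) s"
      then have "regs s 7 * 2 * 2 ^ r = B" by (simp add: base_inv_def)
      moreover have "regs s 7 * 2 * 1 \<le> regs s 7 * 2 * 2 ^ r" by (rule mult_le_mono2) simp
      ultimately have "regs s 7 * 2 < 2 ^ w" using QB_less by linarith
      moreover have "halvings E (regs s 16 div 2 ^ E) = r"
        using s halvings.simps[of E "regs s 16"] by (auto simp: base_inv_def split: if_splits)
      ultimately show "wp w (Seq (BinOp 16 ShiftR 16 24) (BinOp 7 Add 7 7)) (?I r) s"
        using s by (auto simp: base_inv_def prepared_def drop_bit_eq_div)
    qed simp
    show "(regs s 16 \<noteq> 0) = (0 < r)" if "?I r s" for s
      using that halvings.simps[of E "regs s 16"] E by (auto simp: base_inv_def split: if_splits)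
  qed simp
  have "?r \<le> B" using halvings_le_base_of B by simp
  then have 2: "hoare w (B * 5 + 1) (?I ?r) base_prog (?I 0)"
    by (intro hoare_mono[OF h]) auto
  have 3: "hoare w 3 (?I 0) (modulus_prog Q) (choosable j cnt (mem s0) (regs s0))"
    by (rule hoare_wpI[OF w_pos])
      (use const_less QB_less in \<open>auto simp: modulus_prog_def base_inv_def choosable_def prepared_def\<close>)
  show ?thesis
    unfolding prep_prog_def by (rule hoare_Seq[OF 1 hoare_Seq[OF 2 3 order_refl]]) simp
qed

lemma kept_construction:
  assumes "multiplier A" "j < 3" "avail j cnt s0"
  shows "construction G es n k N (hash_col A) b Q E j B A C w m (2 * m + 2 + j) (mem s0) R"
proof
  show "graph_input G es" "n = card (pverts G)" "2 \<le> k" "m = length es" "0 < Q" "0 < B"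
    by (fact input n k m Qpos Bpos)+
  show "mem s0 (2 + 2 * e) = fst (es ! e) \<and> mem s0 (3 + 2 * e) = snd (es ! e)" if "e < m" for e
    using that assms(3) by (simp add: avail_def)
  show "mem s0 (2 * m + 2 + j + 3 * q) = 0" for q
    using assms(2,3) by (simp add: avail_def)
  show "A + I div C < Q * B" if "I < N" for I using multiplier_less[OF assms(1) that] .
  show "2 * m + 2 + j + 6 + 6 * (N * n + N * m) < 2 ^ w" using bounds(1) assms(2) by linarith
qed (use const_less bounds in \<open>auto simp: hash_col_def N copies_count_def fun_eq_iff\<close>)

definition cyc :: nat where
  "cyc = (if has_k_cycle k G then 1 else 0)"

definition round_time :: "nat \<Rightarrow> nat" where
  "round_time j = build_const R k b Q E C * (1 + N * n + N * m) + 7 * t + cost (finish_prog k j)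
     + cost (setup_prog E j) + 5 * B + 20"

text \<open>Some copy colours some \<open>k\<close>-cycle by its positions. If there is no such
  cycle, every multiplier is good, as it cannot cause a wrong answer.\<close>

definition good_mult :: "nat \<Rightarrow> bool" where
  "good_mult A \<longleftrightarrow> has_k_cycle k G \<longrightarrow> (\<exists>f I. cyclic_seq (parcs G) k f \<and> I < N \<and> (\<forall>i<k. hash_col A I (f i) = i))"

text \<open>\<open>Y\<close> is what is known of the answer: nothing for the bound on the counter
  that always holds, and being a valid approximation for the bound in probability.\<close>

lemma hoare_finish:
  assumes "j < 3" "cnt \<le> 3" and X: "\<And>s. X s \<Longrightarrow> avail (Suc j) cnt s \<and> Y (regs s (sim_reg j 0))"
  shows "hoare w (cost (finish_prog k j)) X (finish_prog k j)
    (\<lambda>s. \<exists>x. Y x \<and> avail (Suc j) (cnt + (if 0 < x \<and> x < 2 * k then 1 else 0)) s)"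
proof (rule hoare_wpI[OF w_pos _ order_refl])
  fix s assume "X s"
  then have a: "avail (Suc j) cnt s" and y: "Y (regs s (sim_reg j 0))" using X by auto
  have r: "sim_reg j 0 = 40 + j" by (simp add: sim_reg_def)
  have c1: "regs s 1 = cnt" "regs s (Suc 0) = cnt" using a by (simp_all add: avail_def)
  have A: "avail (Suc j) cnt' s'"
    if "mem s' = mem s" "\<And>r. 40 \<le> r \<Longrightarrow> regs s' r = regs s r" "regs s' 1 = cnt'" for s' cnt'
    using a that by (simp add: avail_def)
  have w: "Suc cnt < 2 ^ w" "2 * k < 2 ^ w" using assms(2) const_less by linarith+
  let ?x = "regs s (sim_reg j 0)"
  show "wp w (finish_prog k j)
      (\<lambda>s. \<exists>x. Y x \<and> avail (Suc j) (cnt + (if 0 < x \<and> x < 2 * k then 1 else 0)) s) s"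
    using w y c1 unfolding r
    apply (simp add: finish_prog_def r c1)
    apply (intro conjI impI exI[of _ "regs s (40 + j)"]; (rule A)?)
    apply (auto simp: c1)
    done
qed

text \<open>Whatever state \<sigma> the simulated program ends in, the embedding changes only cells
  and registers of residue class \<open>j\<close>, so the input and the later windows
  survive.\<close>

lemma build_avail:
  assumes "multiplier A" "j < 3" "avail j cnt s0"
    and core: "construction.core n N Q B A m (2 * m + 2 + j) cnt (regs s0) (mem s0) xs s"
  shows "\<And>\<sigma>. avail (Suc j) cnt (emb j (2 * m + 2 + j) s \<sigma>)"
proof -
  interpret construction G es n k N "hash_col A" b Q E j B A C w m "2 * m + 2 + j" cnt "regs s0" "mem s0" R
    by (rule kept_construction) fact+
  fix \<sigma>
  let ?off = "2 * m + 2 + j"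
  note c = coreD[OF core]
  have low: "mem (emb j ?off s \<sigma>) a = mem s0 a" if "a < ?off" for a
    using that by (auto simp: emb_def c(1) put_below)
  have other: "2 * m + 2 + j' + 3 * q \<noteq> ?off + 3 * q'" "40 + 3 * q + j' \<noteq> sim_reg j q'"
    if "j < j'" "j' < 3" for j' q q'
    using that by (unfold sim_reg_def, presburger+)
  have "mem (emb j ?off s \<sigma>) (2 * m + 2 + j' + 3 * q) = 0 \<and> regs (emb j ?off s \<sigma>) (40 + 3 * q + j') = 0"
    if "j' \<in> {Suc j..<3}" for j' q
    using that other[of j' q] assms(3) by (simp add: emb_def c put_def avail_def)
  moreover have "regs (emb j ?off s \<sigma>) 1 = cnt" by (simp add: emb_def sim_reg_def c)
  ultimately show "avail (Suc j) cnt (emb j ?off s \<sigma>)"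
    using assms(3) low by (simp add: avail_def)
qed

definition chosen :: "nat \<Rightarrow> nat \<Rightarrow> state \<Rightarrow> nat \<Rightarrow> state \<Rightarrow> bool" where
  "chosen j cnt s0 A s \<longleftrightarrow> choosable j cnt (mem s0) (regs s0) s \<and> regs s 9 = A"

definition tail_prog :: "nat \<Rightarrow> prog" where
  "tail_prog j = Seq (build_prog R k b Q E C) (Seq (sim j P) (finish_prog k j))"

lemma tail:
  assumes A: "multiplier A" and j: "j < 3" and av: "avail j cnt s0" and cnt: "cnt \<le> 3"
  shows "hoare w (build_const R k b Q E C * (1 + N * n + N * m) + (7 * t + cost (finish_prog k j) + 1) + 1)
      (chosen j cnt s0 A) (tail_prog j) (\<lambda>s. avail (Suc j) cnt s \<or> avail (Suc j) (Suc cnt) s)" (is ?hoare)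
    and "good_mult A \<Longrightarrow>
      likely w (build_const R k b Q E C * (1 + N * n + N * m) + (7 * t + cost (finish_prog k j) + 1) + 1) (2 / 3)
      (chosen j cnt s0 A) (tail_prog j) (avail (Suc j) (cnt + cyc))" (is "_ \<Longrightarrow> ?likely")
proof -
  interpret construction G es n k N "hash_col A" b Q E j B A C w m "2 * m + 2 + j" cnt "regs s0" "mem s0" R
    by (rule kept_construction) fact+
  let ?off = "2 * m + 2 + j"
  let ?fs = "pend 0 @ copies 0"
  let ?xs = "[N * n + N * n, length ?fs] @ flat ?fs"
  let ?ok = "\<lambda>x. girth_approximation c H (if x = 0 then \<infinity> else enat x)"
  have "length ?fs \<le> N * n + N * m" using length_copies[of 0] by (simp add: length_pend)
  note S = solver[OF graph_input_arcs this]
  let ?init = "init_state H ?fs"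
  have init: "?init = \<lparr>regs = (\<lambda>_. 0), mem = (\<lambda>a. if a < length ?xs then ?xs ! a else 0)\<rparr>"
  proof -
    have "card (pverts H) # length ?fs # flat ?fs = ?xs" by (simp add: H_def mult_2)
    then show ?thesis unfolding init_state_def Let_def flat_def[symmetric] by (simp only:)
  qed
  have sim: "good w (7 * t) (sim j P) s \<and> result (7 * t) (sim j P) s = map_pmf (emb j ?off s) (result t P ?init)
      \<and> simulation j ?off s v w"
    if s: "fits w s" "core ?xs s" for s
  proof -
    interpret S: simulation j ?off s v w
      using s rounds.bounds(6)[OF rounds_axioms] j by unfold_locales (auto simp: coreD[OF s(2)])
    have "regs s (sim_reg j q) = 0" for q
      using av j coreD(2)[OF s(2), of "sim_reg j q"] by (auto simp: avail_def sim_reg_def add.assoc add.commute)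
    moreover have "mem s (?off + 3 * q) = (if q < length ?xs then ?xs ! q else 0)" for q
      unfolding coreD(1)[OF s(2)] using window[of q] by (simp add: put_def del: append.simps)
    \<comment> \<open>The list in the window and the zero registers are exactly the initial state of
      \<open>P\<close> on \<open>H\<close>, so \<open>s\<close> already has the form that the
      simulation theorem starts from.\<close>
    ultimately have "emb j ?off s ?init = s"
      unfolding init emb_def by (intro state.equality) (auto simp: fun_eq_iff del: append.simps)
    then show ?thesis using S.sim_good[OF S[THEN conjunct1]] S.simulation_axioms by simp
  qed
  have av': "avail (Suc j) cnt (emb j ?off s \<sigma>)" if "core ?xs s" for s \<sigma>
    by (rule build_avail[OF A j av that])
  have h1: "hoare w (7 * t) (core ?xs) (sim j P) (avail (Suc j) cnt)"
    unfolding hoare_def using sim av' by auto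
  have l1: "likely w (7 * t) (2 / 3) (core ?xs) (sim j P) (\<lambda>s. avail (Suc j) cnt s \<and> ?ok (regs s (sim_reg j 0)))"
    unfolding likely_def
  proof (intro allI impI)
    fix s assume s: "fits w s" "core ?xs s"
    interpret S: simulation j ?off s v w using sim[OF s] by blast
    have "2 / 3 \<le> measure_pmf.prob (result t P ?init) {s. ?ok (regs s 0)}" using S by blast
    also have "\<dots> \<le> measure_pmf.prob (result (7 * t) (sim j P) s) {s. avail (Suc j) cnt s \<and> ?ok (regs s (sim_reg j 0))}"
      unfolding sim[OF s, THEN conjunct2, THEN conjunct1] measure_map_pmf
    proof (rule measure_pmf.finite_measure_mono)
      show "{s. ?ok (regs s 0)} \<subseteq>
          emb j ?off s -` {s. avail (Suc j) cnt s \<and> ?ok (regs s (sim_reg j 0))}"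
        unfolding vimage_def using av'[OF s(2)] by (simp only: mem_Collect_eq S.regs_E subset_iff simp_thms)
    qed simp
    finally show "2 / 3 \<le> measure_pmf.prob (result (7 * t) (sim j P) s)
        {s. avail (Suc j) cnt s \<and> ?ok (regs s (sim_reg j 0))}" .
  qed
  have h2: "hoare w (cost (finish_prog k j)) (avail (Suc j) cnt) (finish_prog k j)
      (\<lambda>s. avail (Suc j) cnt s \<or> avail (Suc j) (Suc cnt) s)"
    by (rule hoare_mono[OF hoare_finish[OF j cnt, where X = "avail (Suc j) cnt" and Y = "\<lambda>_. True"]]) (auto split: if_splits)
  have h3: "hoare w (7 * t + cost (finish_prog k j) + 1) (core ?xs) (Seq (sim j P) (finish_prog k j))
      (\<lambda>s. avail (Suc j) cnt s \<or> avail (Suc j) (Suc cnt) s)"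
    by (rule hoare_Seq[OF h1 h2 order_refl])
  have rd: "ready s" if "chosen j cnt s0 A s" for s
    using that unfolding chosen_def choosable_def prepared_def ready_def by blast
  have h0: "hoare w (build_const R k b Q E C * (1 + N * n + N * m)) (chosen j cnt s0 A) (build_prog R k b Q E C) (core ?xs)"
    by (rule hoare_mono[OF hoare_build rd _ order_refl])
  show ?hoare unfolding tail_prog_def by (rule hoare_Seq[OF h0 h3 order_refl])
  assume gm: "good_mult A"
  have ans: "(0 < x \<and> x < 2 * k) \<longleftrightarrow> has_k_cycle k G" if "?ok x" for x
  proof (cases "has_k_cycle k G")
    case True
    then obtain f I where f: "cyclic_seq (parcs G) k f" "I < N" "\<And>i. i < k \<Longrightarrow> hash_col A I (f i) = i"
      using gm unfolding good_mult_def by blast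
    then have "has_k_cycle k H" using G_cycle[OF f] has_k_cycle_iff[OF wf_H] by blast
    then show ?thesis using answer_yes[OF _ that c] True by simp
  next
    case False
    then show ?thesis using answer_no[OF _ that] by blast
  qed
  have "hoare w (cost (finish_prog k j)) (\<lambda>s. avail (Suc j) cnt s \<and> ?ok (regs s (sim_reg j 0))) (finish_prog k j)
      (avail (Suc j) (cnt + cyc))"
  proof (rule hoare_mono[OF hoare_finish[OF j cnt,
        where X = "\<lambda>s. avail (Suc j) cnt s \<and> ?ok (regs s (sim_reg j 0))" and Y = ?ok]])
    fix s assume "\<exists>x. ?ok x \<and> avail (Suc j) (cnt + (if 0 < x \<and> x < 2 * k then 1 else 0)) s"
    then obtain x where x: "?ok x" "avail (Suc j) (cnt + (if 0 < x \<and> x < 2 * k then 1 else 0)) s" by blast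
    have "(if 0 < x \<and> x < 2 * k then 1 else 0) = cyc" using ans[OF x(1)] by (simp add: cyc_def)
    then show "avail (Suc j) (cnt + cyc) s" using x(2) by (simp only:)
  qed auto
  from hoare_likely[OF this, of 1]
  have l2: "likely w (cost (finish_prog k j)) 1 (\<lambda>s. avail (Suc j) cnt s \<and> avail (Suc j) cnt s \<and> ?ok (regs s (sim_reg j 0)))
      (finish_prog k j) (avail (Suc j) (cnt + cyc))"
    by (simp add: likely_def)
  have l3: "likely w (7 * t + cost (finish_prog k j) + 1) (2 / 3) (core ?xs) (Seq (sim j P) (finish_prog k j))
      (avail (Suc j) (cnt + cyc))"
    using likely_Seq[OF h1 l1 h2 l2 likely_zero _ _ order_refl] by simp
  show ?likely
    unfolding tail_prog_def
    using likely_Seq[OF h0 hoare_likely[OF h0, of 1] h3 _ likely_zero _ _ order_refl, of "2/3"] l3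
    by (simp add: likely_def)
qed

section \<open>Most multipliers are good\<close>

lemma n_le: "n \<le> 2 * m"
  using card_pverts_le[OF input] n m by simp

lemma hash_works:
  assumes "cyclic_seq (parcs G) k f" "inj_on (hash Q B a E 0) (f ` {..<k})"
  shows "\<exists>x<C. \<forall>i<k. colour b x (hash Q B a E 0 (f i)) = i"
  unfolding C
proof (rule ex_colour[OF b])
  show "inj_on (\<lambda>i. hash Q B a E 0 (f i)) {..<k}"
    using comp_inj_on[OF _ assms(2)] assms(1) by (simp add: cyclic_seq_def comp_def)
  show "hash Q B a E 0 (f i) < Q ^ E" for i
    using hash_less[OF Qpos Bpos, of a E 0 "f i"] by simp
qed

text \<open>This is where 80 comes from: at most 4k^2 B multipliers fail, and
  \<open>Q = 80 * k\<^sup>2\<close> makes that a twentieth of all \<open>Q * B\<close>. Vertex names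
  have \<open>E\<close> digits because n \<le> 2m < B^E.\<close>

lemma card_bad_mult:
  assumes "cyclic_seq (parcs G) k f"
  shows "20 * card {a. a < Q * B \<and> \<not> inj_on (hash Q B a E 0) (f ` {..<k})} \<le> Q * B"
proof -
  interpret pair_digraph G using input by (simp add: graph_input_def)
  have "f i < B ^ E" if "i < k" for i
  proof -
    have "f i \<in> pverts G" using assms that in_arcsD1 by (auto simp: cyclic_seq_def)
    then have "f i < n" using input n by (auto simp: graph_input_def)
    then show ?thesis using n_le less_base_of_power[OF E, of m] B by simp
  qed
  then have "card {a. a < Q * B \<and> \<not> inj_on (hash Q B a E 0) (f ` {..<k})} \<le> (card (f ` {..<k}))\<^sup>2 * (4 * B)"
    by (intro card_hash_not_inj) (use Qpos Bpos in auto)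
  also have "\<dots> \<le> k\<^sup>2 * (4 * B)"
    using card_image_le[of "{..<k}" f] by (intro mult_right_mono power_mono) auto
  finally have "20 * card {a. a < Q * B \<and> \<not> inj_on (hash Q B a E 0) (f ` {..<k})} \<le> 20 * (k\<^sup>2 * (4 * B))"
    by (rule mult_le_mono2)
  also have "\<dots> = Q * B" unfolding Q by simp
  finally show ?thesis .
qed

lemma good_mult_deterministic:
  assumes "R = Deterministic"
  shows "good_mult 0"
  unfolding good_mult_def
proof
  assume "has_k_cycle k G"
  then obtain f where f: "cyclic_seq (parcs G) k f"
    using has_k_cycle_iff[of G k] input
    by (auto simp: graph_input_def pair_digraph_def pair_fin_digraph_def)
  have "0 < Q * B" using Qpos Bpos by simp
  then have "card {a. a < Q * B \<and> \<not> inj_on (hash Q B a E 0) (f ` {..<k})} < card {a. a < Q * B}"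
  proof -
    have "X < Y" if "20 * X \<le> Y" "0 < Y" for X Y :: nat using that by linarith
    from this[OF card_bad_mult[OF f] \<open>0 < Q * B\<close>] show ?thesis by simp
  qed
  then obtain a where a: "a < Q * B" "inj_on (hash Q B a E 0) (f ` {..<k})"
    by (metis (no_types, lifting) mem_Collect_eq nat_neq_iff Collect_cong)
  then obtain x where x: "x < C" "\<And>i. i < k \<Longrightarrow> colour b x (hash Q B a E 0 (f i)) = i"
    using hash_works[OF f] by blast
  \<comment> \<open>The copy numbered \<open>x + C * a\<close> decodes to the colouring
    \<open>x\<close> and the multiplier \<open>a\<close>.\<close>
  have "x + C * a < C * Suc a" using x by simp
  also have "\<dots> \<le> C * (Q * B)" using a by (intro mult_le_mono2) simp
  finally have "x + C * a < N" using assms by (simp add: N copies_count_def)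
  then show "\<exists>f I. cyclic_seq (parcs G) k f \<and> I < N \<and> (\<forall>i<k. hash_col 0 I (f i) = i)"
    using f x by (intro exI[of _ f] exI[of _ "x + C * a"]) (simp add: hash_col_def)
qed

lemma good_mult_randomized:
  assumes "R = Randomized"
  shows "20 * card {A. A < Q * B \<and> \<not> good_mult A} \<le> Q * B"
proof (cases "has_k_cycle k G")
  case True
  then obtain f where f: "cyclic_seq (parcs G) k f"
    using has_k_cycle_iff[of G k] input
    by (auto simp: graph_input_def pair_digraph_def pair_fin_digraph_def)
  have "good_mult A" if inj: "inj_on (hash Q B A E 0) (f ` {..<k})" for A
  proof -
    obtain x where x: "x < C" "\<And>i. i < k \<Longrightarrow> colour b x (hash Q B A E 0 (f i)) = i"
      using hash_works[OF f inj] by blast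
    then show ?thesis using assms f
      unfolding good_mult_def by (intro impI exI[of _ f] exI[of _ x]) (simp add: hash_col_def N copies_count_def)
  qed
  then have "card {A. A < Q * B \<and> \<not> good_mult A} \<le> card {a. a < Q * B \<and> \<not> inj_on (hash Q B a E 0) (f ` {..<k})}"
    by (intro card_mono) auto
  then show ?thesis using card_bad_mult[OF f] by linarith
qed (simp add: good_mult_def)

lemma hoare_choose:
  "hoare w 1 (choosable j cnt (mem s0) (regs s0)) (choose_prog R) (\<lambda>s. \<exists>A. multiplier A \<and> chosen j cnt s0 A s)"
proof (rule hoare_wpI[OF w_pos])
  fix s assume "choosable j cnt (mem s0) (regs s0) s"
  then show "wp w (choose_prog R) (\<lambda>s. \<exists>A. multiplier A \<and> chosen j cnt s0 A s) s"
    using Qpos Bpos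
    by (auto simp: choose_prog_def multiplier_def chosen_def choosable_def prepared_def)
qed (simp add: choose_prog_def)

lemma likely_choose:
  "likely w 1 (19 / 20) (choosable j cnt (mem s0) (regs s0)) (choose_prog R)
    (\<lambda>s. \<exists>A. (multiplier A \<and> good_mult A) \<and> chosen j cnt s0 A s)"
proof (cases R)
  case Deterministic
  have "hoare w 1 (choosable j cnt (mem s0) (regs s0)) (choose_prog R)
      (\<lambda>s. \<exists>A. (multiplier A \<and> good_mult A) \<and> chosen j cnt s0 A s)"
  proof (rule hoare_mono[OF hoare_choose])
    fix s assume "\<exists>A. multiplier A \<and> chosen j cnt s0 A s"
    then obtain A where A: "multiplier A" "chosen j cnt s0 A s" by blast
    then have "A = 0" using Deterministic unfolding multiplier_def by simp
    then show "\<exists>A. (multiplier A \<and> good_mult A) \<and> chosen j cnt s0 A s"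
      using A good_mult_deterministic[OF Deterministic] by blast
  qed auto
  then show ?thesis by (rule hoare_likely) simp
next
  case Randomized
  show ?thesis
    unfolding likely_def
  proof (intro allI impI)
    fix s assume s: "choosable j cnt (mem s0) (regs s0) s"
    have pos: "0 < Q * B" using Qpos Bpos by simp
    let ?D = "pmf_of_set {..<Q * B}"
    let ?bad = "{A. A < Q * B \<and> \<not> good_mult A}"
    have fin: "finite {..<Q * B}" "{..<Q * B} \<noteq> {}" using pos by (simp_all add: lessThan_empty_iff)
    have r: "result 1 (choose_prog R) s = map_pmf (\<lambda>x. set_reg 9 x s) ?D"
      using s pos Randomized
      by (simp add: choose_prog_def result_Suc[of 0, simplified] choosable_def bind_map_pmf map_pmf_def split_def bind_return_pmf bind_assoc_pmf)
    have "measure_pmf.prob ?D ?bad = card ({..<Q * B} \<inter> ?bad) / (Q * B)"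
      using fin by (simp add: measure_pmf_of_set)
    also have "{..<Q * B} \<inter> ?bad = ?bad" by auto
    also have "real (card ?bad) / (Q * B) \<le> 1 / 20"
      using good_mult_randomized[OF Randomized] pos by (simp add: divide_simps flip: of_nat_mult)
    finally have "measure_pmf.prob ?D ?bad \<le> 1 / 20" .
    moreover have "measure_pmf.prob ?D (- ?bad) = 1 - measure_pmf.prob ?D ?bad"
      using measure_pmf.prob_compl[of ?bad ?D] by (simp add: Compl_eq_Diff_UNIV)
    ultimately have "19 / 20 \<le> measure_pmf.prob ?D (- ?bad)" by simp
    also have "\<dots> = measure_pmf.prob ?D (- ?bad \<inter> {..<Q * B})"
      using fin by (intro measure_eq_AE) (auto simp: AE_measure_pmf_iff)
    also have "\<dots> \<le> measure_pmf.prob (result 1 (choose_prog R) s)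
        {s. \<exists>A. (multiplier A \<and> good_mult A) \<and> chosen j cnt s0 A s}"
      unfolding r measure_map_pmf
    proof (rule measure_pmf.finite_measure_mono)
      have "multiplier A" if "A < Q * B" for A using that Randomized unfolding multiplier_def by simp
      moreover have "chosen j cnt s0 A (set_reg 9 A s)" for A
        using s by (auto simp: chosen_def choosable_def prepared_def)
      ultimately show "- ?bad \<inter> {..<Q * B}
          \<subseteq> (\<lambda>x. set_reg 9 x s) -` {s. \<exists>A. (multiplier A \<and> good_mult A) \<and> chosen j cnt s0 A s}"
        by blast
    qed simp
    finally show "19 / 20 \<le> measure_pmf.prob (result 1 (choose_prog R) s)
        {s. \<exists>A. (multiplier A \<and> good_mult A) \<and> chosen j cnt s0 A s}" .
  qed
qed

lemma hoare_ex: "(\<And>A. M A \<Longrightarrow> hoare w u (X A) Z Y) \<Longrightarrow> hoare w u (\<lambda>s. \<exists>A. M A \<and> X A s) Z Y"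
  by (auto simp: hoare_def)

lemma likely_ex: "(\<And>A. M A \<Longrightarrow> likely w u p (X A) Z Y) \<Longrightarrow> likely w u p (\<lambda>s. \<exists>A. M A \<and> X A s) Z Y"
  by (auto simp: likely_def)

text \<open>Assertions within a round mention the memory and the high registers at its start, so the
  round is analysed from a fixed state \<open>s0\<close>, which is generalised here.\<close>

lemma hoare_pointwise: "(\<And>s0. hoare w u (\<lambda>s. s = s0 \<and> X s0) Z Y) \<Longrightarrow> hoare w u X Z Y"
  unfolding hoare_def by simp

lemma likely_pointwise: "(\<And>s0. likely w u p (\<lambda>s. s = s0 \<and> X s0) Z Y) \<Longrightarrow> likely w u p X Z Y"
  unfolding likely_def by simp

lemma likely_disj:
  "likely w u p X Z Y \<Longrightarrow> likely w u p X' Z Y \<Longrightarrow> likely w u p (\<lambda>s. X s \<or> X' s) Z Y"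
  by (auto simp: likely_def)

lemma likely_pre: "likely w u p X Z Y \<Longrightarrow> (\<And>s. X' s \<Longrightarrow> X s) \<Longrightarrow> p' \<le> p \<Longrightarrow> likely w u p' X' Z Y"
  unfolding likely_def by (meson order_trans)

lemma round:
  assumes j: "j < 3" and cnt: "cnt \<le> 3"
  shows "hoare w (round_time j) (avail j cnt) (round_prog R k b Q E C P j)
      (\<lambda>s. avail (Suc j) cnt s \<or> avail (Suc j) (Suc cnt) s)"
    and "likely w (round_time j) (19 / 30) (avail j cnt) (round_prog R k b Q E C P j) (avail (Suc j) (cnt + cyc))"
proof -
  let ?t = "build_const R k b Q E C * (1 + N * n + N * m) + (7 * t + cost (finish_prog k j) + 1) + 1"
  let ?Y = "\<lambda>s. avail (Suc j) cnt s \<or> avail (Suc j) (Suc cnt) s"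
  have *: "hoare w (round_time j) (\<lambda>s. s = s0 \<and> avail j cnt s0) (round_prog R k b Q E C P j) ?Y \<and>
      likely w (round_time j) (19 / 30) (\<lambda>s. s = s0 \<and> avail j cnt s0) (round_prog R k b Q E C P j) (avail (Suc j) (cnt + cyc))"
    (is "?A \<and> ?B") for s0
  proof (cases "avail j cnt s0")
    case True
    let ?M = "\<lambda>s. \<exists>A. multiplier A \<and> chosen j cnt s0 A s"
    let ?M' = "\<lambda>s. \<exists>A. (multiplier A \<and> good_mult A) \<and> chosen j cnt s0 A s"
    have h: "hoare w ?t ?M (tail_prog j) ?Y"
      by (rule hoare_ex) (rule tail(1)[OF _ j True cnt])
    have "likely w ?t (2 / 3) ?M' (tail_prog j) (avail (Suc j) (cnt + cyc))"
      by (rule likely_ex) (use tail(2)[OF _ j True cnt] in blast)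
    then have l: "likely w ?t (2 / 3) (\<lambda>s. ?M s \<and> ?M' s) (tail_prog j) (avail (Suc j) (cnt + cyc))"
      by (simp add: likely_def)
    have h2: "hoare w (?t + 2) (choosable j cnt (mem s0) (regs s0)) (Seq (choose_prog R) (tail_prog j)) ?Y"
      by (rule hoare_Seq[OF hoare_choose h]) simp
    have l2: "likely w (?t + 2) (19 / 30) (choosable j cnt (mem s0) (regs s0)) (Seq (choose_prog R) (tail_prog j))
        (avail (Suc j) (cnt + cyc))"
      using likely_Seq[OF hoare_choose likely_choose h l likely_zero] by simp
    note p = hoare_prep[OF j, of s0 cnt]
    have "?A"
      unfolding round_prog_def tail_prog_def[symmetric]
      by (rule hoare_Seq[OF p h2]) (simp add: round_time_def)
    moreover have "likely w (?t + 2) (19 / 30)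
        (\<lambda>s. choosable j cnt (mem s0) (regs s0) s \<and> choosable j cnt (mem s0) (regs s0) s)
        (Seq (choose_prog R) (tail_prog j)) (avail (Suc j) (cnt + cyc))"
      using l2 by simp
    from likely_Seq[OF p hoare_likely[OF p, of 1] h2 this likely_zero, of "round_time j"]
    have "?B"
      unfolding round_prog_def tail_prog_def[symmetric] by (simp add: round_time_def)
    ultimately show ?thesis ..
  qed (auto simp: hoare_def likely_def)
  show "hoare w (round_time j) (avail j cnt) (round_prog R k b Q E C P j) ?Y"
    by (rule hoare_pointwise) (rule *[THEN conjunct1])
  show "likely w (round_time j) (19 / 30) (avail j cnt) (round_prog R k b Q E C P j) (avail (Suc j) (cnt + cyc))"
    by (rule likely_pointwise) (rule *[THEN conjunct2])
qed

text \<open>Exactly \<open>x\<close> of the first \<open>j\<close> answers were wrong. Counting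
  errors instead of affirmative answers treats graphs with and without a \<open>k\<close>-cycle
  alike.\<close>

definition errors :: "nat \<Rightarrow> nat \<Rightarrow> state \<Rightarrow> bool" where
  "errors j x s \<longleftrightarrow> x \<le> j \<and> avail j (if cyc = 1 then j - x else x) s"

lemma round_errors:
  assumes "j < 3"
  shows "hoare w (round_time j) (errors j x) (round_prog R k b Q E C P j)
      (\<lambda>s. errors (Suc j) x s \<or> errors (Suc j) (Suc x) s)" (is "?A")
    and "likely w (round_time j) (19 / 30) (errors j x) (round_prog R k b Q E C P j) (errors (Suc j) x)" (is "?B")
proof -
  let ?c = "if cyc = 1 then j - x else x"
  have "?A \<and> ?B"
  proof (cases "x \<le> j")
    case True
    then have "?c \<le> 3" using assms by auto
    note r = round[OF assms this]
    have cyc: "cyc = 0 \<or> cyc = 1" by (simp add: cyc_def)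
    have pre: "avail j ?c s" if "errors j x s" for s using that by (simp add: errors_def)
    have post1: "errors (Suc j) x s \<or> errors (Suc j) (Suc x) s"
      if "avail (Suc j) ?c s \<or> avail (Suc j) (Suc ?c) s" for s
      using that True cyc unfolding errors_def by (elim disjE) (simp_all add: Suc_diff_le)
    have post2: "errors (Suc j) x s" if "avail (Suc j) (?c + cyc) s" for s
      using that True cyc unfolding errors_def by (elim disjE) (simp_all add: Suc_diff_le)
    show ?thesis
      by (intro conjI hoare_mono[OF r(1) pre post1 order_refl] likely_mono[OF r(2) r(1) pre post2 order_refl order_refl])
  qed (simp add: hoare_def likely_def errors_def)
  then show ?A and ?B by blast+
qed

end

definition detect_prog :: "model \<Rightarrow> nat \<Rightarrow> nat \<Rightarrow> nat \<Rightarrow> nat \<Rightarrow> nat \<Rightarrow> prog \<Rightarrow> prog" where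
  "detect_prog R k b Q E C P = Seq (round_prog R k b Q E C P 0) (Seq (round_prog R k b Q E C P 1)
     (Seq (round_prog R k b Q E C P 2) (Seq (SetConst 11 1) (BinOp 0 Less 11 1))))"

context rounds
begin

definition detect_time :: nat where
  "detect_time = round_time 0 + round_time 1 + round_time 2 + 6"

lemma
  shows hoare_detect: "hoare w detect_time (errors 0 0) (detect_prog R k b Q E C P) (\<lambda>_. True)"
    and likely_detect: "likely w detect_time (2 / 3) (errors 0 0) (detect_prog R k b Q E C P)
      (\<lambda>s. regs s 0 \<noteq> 0 \<longleftrightarrow> has_k_cycle k G)"
proof -
  let ?Z = "\<lambda>s. regs s 0 \<noteq> 0 \<longleftrightarrow> has_k_cycle k G"
  let ?T = "\<lambda>_ :: state. True"
  define F where "F = Seq (SetConst 11 1) (BinOp 0 Less 11 1)"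
  define S2 where "S2 = Seq (round_prog R k b Q E C P 2) F"
  define S1 where "S1 = Seq (round_prog R k b Q E C P 1) S2"
  define S0 where "S0 = Seq (round_prog R k b Q E C P 0) S1"
  define any where "any j s = (\<exists>x. True \<and> errors j x s)" for j s
  define p :: real where "p = 19 / 30"
  define t2 t1 t0 where "t2 = round_time 2 + 3 + 1" and "t1 = round_time 1 + t2 + 1" and "t0 = round_time 0 + t1 + 1"
  have 0: "detect_prog R k b Q E C P = S0" by (simp add: detect_prog_def S0_def S1_def S2_def F_def)
  have t: "detect_time = t0" by (simp add: detect_time_def t0_def t1_def t2_def)
  have one: "1 < (2::nat) ^ w" using const_less(7) by linarith
  note R = round_errors[folded p_def]
  have suc: "Suc 2 = 3" "Suc 1 = 2" "Suc 0 = 1" by simp_all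
  have "1 < (3::nat)" "2 < (3::nat)" "0 < (3::nat)" by simp_all
  note R0 = R[OF this(3), unfolded suc] and R1 = R[OF this(1), unfolded suc] and R2 = R[OF this(2), unfolded suc]
  have r: "hoare w (round_time j) (any j) (round_prog R k b Q E C P j) (any (Suc j))" if "j < 3" for j
    unfolding any_def
  proof (rule hoare_ex)
    fix x
    show "hoare w (round_time j) (errors j x) (round_prog R k b Q E C P j) (\<lambda>s. \<exists>x. True \<and> errors (Suc j) x s)"
      by (rule hoare_mono[OF R(1)[OF that, of x] _ _ order_refl]) blast+
  qed
  note r0 = r[of 0, unfolded suc] and r1 = r[of 1, unfolded suc] and r2 = r[of 2, unfolded suc]
  have f: "hoare w 3 (any 3) F ?T"
    by (rule hoare_wpI[OF w_pos]) (use one in \<open>auto simp: F_def\<close>)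
  have fz: "hoare w 3 (errors 3 x) F ?Z" if "x \<le> 1" for x
  proof (rule hoare_wpI[OF w_pos])
    fix s assume "errors 3 x s"
    then have r: "regs s 1 = (if cyc = 1 then 3 - x else x)" by (simp add: errors_def avail_def)
    have "1 < regs s 1 \<longleftrightarrow> cyc = 1" unfolding r using that by (cases "cyc = 1") auto
    moreover have "cyc = 1 \<longleftrightarrow> has_k_cycle k G" by (simp add: cyc_def)
    ultimately show "wp w F ?Z s" using one by (simp add: F_def)
  qed (simp add: F_def)
  have h2: "hoare w t2 (any 2) S2 ?T"
    unfolding S2_def t2_def by (rule hoare_Seq[OF r2 f order_refl]) simp
  have h1: "hoare w t1 (any 1) S1 ?T"
    unfolding S1_def t1_def by (rule hoare_Seq[OF r1 h2 order_refl]) simp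
  have h0: "hoare w t0 (any 0) S0 ?T"
    unfolding S0_def t0_def by (rule hoare_Seq[OF r0 h1 order_refl]) simp
  have e: "any j s" if "errors j x s" for j x s using that by (auto simp: any_def)
  show "hoare w detect_time (errors 0 0) (detect_prog R k b Q E C P) ?T"
    unfolding 0 t by (rule hoare_mono[OF h0 e _ order_refl])
  have sub: "hoare w u (\<lambda>s. errors j x s \<or> errors j y s) Y ?T" if "hoare w u (any j) Y ?T" for u j x y Y
    by (rule hoare_mono[OF that _ _ order_refl]) (auto intro: e)
  have p: "0 \<le> p" "p \<le> 1" "p * p \<le> p * 1 + (1 - p) * p" by (auto simp: p_def)
  have fd: "hoare w 3 (\<lambda>s. errors 3 0 s \<or> errors 3 1 s) F ?Z"
    using fz[of 0] fz[of 1] unfolding hoare_def by simp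
  \<comment> \<open>The fact \<open>lij\<close> bounds the probability of a correct verdict after
    \<open>i\<close> rounds with \<open>j\<close> errors. Two rounds without error already decide
    the vote.\<close>
  have "hoare w t2 (errors 2 0) S2 ?Z"
    unfolding S2_def t2_def by (rule hoare_Seq[OF R2(1)[of 0, unfolded suc] fd order_refl])
  then have l20: "likely w t2 1 (errors 2 0) S2 ?Z" by (rule hoare_likely) simp
  have "likely w 3 1 (errors 3 1) F ?Z" by (rule hoare_likely[OF fz]) simp_all
  then have f': "likely w 3 1 (\<lambda>s. (errors 3 1 s \<or> errors 3 (Suc 1) s) \<and> errors 3 1 s) F ?Z"
    by (rule likely_pre) simp_all
  have l21: "likely w t2 p (errors 2 1) S2 ?Z"
    using likely_Seq[OF R(1)[of 2 1, unfolded suc(1)] R2(2)[of 1] sub[OF f] f' likely_zero _ _ order_refl]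
    unfolding S2_def t2_def by simp
  have l10: "likely w t1 (p * 1 + (1 - p) * p) (errors 1 0) S1 ?Z"
    unfolding S1_def t1_def
  proof (rule likely_Seq[OF R1(1)[of 0, unfolded suc] R1(2)[of 0] sub[OF h2] _ _ p(1,2) order_refl])
    show "likely w t2 1 (\<lambda>s. (errors 2 0 s \<or> errors 2 1 s) \<and> errors 2 0 s) S2 ?Z"
      by (rule likely_pre[OF l20]) simp_all
    show "likely w t2 p (\<lambda>s. errors 2 0 s \<or> errors 2 1 s) S2 ?Z"
      by (rule likely_disj[OF likely_pre[OF l20] l21]) (use p in simp_all)
  qed
  have l11: "likely w t1 (p * p + (1 - p) * 0) (errors 1 1) S1 ?Z"
    unfolding S1_def t1_def
  proof (rule likely_Seq[OF R(1)[of 1 1, unfolded suc(2)] R1(2)[of 1] sub[OF h2] _ likely_zero order_refl p(1) order_refl])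
    show "likely w t2 p (\<lambda>s. (errors 2 1 s \<or> errors 2 2 s) \<and> errors 2 1 s) S2 ?Z"
      by (rule likely_pre[OF l21]) simp_all
  qed simp
  have l00: "likely w t0 (p * (p * 1 + (1 - p) * p) + (1 - p) * (p * p)) (errors 0 0) S0 ?Z"
    unfolding S0_def t0_def
  proof (rule likely_Seq[OF R0(1)[of 0, unfolded suc] R0(2)[of 0] sub[OF h1] _ _ _ p(3) order_refl])
    show "likely w t1 (p * 1 + (1 - p) * p) (\<lambda>s. (errors 1 0 s \<or> errors 1 1 s) \<and> errors 1 0 s) S1 ?Z"
      by (rule likely_pre[OF l10]) simp_all
    show "likely w t1 (p * p) (\<lambda>s. errors 1 0 s \<or> errors 1 1 s) S1 ?Z"
      by (rule likely_disj[OF likely_pre[OF l10]], assumption, rule p(3)) (use l11 in simp)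
  qed (simp add: p_def)
  have h00: "hoare w t0 (errors 0 0) S0 ?T" by (rule hoare_mono[OF h0 e _ order_refl])
  \<comment> \<open>The right-hand side is 3p^2 - 2p^3, about 0.695 for p = 19/30.\<close>
  have "2 / 3 \<le> p * (p * 1 + (1 - p) * p) + (1 - p) * (p * p)" by (simp add: p_def)
  from likely_mono[OF l00 h00 _ _ order_refl this]
  show "likely w detect_time (2 / 3) (errors 0 0) (detect_prog R k b Q E C P) ?Z"
    unfolding 0 t by simp
qed

end

section \<open>Approximating the girth takes linear time\<close>

text \<open>A \<open>Store\<close> counts as well as a \<open>Load\<close>: the change of cell
  \<open>i\<close> commutes with a step only if that step leaves the cell alone.\<close>

fun touches :: "prog \<Rightarrow> state \<Rightarrow> nat \<Rightarrow> bool" where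
  "touches (Load r a) s i \<longleftrightarrow> regs s a = i"
| "touches (Store a r) s i \<longleftrightarrow> regs s a = i"
| "touches (Seq P Q) s i \<longleftrightarrow> touches P s i"
| "touches _ s i \<longleftrightarrow> False"

lemma touches_unique: "touches P s i \<Longrightarrow> touches P s i' \<Longrightarrow> i = i'"
  by (induction P) auto

lemma step_set_mem:
  assumes "\<not> touches P s i"
  shows "step P (set_mem i x s) = map_pmf (\<lambda>(Q, s'). (Q, set_mem i x s')) (step P s)"
  using assms
proof (induction P)
  case (Seq P Q)
  then show ?case by (auto simp: pmf.map_comp comp_def split_def)
next
  case (Rand r b)
  have swap: "set_reg r y (set_mem i x s) = set_mem i x (set_reg r y s)" for y
    by (simp add: set_reg_def set_mem_def)
  have "regs (set_mem i x s) b = regs s b" by (simp add: set_mem_def)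
  then show ?case by (simp add: pmf.map_comp comp_def swap)
qed (auto simp: set_mem_def set_reg_def pmf.map_comp comp_def fun_upd_twist)

text \<open>Until cell \<open>i\<close> is accessed, the runs from the two memories differ in that
  cell only. A union bound over the times limits the loss by the sum of the access
  probabilities.\<close>

lemma run_set_mem:
  "measure_pmf.prob (run t P s) {(Q, s'). (Q, set_mem i x s') \<in> A}
     - (\<Sum>u<t. measure_pmf.prob (run u P s) {(Q, s'). touches Q s' i})
   \<le> measure_pmf.prob (run t P (set_mem i x s)) A"
proof (induction t arbitrary: P s)
  case 0
  then show ?case by (simp add: indicator_def)
next
  case (Suc t)
  let ?A = "{(Q, s'). (Q, set_mem i x s') \<in> A}" and ?B = "{(Q, s'). touches Q s' i}"
  show ?case
  proof (cases "touches P s i")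
    case True
    \<comment> \<open>The very next step accesses the cell, so the subtracted sum is at least 1 and
      the bound is trivial.\<close>
    have "1 \<le> (\<Sum>u<Suc t. measure_pmf.prob (run u P s) ?B)"
      unfolding sum.lessThan_Suc_shift using True by (simp add: sum_nonneg del: run.simps(2))
    moreover have "measure_pmf.prob (run (Suc t) P s) ?A \<le> 1" by simp
    ultimately show ?thesis by (smt (verit) measure_nonneg)
  next
    case False
    have "(\<Sum>u<Suc t. measure_pmf.prob (run u P s) ?B) = (\<Sum>u<t. measure_pmf.prob (run (Suc u) P s) ?B)"
      unfolding sum.lessThan_Suc_shift using False by (simp del: run.simps(2))
    also have "\<dots> = (\<Sum>u<t. \<integral>y. measure_pmf.prob (case y of (Q, s') \<Rightarrow> run u Q s') ?B \<partial>step P s)"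
      by (simp add: run_Suc_left prob_bind_pmf del: run.simps(2))
    also have "\<dots> = (\<integral>y. (\<Sum>u<t. measure_pmf.prob (case y of (Q, s') \<Rightarrow> run u Q s') ?B) \<partial>step P s)"
      by (rule Bochner_Integration.integral_sum[symmetric]) (rule integrable_prob)
    finally have B: "(\<Sum>u<Suc t. measure_pmf.prob (run u P s) ?B) = \<dots>" .
    have "measure_pmf.prob (run (Suc t) P s) ?A - (\<Sum>u<Suc t. measure_pmf.prob (run u P s) ?B)
       = (\<integral>y. measure_pmf.prob (case y of (Q, s') \<Rightarrow> run t Q s') ?A
             - (\<Sum>u<t. measure_pmf.prob (case y of (Q, s') \<Rightarrow> run u Q s') ?B) \<partial>step P s)"
      unfolding B run_Suc_left prob_bind_pmf
      by (rule Bochner_Integration.integral_diff[symmetric])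
        (auto intro!: integrable_prob Bochner_Integration.integrable_sum)
    also have "\<dots> \<le> (\<integral>y. measure_pmf.prob (case y of (Q, s') \<Rightarrow> run t Q (set_mem i x s')) A \<partial>step P s)"
      using Suc.IH
      by (intro integral_mono Bochner_Integration.integrable_diff Bochner_Integration.integrable_sum integrable_prob)
        (auto split: prod.split)
    also have "\<dots> = measure_pmf.prob (run (Suc t) P (set_mem i x s)) A"
      unfolding run_Suc_left step_set_mem[OF False] bind_map_pmf prob_bind_pmf
      by (simp add: split_def)
    finally show ?thesis .
  qed
qed

text \<open>Paths of length two from 0 to \<open>Suc p\<close> through \<open>p\<close> middle
  vertices. Turning the second arc of one path back to 0 closes a 2-cycle while changing a single
  memory cell; for \<open>p \<ge> 2\<close> it isolates no vertex.\<close>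

definition fan_arcs :: "nat \<Rightarrow> (nat \<times> nat) list" where
  "fan_arcs p = map (\<lambda>i. (0, Suc i)) [0..<p] @ map (\<lambda>i. (Suc i, Suc p)) [0..<p]"

definition list_graph :: "nat \<Rightarrow> (nat \<times> nat) list \<Rightarrow> nat pair_pre_digraph" where
  "list_graph n es = \<lparr>pverts = {..<n}, parcs = set es\<rparr>"

definition turned :: "nat \<Rightarrow> nat \<Rightarrow> (nat \<times> nat) list" where
  "turned p i = (fan_arcs p)[p + i := (Suc i, 0)]"

lemma length_fan_arcs [simp]: "length (fan_arcs p) = 2 * p" "length (turned p i) = 2 * p"
  by (simp_all add: fan_arcs_def turned_def)

lemma nth_fan_arcs: "l < 2 * p \<Longrightarrow> fan_arcs p ! l = (if l < p then (0, Suc l) else (Suc (l - p), Suc p))"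
  by (auto simp: fan_arcs_def nth_append)

lemma nth_turned: "l < 2 * p \<Longrightarrow> i < p \<Longrightarrow>
    turned p i ! l = (if l < p then (0, Suc l) else (Suc (l - p), if l = p + i then 0 else Suc p))"
  by (auto simp: turned_def nth_list_update nth_fan_arcs)

lemma list_graph_input:
  assumes "distinct es" "\<And>e. e \<in> set es \<Longrightarrow> fst e < n \<and> snd e < n \<and> fst e \<noteq> snd e"
    "\<And>v. v < n \<Longrightarrow> \<exists>e\<in>set es. v = fst e \<or> v = snd e"
  shows "graph_input (list_graph n es) es"
proof -
  have "pair_digraph (list_graph n es)"
    by unfold_locales (use assms(2) in \<open>auto simp: list_graph_def\<close>)
  then show ?thesis using assms by (auto simp: graph_input_def list_graph_def)
qed

lemma fan_input:
  assumes "2 \<le> p"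
  shows "graph_input (list_graph (p + 2) (fan_arcs p)) (fan_arcs p)"
proof (rule list_graph_input)
  show "distinct (fan_arcs p)"
    by (auto simp: distinct_conv_nth nth_fan_arcs)
  show "fst e < p + 2 \<and> snd e < p + 2 \<and> fst e \<noteq> snd e" if "e \<in> set (fan_arcs p)" for e
    using that by (auto simp: fan_arcs_def)
  fix v assume v: "v < p + 2"
  consider "v = 0" | "v = Suc p" | "0 < v" "v \<le> p" using v by linarith
  then show "\<exists>e\<in>set (fan_arcs p). v = fst e \<or> v = snd e"
  proof cases
    case 1
    then show ?thesis using assms by (intro bexI[of _ "(0, Suc 0)"]) (auto simp: fan_arcs_def)
  next
    case 2
    then show ?thesis using assms by (intro bexI[of _ "(Suc 0, Suc p)"]) (auto simp: fan_arcs_def)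
  next
    case 3
    then have "v - 1 \<in> {0..<p}" "v = Suc (v - 1)" by auto
    moreover from this(1) have "(0 :: nat, Suc (v - 1)) \<in> (\<lambda>i. (0, Suc i)) ` {0..<p}" by (rule imageI)
    then have "(0, Suc (v - 1)) \<in> set (fan_arcs p)" by (simp add: fan_arcs_def)
    ultimately show ?thesis by (intro bexI[of _ "(0, Suc (v - 1))"]) simp_all
  qed
qed

lemma in_turned:
  assumes "i < p"
  shows "l < p \<Longrightarrow> (0, Suc l) \<in> set (turned p i)" "(Suc i, 0) \<in> set (turned p i)"
    "l < p \<Longrightarrow> l \<noteq> i \<Longrightarrow> (Suc l, Suc p) \<in> set (turned p i)"
  using assms nth_turned[of l p i] nth_turned[of "p + i" p i] nth_turned[of "p + l" p i]
    nth_mem[of l "turned p i"] nth_mem[of "p + i" "turned p i"] nth_mem[of "p + l" "turned p i"]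
  by (auto simp: add.commute)

lemma turned_input:
  assumes "2 \<le> p" "i < p"
  shows "graph_input (list_graph (p + 2) (turned p i)) (turned p i)"
proof (rule list_graph_input)
  show "distinct (turned p i)"
    using assms by (auto simp: distinct_conv_nth nth_turned)
  show "fst e < p + 2 \<and> snd e < p + 2 \<and> fst e \<noteq> snd e" if "e \<in> set (turned p i)" for e
    using that assms by (auto simp: in_set_conv_nth nth_turned split: if_splits)
  fix v assume v: "v < p + 2"
  consider "v = 0" | "v = Suc p" | "0 < v" "v \<le> p" using v by linarith
  then show "\<exists>e\<in>set (turned p i). v = fst e \<or> v = snd e"
  proof cases
    case 1
    then show ?thesis using in_turned(2)[OF assms(2)] by (intro bexI[of _ "(Suc i, 0)"]) auto
  next
    case 2
    obtain l where "l < p" "l \<noteq> i" using assms that[of 0] that[of 1] by (cases "i = 0") auto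
    then show ?thesis using in_turned(3)[OF assms(2), of l] 2 by (intro bexI[of _ "(Suc l, Suc p)"]) auto
  next
    case 3
    then show ?thesis using in_turned(1)[OF assms(2), of "v - 1"] by (intro bexI[of _ "(0, Suc (v - 1))"]) auto
  qed
qed

text \<open>The address is that of the head of arc \<open>p + i\<close>: two header cells, two cells
  for each preceding arc, and one for its own tail.\<close>

lemma init_turned:
  assumes "i < p"
  shows "init_state (list_graph (p + 2) (turned p i)) (turned p i)
     = set_mem (2 * (p + i) + 3) 0 (init_state (list_graph (p + 2) (fan_arcs p)) (fan_arcs p))"
proof -
  let ?f = "\<lambda>xs :: (nat \<times> nat) list. concat (map (\<lambda>(u, v). [u, v]) xs)"
  have len: "length (?f xs) = 2 * length xs" for xs by (induction xs) auto
  have upd: "?f (xs[l := (fst (xs ! l), y)]) = (?f xs)[2 * l + 1 := y]" if "l < length xs" for xs l y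
    using that
  proof (induction xs arbitrary: l)
    case (Cons e xs)
    then show ?case by (cases l) (auto simp: split_def)
  qed simp
  have f: "?f (turned p i) = (?f (fan_arcs p))[2 * (p + i) + 1 := 0]"
    using upd[of "p + i" "fan_arcs p" 0] assms by (simp add: turned_def nth_fan_arcs)
  show ?thesis
    unfolding init_state_def Let_def f
    using assms by (auto simp: list_graph_def set_mem_def fun_eq_iff len nth_list_update nth_Cons split: nat.splits)
qed

text \<open>All arcs lead to greater numbers, so the greatest vertex of a cycle could have no
  successor.\<close>

lemma girth_fan: "girth (list_graph (p + 2) (fan_arcs p)) = \<infinity>" if "2 \<le> p"
proof -
  let ?G = "list_graph (p + 2) (fan_arcs p)"
  have wf: "pair_wf_digraph ?G" using fan_input[OF that]
    by (simp add: graph_input_def pair_digraph_def pair_fin_digraph_def)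
  have "\<not> cyclic_seq (parcs ?G) k f" for k f
  proof
    assume c: "cyclic_seq (parcs ?G) k f"
    then have k: "0 < k" by (simp add: cyclic_seq_def)
    have "Max (f ` {..<k}) \<in> f ` {..<k}" using k by (intro Max_in) auto
    then obtain i where i: "i < k" "f i = Max (f ` {..<k})" by auto
    have "(f i, f (Suc i mod k)) \<in> set (fan_arcs p)"
      using c i(1) by (simp add: cyclic_seq_def list_graph_def)
    then have "f i < f (Suc i mod k)" by (auto simp: fan_arcs_def)
    moreover have "f (Suc i mod k) \<le> Max (f ` {..<k})" using k by (intro Max_ge) auto
    ultimately show False using i by simp
  qed
  then have "\<infinity> \<le> girth ?G" using has_k_cycle_iff[OF wf] by (intro girth_ge) blast
  then show ?thesis by simp
qed

lemma girth_turned: "girth (list_graph (p + 2) (turned p i)) \<le> 2" if "2 \<le> p" "i < p"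
proof -
  let ?G = "list_graph (p + 2) (turned p i)"
  have wf: "pair_wf_digraph ?G" using turned_input[OF that]
    by (simp add: graph_input_def pair_digraph_def pair_fin_digraph_def)
  have "cyclic_seq (parcs ?G) 2 (\<lambda>l. if l = 0 then 0 else Suc i)"
    using in_turned[OF that(2)] that
    by (auto simp: cyclic_seq_def list_graph_def inj_on_def less_Suc_eq numeral_2_eq_2)
  then have "has_k_cycle 2 ?G" using has_k_cycle_iff[OF wf] by blast
  then show ?thesis using girth_le[of 2 ?G] by (simp add: numeral_eq_enat)
qed

text \<open>
  Redirecting a single arc to 0 creates a cycle: hence each of \<open>p\<close> arcs of the fan has to be read
  with probability at least \<open>1/3\<close>, while a step reads at most one of them.
\<close>

lemma girth_approximation_time:
  assumes S: "solves P a T (\<lambda>G x. girth_approximation c G (if x = 0 then \<infinity> else enat x))" and p: "2 \<le> p"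
  shows "real p / 3 \<le> real (T (2 * p))"
proof -
  let ?G = "list_graph (p + 2) (fan_arcs p)" and ?T = "T (2 * p)"
  let ?s = "init_state ?G (fan_arcs p)"
  let ?cell = "\<lambda>i. 2 * (p + i) + 3"
  let ?Z = "{(Q :: prog, s :: state). regs s 0 = 0}"
  let ?touch = "\<lambda>i u. measure_pmf.prob (run u P ?s) {(Q, s'). touches Q s' (?cell i)}"
  have m: "card (parcs G) = length es" if "graph_input G es" for G es
    using that by (metis graph_input_def distinct_card)
  have "2 / 3 \<le> measure_pmf.prob (run ?T P ?s) {(P', s'). girth_approximation c ?G (if regs s' 0 = 0 then \<infinity> else enat (regs s' 0))}"
    using S[unfolded solves_def Let_def, rule_format, OF fan_input[OF p]] m[OF fan_input[OF p]] by simp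
  also have "\<dots> \<le> measure_pmf.prob (run ?T P ?s) ?Z"
  proof (intro measure_pmf.finite_measure_mono subsetI)
    fix y :: "prog \<times> state"
    assume "y \<in> {(P', s'). girth_approximation c ?G (if regs s' 0 = 0 then \<infinity> else enat (regs s' 0))}"
    then show "y \<in> ?Z"
      unfolding girth_approximation_def girth_fan[OF p] by (auto split: if_splits)
  qed simp
  finally have yes: "2 / 3 \<le> measure_pmf.prob (run ?T P ?s) ?Z" .
  \<comment> \<open>The answer 0 has probability at least 2/3 on the fan and at most 1/3 on the
    turned graph; accesses to the changed cell must account for the difference.\<close>
  have "1 / 3 \<le> (\<Sum>u<?T. ?touch i u)" if i: "i < p" for i
  proof -
    let ?H = "list_graph (p + 2) (turned p i)"
    let ?r = "init_state ?H (turned p i)"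
    have "2 / 3 \<le> measure_pmf.prob (run ?T P ?r) {(P', s'). girth_approximation c ?H (if regs s' 0 = 0 then \<infinity> else enat (regs s' 0))}"
      using S[unfolded solves_def Let_def, rule_format, OF turned_input[OF p i]] m[OF turned_input[OF p i]] by simp
    also have "\<dots> \<le> measure_pmf.prob (run ?T P ?r) (- ?Z)"
    proof (intro measure_pmf.finite_measure_mono subsetI)
      fix y :: "prog \<times> state"
      assume y: "y \<in> {(P', s'). girth_approximation c ?H (if regs s' 0 = 0 then \<infinity> else enat (regs s' 0))}"
      obtain g where g: "girth ?H = enat g" using girth_turned[OF p i] by (cases "girth ?H") auto
      have "\<not> girth_approximation c ?H \<infinity>" unfolding girth_approximation_def g by simp
      then show "y \<in> - ?Z" using y by (auto split: if_splits)
    qed auto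
    also have "\<dots> = 1 - measure_pmf.prob (run ?T P ?r) ?Z"
      using measure_pmf.prob_compl[of ?Z "run ?T P ?r"] by (simp add: Compl_eq_Diff_UNIV)
    finally have "measure_pmf.prob (run ?T P ?r) ?Z \<le> 1 / 3" by simp
    moreover have "{(Q, s'). (Q, set_mem (?cell i) 0 s') \<in> ?Z} = ?Z" by (auto simp: set_mem_def)
    ultimately show ?thesis
      using run_set_mem[of ?T P ?s "?cell i" 0 ?Z] yes unfolding init_turned[OF i] by simp
  qed
  then have "(\<Sum>i<p. 1 / 3) \<le> (\<Sum>i<p. \<Sum>u<?T. ?touch i u)" by (intro sum_mono) auto
  also have "\<dots> = (\<Sum>u<?T. \<Sum>i<p. ?touch i u)" by (rule sum.swap)
  also have "\<dots> \<le> (\<Sum>u<?T. 1)"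
  proof (intro sum_mono)
    fix u
    have "disjoint_family_on (\<lambda>i. {(Q, s'). touches Q s' (?cell i)}) {..<p}"
      unfolding disjoint_family_on_def
    proof (intro ballI impI)
      fix i i' :: nat assume "i \<noteq> i'"
      then have "\<not> (touches Q s (?cell i) \<and> touches Q s (?cell i'))" for Q s
        using touches_unique[of Q s "?cell i" "?cell i'"] by auto
      then show "{(Q, s'). touches Q s' (?cell i)} \<inter> {(Q, s'). touches Q s' (?cell i')} = {}" by auto
    qed
    then have "(\<Sum>i<p. ?touch i u) = measure_pmf.prob (run u P ?s) (\<Union>i<p. {(Q, s'). touches Q s' (?cell i)})"
      by (intro measure_pmf.finite_measure_finite_Union[symmetric]) auto
    then show "(\<Sum>i<p. ?touch i u) \<le> 1" by simp
  qed
  finally show ?thesis by simp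
qed

lemma no_sublinear_girth_approximation:
  assumes "1 < \<epsilon>"
  shows "\<not> girth_approximable_in_time M c (\<lambda>m. real m powr (2 - \<epsilon>))"
proof
  assume "girth_approximable_in_time M c (\<lambda>m. real m powr (2 - \<epsilon>))"
  then obtain P a T where T: "(\<lambda>m. real (T m)) \<in> O(\<lambda>m. real m powr (2 - \<epsilon>))"
    and S: "solves P a T (\<lambda>G x. girth_approximation c G (if x = 0 then \<infinity> else enat x))"
    unfolding girth_approximable_in_time_def solvable_in_time_def by blast
  have "(\<lambda>m. real m powr (2 - \<epsilon>)) \<in> o(\<lambda>m. real m)"
    using assms by real_asymp
  with T have "(\<lambda>m. real (T m)) \<in> o(\<lambda>m. real m)" by (rule landau_o.big_small_trans)
  \<comment> \<open>Any constant below 1/6 would contradict p/3 \<le> T(2p).\<close>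
  then have "eventually (\<lambda>m. norm (real (T m)) \<le> 1 / 12 * norm (real m)) at_top"
    by (rule landau_o.smallD) simp
  then obtain m0 where m0: "\<And>m. m \<ge> m0 \<Longrightarrow> real (T m) \<le> real m / 12"
    by (auto simp: eventually_at_top_linorder)
  define p where "p = max 2 m0"
  have "real p / 3 \<le> real (T (2 * p))" by (rule girth_approximation_time[OF S]) (simp add: p_def)
  also have "\<dots> \<le> real (2 * p) / 12" by (rule m0) (simp add: p_def)
  finally show False by (simp add: p_def)
qed

section \<open>The reduction\<close>

lemma good_word_mono: "good w t P s \<Longrightarrow> w \<le> w' \<Longrightarrow> good w' t P s"
  unfolding good_def fits_def
  by (smt (verit, ccfv_SIG) case_prodD case_prodI2 less_le_trans one_le_numeral power_increasing)

section \<open>Word sizes\<close>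

definition log_size :: "nat \<Rightarrow> nat" where
  "log_size m = nat \<lceil>log 2 (real m + 2)\<rceil>"

lemma word_size_eq: "word_size c m = c * log_size m"
  by (simp add: word_size_def log_size_def)

lemma power_log_size: "m + 2 \<le> 2 ^ log_size m"
proof -
  have "log 2 (real m + 2) \<le> real (log_size m)" by (simp add: log_size_def of_nat_ceiling)
  then have "real m + 2 \<le> 2 powr real (log_size m)" by (simp add: log_le_iff)
  then have "real (m + 2) \<le> real (2 ^ log_size m)" by (simp add: powr_realpow)
  then show ?thesis by (simp only: of_nat_le_iff)
qed

text \<open>A constant factor in the word size is an exponent in the range of values, so every
  polynomial bound can be accommodated.\<close>

lemma power_word_size: "(m + 2) ^ c \<le> 2 ^ word_size c m"
proof -
  have "(m + 2) ^ c \<le> (2 ^ log_size m) ^ c" by (rule power_mono[OF power_log_size]) simp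
  also have "\<dots> = 2 ^ word_size c m" unfolding word_size_eq by (simp add: mult.commute flip: power_mult)
  finally show ?thesis .
qed

lemma word_size_mono: "m \<le> m' \<Longrightarrow> word_size c m \<le> word_size c m'"
  unfolding word_size_def by (intro mult_le_mono2 nat_mono ceiling_mono) simp

text \<open>The constructed graph is polynomially larger than the input, so its words are longer by
  a constant factor only.\<close>

lemma word_size_le:
  assumes "M + 2 \<le> (m + 2) ^ d"
  shows "word_size c M \<le> word_size (c * d) m"
proof -
  have "real (M + 2) \<le> real ((m + 2) ^ d)" using assms by (simp only: of_nat_le_iff)
  then have "real M + 2 \<le> (real m + 2) ^ d" by (simp add: add.commute)
  then have "log 2 (real M + 2) \<le> log 2 ((real m + 2) ^ d)" by (intro log_mono) auto
  also have "\<dots> = d * log 2 (real m + 2)" by (simp add: log_nat_power)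
  also have "\<dots> \<le> real d * real (log_size m)"
    by (intro mult_left_mono) (simp_all add: log_size_def of_nat_ceiling)
  finally have "\<lceil>log 2 (real M + 2)\<rceil> \<le> int (d * log_size m)" by (simp add: ceiling_le_iff)
  then have "log_size M \<le> d * log_size m" by (simp add: log_size_def[of M] nat_le_iff)
  then show ?thesis by (simp add: word_size_eq)
qed

lemma fits_init_state:
  assumes "graph_input G es" "2 * length es < 2 ^ w"
  shows "fits w (init_state G es)"
proof -
  let ?input = "card (pverts G) # length es # concat (map (\<lambda>(u, v). [u, v]) es)"
  interpret pair_digraph G using assms by (simp add: graph_input_def)
  have n: "card (pverts G) \<le> 2 * length es" by (rule card_pverts_le[OF assms(1)])
  have "x < 2 ^ w" if x: "x \<in> set ?input" for x
  proof -
    consider "x = card (pverts G)" | "x = length es" | "x \<in> fst ` set es \<union> snd ` set es"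
      using x by (force simp: split_def image_iff)
    then show ?thesis
    proof cases
      case 3
      then have "x \<in> pverts G" using assms(1) by (auto simp: graph_input_def dest: in_arcsD1 in_arcsD2)
      then have "x < card (pverts G)" using assms(1) by (metis graph_input_def lessThan_iff)
      then show ?thesis using n assms(2) by linarith
    qed (use n assms(2) in linarith)+
  qed
  then have "(if a < length ?input then ?input ! a else 0) < 2 ^ w" for a
    using nth_mem[of a ?input] by (cases "a < length ?input") auto
  then show ?thesis unfolding fits_def init_state_def Let_def by simp
qed

text \<open>There are no self-loops, so halting at once with 0 in register 0 is correct. The factor
  2 in the word size makes room for vertex numbers up to 2m.\<close>

lemma no_short_cycle:
  assumes "k < 2"
  shows "k_cycle_detectable_in_time M k f"
  unfolding k_cycle_detectable_in_time_def solvable_in_time_def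
proof (intro exI conjI)
  show "solves Skip 2 (\<lambda>_. 0) (\<lambda>G x. x \<noteq> 0 \<longleftrightarrow> has_k_cycle k G)"
    unfolding solves_def Let_def
  proof (intro allI impI)
    fix G es assume i: "graph_input G es"
    then have c: "card (parcs G) = length es" by (metis graph_input_def distinct_card)
    have "2 * length es < (length es + 2) ^ 2" by (simp add: power2_eq_square)
    also have "\<dots> \<le> 2 ^ word_size 2 (length es)" by (rule power_word_size)
    finally have "fits (word_size 2 (length es)) (init_state G es)" by (rule fits_init_state[OF i])
    moreover have "\<not> has_k_cycle k G"
      using has_k_cycle_ge_2[of G k] i assms by (auto simp: graph_input_def)
    ultimately show "(\<forall>t\<le>0. \<forall>(P', s')\<in>set_pmf (run t Skip (init_state G es)). fits (word_size 2 (card (parcs G))) s') \<and>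
        (\<forall>(P', s')\<in>set_pmf (run 0 Skip (init_state G es)). P' = Skip) \<and>
        2 / 3 \<le> measure_pmf.prob (run 0 Skip (init_state G es)) {(P', s'). (regs s' 0 \<noteq> 0) = has_k_cycle k G}"
      by (simp add: c) (simp add: init_state_def Let_def)
  qed
qed auto

lemma rand_free_detect:
  assumes "rand_free P"
  shows "rand_free (detect_prog Deterministic k b Q E C P)"
  by (simp add: detect_prog_def round_prog_def prep_prog_def setup_prog_def base_prog_def modulus_prog_def
      choose_prog_def build_prog_def copies_prog_def pendant_prog_def main_prog_def read_prog_def colour_prog_def
      emit_prog_def header_prog_def finish_prog_def rand_free_sim[OF assms] rand_free_rep colour_step_def)

lemma base_of_le: "0 < E \<Longrightarrow> base_of E m \<le> 2 ^ (E + 1) * (m + 1)"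
proof (cases "m = 0")
  case True
  then show ?thesis by (simp add: base_of_def halvings.simps)
next
  case False
  assume E: "0 < E"
  have "base_of E m \<le> base_of E m ^ E" using E by (intro self_le_power) (auto simp: Suc_le_eq)
  also have "\<dots> \<le> 2 * m * 2 ^ E" using base_of_power_le[OF E] False by simp
  also have "\<dots> \<le> 2 ^ (E + 1) * (m + 1)" by simp
  finally show ?thesis .
qed

text \<open>The size of \<open>H\<close> depends on the colours and is only known to be at most 3Nm,
  and \<open>T\<close> need not be monotone; hence the maximum. The 66 collects three times the 20
  of \<open>round_time\<close> and the 6 of \<open>detect_time\<close>.\<close>

definition reduction_time :: "model \<Rightarrow> nat \<Rightarrow> nat \<Rightarrow> nat \<Rightarrow> nat \<Rightarrow> nat \<Rightarrow> (nat \<Rightarrow> nat) \<Rightarrow> nat \<Rightarrow> nat" where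
  "reduction_time R k b Q E C T m =
     (let B = base_of E m; N = copies_count R Q B C in
      3 * (build_const R k b Q E C * (1 + 3 * N * m) + 7 * Max (T ` {..3 * N * m}) + 5 * B)
      + (\<Sum>j<3. cost (finish_prog k j) + cost (setup_prog E j)) + 66)"

text \<open>A number so large that \<open>algorithm_consts k b Q E C * (m + 2)\<^sup>2\<close> bounds all values outside the
  simulations.\<close>

definition algorithm_consts :: "nat \<Rightarrow> nat \<Rightarrow> nat \<Rightarrow> nat \<Rightarrow> nat \<Rightarrow> nat" where
  "algorithm_consts k b Q E C = 2 * k + C + Q + b + 2 ^ b + E + 16 + 18 * C * Q * 2 ^ (E + 1)
     + Q * (2 ^ (E + 1))\<^sup>2 + Q ^ E + b * Q ^ E"

text \<open>The word size has two parts: \<open>a * (K + 2)\<close> for the words of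
  \<open>P\<close> on inputs of size at most (m+2)^(K+2), and \<open>K + 2\<close> for the factor by
  which addresses grow in a window and for the values of the reduction itself.\<close>

lemma detect_solves:
  assumes S: "solves P a T (\<lambda>G x. girth_approximation c G (if x = 0 then \<infinity> else enat x))"
    and k: "2 \<le> k" and E: "0 < E" and c: "c < 2"
    and b: "b = k" and Q: "Q = 80 * k\<^sup>2" and C: "C = 2 ^ (b * Q ^ E)"
    and K: "K = algorithm_consts k b Q E C"
  shows "solves (detect_prog R k b Q E C P) (a * (K + 2) + (K + 2)) (reduction_time R k b Q E C T)
    (\<lambda>G x. x \<noteq> 0 \<longleftrightarrow> has_k_cycle k G)"
  unfolding solves_def Let_def
proof (intro allI impI)
  fix G es assume i: "graph_input G es"
  define n m B N M where "n = card (pverts G)" and "m = length es" and "B = base_of E m"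
    and "N = copies_count R Q B C" and "M = 3 * N * m"
  define t v w where "t = Max (T ` {..M})" and "v = word_size a M" and "w = word_size (a * (K + 2) + (K + 2)) m"
  have card: "card (parcs H) = length fs" if "graph_input H fs" for H fs
    using that by (metis graph_input_def distinct_card)
  define x where "x = m + 2"
  define \<beta> :: nat where "\<beta> = 2 ^ (E + 1)"
  have x: "2 \<le> x" "m \<le> x" "x \<le> x\<^sup>2" "1 \<le> x\<^sup>2" by (auto simp: x_def power2_eq_square)
  have n: "n \<le> 2 * m" using card_pverts_le[OF i] by (simp add: n_def m_def)
  have B: "B \<le> \<beta> * x" using base_of_le[OF E, of m] by (auto simp: B_def \<beta>_def x_def intro: order_trans)
  have Q1: "1 \<le> Q" and \<beta>1: "1 \<le> \<beta>" using Q k by (auto simp: \<beta>_def power2_eq_square)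
  have N: "N \<le> C * Q * \<beta> * x"
  proof -
    have "C * 1 \<le> C * (Q * \<beta> * x)" using Q1 \<beta>1 x by (intro mult_le_mono2) (simp add: Suc_le_eq)
    moreover have "C * (Q * B) \<le> C * (Q * (\<beta> * x))" using B by (intro mult_le_mono2)
    ultimately show ?thesis by (auto simp: N_def copies_count_def mult_ac)
  qed
  have Nx: "N * n + N * m \<le> M" "N * m \<le> C * Q * \<beta> * x\<^sup>2" "M \<le> 3 * (C * Q * \<beta> * x\<^sup>2)"
  proof -
    have "N * n \<le> N * (2 * m)" using n by (rule mult_le_mono2)
    then show "N * n + N * m \<le> M" by (simp add: M_def)
    show "N * m \<le> C * Q * \<beta> * x\<^sup>2"
      using mult_le_mono[OF N x(2)] by (simp add: power2_eq_square mult_ac)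
    then show "M \<le> 3 * (C * Q * \<beta> * x\<^sup>2)" by (simp add: M_def)
  qed
  have Kge: "X * x\<^sup>2 \<le> K * x\<^sup>2" if "X \<le> K" for X using that by (rule mult_le_mono1)
  \<comment> \<open>As K < 2^K and \<open>x \<ge> 2\<close>, a constant factor \<open>K\<close> is
    traded for an exponent.\<close>
  have Kx: "K * x\<^sup>2 < x ^ (K + 2)"
  proof -
    have "K < 2 ^ K" by (rule less_exp)
    also have "(2::nat) ^ K \<le> x ^ K" using x by (intro power_mono) auto
    finally have "K * x\<^sup>2 < x ^ K * x\<^sup>2" using x by (intro mult_strict_right_mono) auto
    then show ?thesis by (simp only: power_add)
  qed
  have "M + 2 \<le> K * x\<^sup>2"
  proof -
    have "M + 2 \<le> (3 * (C * Q * \<beta>) + 2) * x\<^sup>2" using Nx(3) x by (simp add: algebra_simps)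
    also have "\<dots> \<le> K * x\<^sup>2" by (rule Kge) (simp add: K algorithm_consts_def \<beta>_def)
    finally show ?thesis .
  qed
  then have "v \<le> word_size (a * (K + 2)) m"
    unfolding v_def using Kx by (intro word_size_le) (simp add: x_def)
  moreover have ws: "w = word_size (a * (K + 2)) m + word_size (K + 2) m" by (simp add: w_def word_size_eq algebra_simps)
  moreover have xw: "x ^ (K + 2) \<le> 2 ^ word_size (K + 2) m" using power_word_size[of m "K + 2"] by (simp add: x_def)
  ultimately have "2 ^ v * (K * x\<^sup>2) \<le> 2 ^ w"
    unfolding ws power_add[of "2 :: nat"]
    by (intro mult_le_mono power_increasing order_trans[OF less_imp_le[OF Kx]]) auto
  moreover have "3 * 2 ^ v + (2 * m + 4) \<le> 2 ^ v * (K * x\<^sup>2)"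
  proof -
    have "3 + (2 * m + 4) \<le> 9 * x\<^sup>2" using x by (simp add: x_def)
    also have "\<dots> \<le> K * x\<^sup>2" by (rule Kge) (simp add: K algorithm_consts_def)
    finally have "2 ^ v * (3 + (2 * m + 4)) \<le> 2 ^ v * (K * x\<^sup>2)" by (rule mult_le_mono2)
    moreover have "1 * (2 * m + 4) \<le> 2 ^ v * (2 * m + 4)" by (intro mult_le_mono1) simp
    ultimately show ?thesis by (simp add: algebra_simps)
  qed
  ultimately have vw: "3 * 2 ^ v + (2 * m + 4) \<le> 2 ^ w" by (rule order_trans[rotated])
  have Kw: "K * x\<^sup>2 < 2 ^ w"
  proof -
    have "(2::nat) ^ word_size (K + 2) m \<le> 2 ^ w" unfolding ws by (intro power_increasing) auto
    then show ?thesis using Kx xw by linarith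
  qed
  have const: "X < 2 ^ w" if "X \<le> K" for X
  proof -
    have "X * 1 \<le> K * x\<^sup>2" using that x by (intro mult_le_mono) auto
    then show ?thesis using Kw by simp
  qed
  have scaled: "Y < 2 ^ w" if "Y \<le> X * x\<^sup>2" "X \<le> K" for X Y using Kge[OF that(2)] that(1) Kw by linarith
  interpret rounds G es R P c n m k b Q E C B N w v t
  proof
    show "graph_input G es" "n = card (pverts G)" "m = length es" "2 \<le> k" "0 < E" "Q = 80 * k\<^sup>2"
      "C = 2 ^ (b * Q ^ E)" "c < 2" "B = base_of E m" "N = copies_count R Q B C"
      by (fact i n_def m_def k E Q C c B_def N_def)+
    show "k \<le> 2 ^ b" unfolding b by (rule less_imp_le[OF less_exp])
    show "2 * k < 2 ^ w" "C < 2 ^ w" "Q < 2 ^ w" "b < 2 ^ w" "2 ^ b < (2::nat) ^ w" "E < 2 ^ w" "6 < (2::nat) ^ w"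
      "b * Q ^ E < 2 ^ w"
      by (rule const, simp add: K algorithm_consts_def)+
    have "Q ^ E < 2 ^ w" by (rule const) (simp add: K algorithm_consts_def)
    then show "Q ^ E \<le> 2 ^ w" by simp
    show "3 * 2 ^ v + (2 * m + 4) \<le> 2 ^ w" by (rule vw)
    show "2 * m + 10 + 6 * (N * n + N * m) < 2 ^ w"
    proof (rule scaled)
      have "2 * m + 10 + 6 * (N * n + N * m) \<le> 2 * m + 10 + 6 * (3 * (C * Q * \<beta> * x\<^sup>2))"
        using order_trans[OF Nx(1,3)] by (intro add_left_mono mult_le_mono2)
      also have "2 * m + 10 \<le> 12 * x\<^sup>2" using x by (simp add: x_def)
      finally show "2 * m + 10 + 6 * (N * n + N * m) \<le> (12 + 18 * (C * Q * \<beta>)) * x\<^sup>2"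
        by (simp add: algebra_simps)
      show "12 + 18 * (C * Q * \<beta>) \<le> K" by (simp add: K algorithm_consts_def \<beta>_def)
    qed
    show "N < 2 ^ w"
    proof (rule scaled)
      have "C * Q * \<beta> * x \<le> C * Q * \<beta> * x\<^sup>2" using x by (intro mult_le_mono2)
      then show "N \<le> (C * Q * \<beta>) * x\<^sup>2" using N by linarith
      show "C * Q * \<beta> \<le> K" by (simp add: K algorithm_consts_def \<beta>_def)
    qed
    show "Q * B * B < 2 ^ w"
    proof (rule scaled)
      have "Q * (B * B) \<le> Q * ((\<beta> * x) * (\<beta> * x))" using B by (intro mult_le_mono2 mult_le_mono)
      then show "Q * B * B \<le> (Q * \<beta>\<^sup>2) * x\<^sup>2" by (simp add: power2_eq_square mult_ac)
      show "Q * \<beta>\<^sup>2 \<le> K" by (simp add: K algorithm_consts_def \<beta>_def)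
    qed
    fix H fs assume H: "graph_input H fs" and len: "length fs \<le> N * n + N * m"
    let ?ok = "\<lambda>y. girth_approximation c H (if y = 0 then \<infinity> else enat y)"
    define m' where "m' = length fs"
    have m': "m' \<le> M" using len Nx(1) by (simp add: m'_def)
    have s: "good (word_size a m') (T m') P (init_state H fs)"
      "2 / 3 \<le> measure_pmf.prob (run (T m') P (init_state H fs)) {(P', s'). ?ok (regs s' 0)}"
      using S[unfolded solves_def Let_def, rule_format, OF H]
      unfolding good_def m'_def card[OF H] by blast+
    have Tt: "T m' \<le> t" unfolding t_def using m' by (intro Max_ge) auto
    have g: "good v (T m') P (init_state H fs)"
      by (rule good_word_mono[OF s(1)]) (simp add: v_def word_size_mono m')
    have "measure_pmf.prob (result (T m') P (init_state H fs)) {s. ?ok (regs s 0)}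
        = measure_pmf.prob (run (T m') P (init_state H fs)) {(P', s'). ?ok (regs s' 0)}"
      by (simp add: result_def vimage_def split_def)
    then show "good v t P (init_state H fs) \<and>
        2 / 3 \<le> measure_pmf.prob (result t P (init_state H fs)) {s. ?ok (regs s 0)}"
      using s(2) good_mono[OF g Tt] by simp
  qed
  let ?s = "init_state G es"
  have "2 * m < 2 ^ w" using bounds(1) by linarith
  then have f: "fits w ?s" using fits_init_state[OF i] by (simp add: m_def)
  have e: "errors 0 0 ?s"
  proof -
    have mem: "mem ?s a = (if a < length (n # m # flat es) then (n # m # flat es) ! a else 0)" for a
      by (simp add: init_state_def Let_def flat_def n_def m_def)
    have "mem ?s (2 + 2 * e) = fst (es ! e) \<and> mem ?s (3 + 2 * e) = snd (es ! e)" if "e < m" for e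
      using nth_flat[of e es] that unfolding mem by (simp add: m_def nth_Cons' numeral_3_eq_3)
    moreover have "mem ?s (2 * m + 2 + j + 3 * q) = 0" for j q unfolding mem by (simp add: m_def)
    moreover have "regs ?s r = 0" for r by (simp add: init_state_def Let_def)
    moreover have "mem ?s 0 = n" "mem ?s 1 = m" unfolding mem by auto
    ultimately show ?thesis by (simp add: errors_def avail_def)
  qed
  let ?D = "detect_prog R k b Q E C P" and ?T = "reduction_time R k b Q E C T m"
  define X where "X = build_const R k b Q E C * (1 + 3 * N * m)"
  define Z where "Z = build_const R k b Q E C * (1 + N * n + N * m)"
  have X: "Z \<le> X"
    unfolding X_def Z_def using Nx(1) by (intro mult_le_mono2) (simp add: M_def)
  have T: "?T = 3 * (X + 7 * t + 5 * B) + (\<Sum>j<3. cost (finish_prog k j) + cost (setup_prog E j)) + 66"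
    unfolding reduction_time_def Let_def B_def[symmetric] N_def[symmetric] X_def t_def M_def ..
  have sum3: "(\<Sum>j<3. f j) = f 0 + f 1 + f 2" for f :: "nat \<Rightarrow> nat"
    by (simp add: numeral_3_eq_3 numeral_2_eq_2)
  have lin: "(Z + 7 * t + f0 + g0 + 5 * B + 20) + (Z + 7 * t + f1 + g1 + 5 * B + 20)
      + (Z + 7 * t + f2 + g2 + 5 * B + 20) + 6
      \<le> 3 * (X + 7 * t + 5 * B) + (f0 + g0 + (f1 + g1) + (f2 + g2)) + 66"
    for f0 g0 f1 g1 f2 g2
    using X by simp
  have "detect_time \<le> ?T"
    unfolding T sum3 detect_time_def round_time_def Z_def[symmetric] by (rule lin)
  moreover have "good w detect_time ?D ?s" using hoare_detect f e unfolding hoare_def by blast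
  ultimately have g: "good w ?T ?D ?s" "result ?T ?D ?s = result detect_time ?D ?s"
    using good_mono by blast+
  have "2 / 3 \<le> measure_pmf.prob (result ?T ?D ?s) {s. regs s 0 \<noteq> 0 \<longleftrightarrow> has_k_cycle k G}"
    using likely_detect f e unfolding likely_def g(2) by blast
  also have "\<dots> = measure_pmf.prob (run ?T ?D ?s) {(P', s'). regs s' 0 \<noteq> 0 \<longleftrightarrow> has_k_cycle k G}"
    by (simp add: result_def vimage_def split_def)
  finally show "(\<forall>t\<le>reduction_time R k b Q E C T (card (parcs G)).
        \<forall>(P', s')\<in>set_pmf (run t ?D ?s). fits (word_size (a * (K + 2) + (K + 2)) (card (parcs G))) s') \<and>
      (\<forall>(P', s')\<in>set_pmf (run (reduction_time R k b Q E C T (card (parcs G))) ?D ?s). P' = Skip) \<and>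
      2 / 3 \<le> measure_pmf.prob (run (reduction_time R k b Q E C T (card (parcs G))) ?D ?s)
        {(P', s'). (regs s' 0 \<noteq> 0) = has_k_cycle k G}"
    using g(1) unfolding good_def card[OF i] w_def m_def by blast
qed

section \<open>Running time of the reduction\<close>

lemma base_of_root:
  assumes "0 < E" "0 < m"
  shows "real (base_of E m) \<le> 2 ^ (E + 1) * real m powr (1 / E)"
proof (rule power_le_imp_le_base)
  have p: "(real m powr (1 / E)) ^ E = real m" using assms by (simp add: powr_power)
  have "real (base_of E m ^ E) \<le> real (2 * m * 2 ^ E)" using base_of_power_le[OF assms] by (simp only: of_nat_le_iff)
  then have "real (base_of E m) ^ E \<le> 2 ^ (E + 1) * real m" by (simp add: mult_ac)
  \<comment> \<open>Raising the constant to the power \<open>E\<close> is wasteful but spares taking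
    its root.\<close>
  also have "\<dots> \<le> (2 ^ (E + 1)) ^ E * real m"
    using assms by (intro mult_right_mono self_le_power one_le_power) auto
  also have "\<dots> = (2 ^ (E + 1) * real m powr (1 / E)) ^ E" unfolding power_mult_distrib p ..
  finally show "real (base_of E m) ^ Suc (E - 1) \<le> (2 ^ (E + 1) * real m powr (1 / E)) ^ Suc (E - 1)" using assms by simp
qed simp

text \<open>A bound for all \<open>m\<close> is required, as the maximum in
  \<open>reduction_time\<close> includes small arguments. The summand 1 takes care of those, in
  particular of 0.\<close>

lemma bigo_powr_bound:
  fixes T :: "nat \<Rightarrow> nat"
  assumes "(\<lambda>m. real (T m)) \<in> O(\<lambda>m. real m powr q)"
  shows "\<exists>D\<ge>0. \<forall>m. real (T m) \<le> D * (real m powr q + 1)"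
proof -
  obtain d where d: "d > 0" "eventually (\<lambda>m. norm (real (T m)) \<le> d * norm (real m powr q)) at_top"
    using assms by (elim landau_o.bigE)
  then obtain m0 where m0: "\<And>m. m \<ge> m0 \<Longrightarrow> real (T m) \<le> d * real m powr q"
    by (auto simp: eventually_at_top_linorder)
  define D where "D = d + (\<Sum>i<m0. real (T i))"
  have nn: "0 \<le> (\<Sum>i<m0. real (T i))" by (rule sum_nonneg) simp
  have "real (T m) \<le> D * (real m powr q + 1)" for m
  proof (cases "m < m0")
    case True
    then have "real (T m) \<le> (\<Sum>i<m0. real (T i))" by (intro member_le_sum) auto
    also have "\<dots> \<le> D * 1" using d by (simp add: D_def)
    also have "\<dots> \<le> D * (real m powr q + 1)" using d nn by (intro mult_left_mono) (auto simp: D_def)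
    finally show ?thesis .
  next
    case False
    then have "real (T m) \<le> d * real m powr q" using m0 by simp
    also have "\<dots> \<le> D * (real m powr q + 1)" using d nn by (intro mult_mono) (auto simp: D_def)
    finally show ?thesis .
  qed
  then show ?thesis using d nn by (intro exI[of _ D]) (auto simp: D_def)
qed

text \<open>With O(m^\<theta>) copies, \<open>H\<close> has O(m^(1+\<theta>)) arcs, and the calls
  take time of order m^((1+\<theta>)q) on it. Since \<open>q \<ge> 1\<close>, this also dominates
  the construction of \<open>H\<close>.\<close>

lemma reduction_time_bound:
  assumes T: "(\<lambda>m. real (T m)) \<in> O(\<lambda>m. real m powr q)" and q: "1 \<le> q" and E: "0 < E" and Q: "0 < Q"
    and \<theta>: "\<theta> = (if R = Randomized then 0 else 1 / real E)" and e: "(1 + \<theta>) * q \<le> e"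
  shows "(\<lambda>m. real (reduction_time R k b Q E C T m)) \<in> O(\<lambda>m. real m powr e)"
proof -
  obtain D where D: "0 \<le> D" "\<And>m. real (T m) \<le> D * (real m powr q + 1)"
    using bigo_powr_bound[OF T] by blast
  define K where "K = real (C * Q) * 2 ^ (E + 1)"
  define bc where "bc = real (build_const R k b Q E C)"
  define cc where "cc = real (\<Sum>j<3. cost (finish_prog k j) + cost (setup_prog E j))"
  define F where "F = 3 * (bc * (1 + 3 * K) + 7 * (D * ((3 * K) powr q + 1)) + 5 * (2 ^ (E + 2))) + cc + 66"
  have "real (reduction_time R k b Q E C T m) \<le> F * real m powr e" if m: "1 \<le> m" for m
  proof -
    define B N M y where "B = base_of E m" and "N = copies_count R Q B C" and "M = 3 * N * m" and "y = real m powr e"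
    have th: "0 \<le> \<theta>" using \<theta> by simp
    have "1 + \<theta> \<le> (1 + \<theta>) * q" using mult_left_mono[OF q, of "1 + \<theta>"] th by simp
    then have e1: "1 + \<theta> \<le> e" using e by simp
    have y: "1 \<le> y" "real m \<le> y" "real m powr (1 + \<theta>) \<le> y" "real m powr ((1 + \<theta>) * q) \<le> y"
    proof -
      show "1 \<le> y" unfolding y_def using m e1 th by (intro ge_one_powr_ge_zero) auto
      have "real m powr 1 \<le> y" unfolding y_def using m e1 th by (intro powr_mono) auto
      then show "real m \<le> y" using m by simp
      show "real m powr (1 + \<theta>) \<le> y" unfolding y_def using m e1 by (intro powr_mono) auto
      show "real m powr ((1 + \<theta>) * q) \<le> y" unfolding y_def using m e by (intro powr_mono) auto
    qed
    have "real B \<le> 2 ^ (E + 1) * real m powr (1 / E)" unfolding B_def using base_of_root[OF E] m by simp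
    then have QB: "real (C * Q) * real B \<le> real (C * Q) * (2 ^ (E + 1) * real m powr (1 / E))"
      by (rule mult_left_mono) simp
    have N: "real N \<le> K * real m powr \<theta>"
    proof (cases R)
      case Randomized
      have "1 \<le> real Q" using Q by simp
      then have "1 * 1 \<le> real Q * 2 ^ (E + 1)" by (intro mult_mono one_le_power) auto
      then have "real C * 1 \<le> real C * (real Q * 2 ^ (E + 1))" by (intro mult_left_mono) auto
      then show ?thesis using Randomized m by (simp add: N_def copies_count_def \<theta> K_def mult_ac)
    next
      case Deterministic
      then show ?thesis using QB by (simp add: N_def copies_count_def \<theta> K_def mult_ac)
    qed
    have Nm: "real (N * m) \<le> K * real m powr (1 + \<theta>)"
    proof -
      have "real (N * m) \<le> K * real m powr \<theta> * real m" using N by (simp add: mult_right_mono)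
      also have "\<dots> = K * real m powr (1 + \<theta>)" using m by (simp add: powr_add)
      finally show ?thesis .
    qed
    have K0: "0 \<le> K" by (simp add: K_def)
    have Ny: "real (N * m) \<le> K * y" using Nm mult_left_mono[OF y(3) K0] by linarith
    have TM: "real (Max (T ` {..M})) \<le> D * ((3 * K) powr q + 1) * y"
    proof -
      have "Max (T ` {..M}) \<in> T ` {..M}" by (intro Max_in) auto
      then obtain m' where m': "Max (T ` {..M}) = T m'" "m' \<in> {..M}" by (rule imageE)
      have "real m' \<le> 3 * real (N * m)" using m'(2) by (simp add: M_def flip: of_nat_mult)
      then have "real m' \<le> (3 * K) * real m powr (1 + \<theta>)" using Nm by linarith
      then have "real m' powr q \<le> ((3 * K) * real m powr (1 + \<theta>)) powr q" using q by (intro powr_mono2) auto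
      also have "\<dots> = (3 * K) powr q * real m powr ((1 + \<theta>) * q)" using K0 by (simp add: powr_mult powr_powr)
      also have "\<dots> \<le> (3 * K) powr q * y" using y(4) by (intro mult_left_mono) auto
      finally have "real m' powr q + 1 \<le> ((3 * K) powr q + 1) * y" using y(1) by (simp add: algebra_simps)
      then have "D * (real m' powr q + 1) \<le> D * (((3 * K) powr q + 1) * y)" using D(1) by (rule mult_left_mono)
      then show ?thesis using D(2)[of m'] by (simp add: m'(1) mult.assoc)
    qed
    have "B \<le> 2 ^ (E + 1) * (m + 1)" unfolding B_def by (rule base_of_le[OF E])
    then have "real B \<le> real (2 ^ (E + 1) * (m + 1))" by (simp only: of_nat_le_iff)
    also have "\<dots> = 2 ^ (E + 1) * (real m + 1)" by (simp add: algebra_simps)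
    also have "\<dots> \<le> 2 ^ (E + 1) * (2 * y)" using y by (intro mult_left_mono) auto
    finally have By: "real B \<le> 2 ^ (E + 2) * y" by simp
    have b: "bc * (1 + 3 * real (N * m)) \<le> bc * ((1 + 3 * K) * y)"
      using Ny y(1) by (intro mult_left_mono) (auto simp: bc_def algebra_simps)
    have "real (reduction_time R k b Q E C T m)
        = 3 * (bc * (1 + 3 * real (N * m)) + 7 * real (Max (T ` {..M})) + 5 * real B) + cc + 66"
      unfolding reduction_time_def Let_def B_def[symmetric] N_def[symmetric] M_def[symmetric]
      by (simp add: bc_def cc_def M_def algebra_simps)
    also have "\<dots> \<le> 3 * (bc * ((1 + 3 * K) * y) + 7 * (D * ((3 * K) powr q + 1) * y) + 5 * (2 ^ (E + 2) * y)) + cc * y + 66 * y"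
    proof -
      have "0 \<le> cc" unfolding cc_def by (rule of_nat_0_le_iff)
      then have cy: "cc \<le> cc * y" using mult_left_mono[OF y(1)] by fastforce
      have "3 * (p + 7 * r + 5 * u) + x + 66 \<le> 3 * (p' + 7 * r' + 5 * u') + x' + 66 * z"
        if "p \<le> p'" "r \<le> r'" "u \<le> u'" "x \<le> x'" "1 \<le> z" for p p' r r' u u' x x' z :: real
        using that by (intro add_mono mult_left_mono) auto
      from this[OF b TM By cy y(1)] show ?thesis .
    qed
    also have "\<dots> = F * y" by (simp add: F_def algebra_simps)
    finally show ?thesis by (simp add: y_def)
  qed
  then show ?thesis
    by (intro bigoI[of _ F] eventually_at_top_linorderI[of 1]) auto
qed

lemma reduction:
  assumes A: "girth_approximable_in_time R c (\<lambda>m. real m powr q)" and c: "c < 2" and q: "1 \<le> q"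
    and k: "2 \<le> k" and E: "0 < E"
    and e: "(1 + (if R = Randomized then 0 else 1 / real E)) * q \<le> e"
  shows "k_cycle_detectable_in_time R k (\<lambda>m. real m powr e)"
proof -
  obtain P a T where P: "R = Deterministic \<longrightarrow> rand_free P" "(\<lambda>m. real (T m)) \<in> O(\<lambda>m. real m powr q)"
    "solves P a T (\<lambda>G x. girth_approximation c G (if x = 0 then \<infinity> else enat x))"
    using A unfolding girth_approximable_in_time_def solvable_in_time_def by blast
  define Q where "Q = 80 * k\<^sup>2"
  have "0 < Q" using k by (simp add: Q_def)
  then have "(\<lambda>m. real (reduction_time R k k Q E (2 ^ (k * Q ^ E)) T m)) \<in> O(\<lambda>m. real m powr e)"
    by (rule reduction_time_bound[OF P(2) q E _ refl e])
  moreover note detect_solves[OF P(3) k E c refl Q_def refl refl, of R]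
  moreover have "R = Deterministic \<longrightarrow> rand_free (detect_prog R k k Q E (2 ^ (k * Q ^ E)) P)"
    using P(1) rand_free_detect by blast
  ultimately show ?thesis
    unfolding k_cycle_detectable_in_time_def solvable_in_time_def by blast
qed

theorem theorem1p1:
  fixes \<epsilon> \<delta> :: real
  assumes "\<epsilon> > 0" and "\<delta> > 0"
  shows
    "(girth_approximable_in_time Randomized (2 - \<delta>) (\<lambda>m. real m powr (2 - \<epsilon>)) \<longrightarrow>
        (\<forall>k. k_cycle_detectable_in_time Randomized k (\<lambda>m. real m powr (2 - \<epsilon>))) \<and>
        \<not> k_Cycle_Hypothesis Randomized) \<and>
     (girth_approximable_in_time Deterministic (2 - \<delta>) (\<lambda>m. real m powr (2 - \<epsilon>)) \<longrightarrow>
        (\<forall>k. \<forall>\<epsilon>'<\<epsilon>. k_cycle_detectable_in_time Deterministic k (\<lambda>m. real m powr (2 - \<epsilon>'))) \<and>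
        \<not> k_Cycle_Hypothesis Deterministic)"
proof (intro conjI impI allI)
  have low: "\<epsilon> \<le> 1" if "girth_approximable_in_time M (2 - \<delta>) (\<lambda>m. real m powr (2 - \<epsilon>))" for M
    using no_sublinear_girth_approximation[of \<epsilon> M "2 - \<delta>"] that by fastforce
  show rand: "k_cycle_detectable_in_time Randomized k (\<lambda>m. real m powr (2 - \<epsilon>))"
    if A: "girth_approximable_in_time Randomized (2 - \<delta>) (\<lambda>m. real m powr (2 - \<epsilon>))" for k
  proof (cases "k < 2")
    case True
    then show ?thesis by (rule no_short_cycle)
  next
    case False
    then show ?thesis
      using low[OF A] assms(2) by (intro reduction[OF A, of _ 1]) auto
  qed
  then show "\<not> k_Cycle_Hypothesis Randomized"
    if "girth_approximable_in_time Randomized (2 - \<delta>) (\<lambda>m. real m powr (2 - \<epsilon>))"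
    using that assms(1) unfolding k_Cycle_Hypothesis_def by blast
  show det: "k_cycle_detectable_in_time Deterministic k (\<lambda>m. real m powr (2 - \<epsilon>'))"
    if A: "girth_approximable_in_time Deterministic (2 - \<delta>) (\<lambda>m. real m powr (2 - \<epsilon>))" and e: "\<epsilon>' < \<epsilon>"
    for k \<epsilon>'
  proof (cases "k < 2")
    case True
    then show ?thesis by (rule no_short_cycle)
  next
    case False
    \<comment> \<open>The digits raise the exponent by (2-\<epsilon>)/E, which is at most 2/E and
      thus covered by the gap between \<epsilon> and \<epsilon>'.\<close>
    define E where "E = Suc (nat \<lceil>2 / (\<epsilon> - \<epsilon>')\<rceil>)"
    have "2 / (\<epsilon> - \<epsilon>') \<le> real E" unfolding E_def by linarith
    then have "2 \<le> (\<epsilon> - \<epsilon>') * real E" using e by (simp add: field_simps)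
    then have "2 / real E \<le> \<epsilon> - \<epsilon>'" by (simp add: E_def field_simps)
    moreover have "1 / real E * (2 - \<epsilon>) \<le> 1 / real E * 2" using assms(1) by (intro mult_left_mono) auto
    ultimately have "(1 + 1 / real E) * (2 - \<epsilon>) \<le> 2 - \<epsilon>'" by (simp add: algebra_simps)
    then show ?thesis
      using False low[OF A] assms(2) by (intro reduction[OF A, of _ E]) (auto simp: E_def)
  qed
  show "\<not> k_Cycle_Hypothesis Deterministic"
    if A: "girth_approximable_in_time Deterministic (2 - \<delta>) (\<lambda>m. real m powr (2 - \<epsilon>))"
  proof -
    have "k_cycle_detectable_in_time Deterministic k (\<lambda>m. real m powr (2 - \<epsilon> / 2))" for k
      using det[OF A, of "\<epsilon> / 2"] assms(1) by simp
    then show ?thesis using assms(1) unfolding k_Cycle_Hypothesis_def by (auto intro: exI[of _ "\<epsilon> / 2"])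
  qed
qed

end
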